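(* Let $V(\mathbb{C})=\{(s_1,s_2)\in\mathbb{C}^2 : s_1s_2(1-s_1)(1-s_2)(s_1-s_2)(1-s_1s_2)\neq 0\}$, let $(x,y)\in V(\mathbb{C})$, and let $\gamma_0\in\pi_1^{\mathrm{top}}(V(\mathbb{C});\vec v,(x,y))$ be a homotopy class of paths from the tangential base point $\vec v$ (over $(t^2,t)$) to $(x,y)$. Define the path system $\{\gamma_i\}_{i=1,\dots,9}$ associated with $\gamma_0$ by $$\gamma_i:=\delta_i\cdot f_i(\gamma_0)\in\pi_1^{\mathrm{top}}\big(\mathbb{P}^1(\mathbb{C})\setminus\{0,1,\infty\};\overrightarrow{01},f_i(x,y)\big),$$ with the maps $f_i$ and the paths $\delta_i$ given in the context. Then the following hold. (a-$\mathbb{C}$) (Schaeffer equation) $$Li_2\Big(\tfrac{x(1-y)}{y(1-x)};\gamma_4\Big)-Li_2(y;\gamma_9)+Li_2(x;\gamma_8)-Li_2\Big(\tfrac xy;\gamma_3\Big)-Li_2\Big(\tfrac{1-y}{1-x};\gamma_6\Big)=\log(y;\gamma_9)\log\Big(\tfrac{1-y}{1-x};\gamma_6\Big)-\tfrac{\pi^2}{6}.$$ (b-$\mathbb{C}$) (Kummer equation) $$Li_2\Big(\tfrac{x(1-y)^2}{y(1-x)^2};\gamma_1\Big)-Li_2\Big(\tfrac{x(1-y)}{x-1};\gamma_5\Big)-Li_2\Big(\tfrac{1-y}{y(x-1)};\gamma_7\Big)-Li_2\Big(\tfrac{x(1-y)}{y(1-x)};\gamma_4\Big)-Li_2\Big(\tfrac{1-y}{1-x};\gamma_6\Big)=\tfrac12\log^2(y;\gamma_9).$$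 (c-$\mathbb{C}$) (Hill equation) \begin{align*} &Li_2\Big(\tfrac{1-y}{y(x-1)};\gamma_7\Big)+Li_2(xy;\gamma_2)-Li_2(x;\gamma_8)-Li_2(y;\gamma_9)-Li_2\Big(\tfrac{x(1-y)}{x-1};\gamma_5\Big)\\ &=-\tfrac{\pi^2}{6}+\log(y;\gamma_9)\log\Big(\tfrac{1-y}{1-x};\gamma_6\Big)-\tfrac12\log^2(y;\gamma_9). \end{align*}
   Context: **Paths.** For a complex space $W$ and two (possibly tangential) base points $*,*'$, $\pi_1^{\mathrm{top}}(W;*,*')$ is the set of homotopy classes of topological paths on $W$ from $*$ to $*'$. Paths are composed from left to right: $\gamma\cdot\gamma'$ means first $\gamma$, then $\gamma'$. **Tangential base points on $\mathbb{P}^1(\mathbb{C})\setminus\{0,1,\infty\}$.** $\overrightarrow{ab}$ is the tangential base point at $a$ pointing towards $b$ along the real segment of $\mathbb{P}^1(\mathbb{R})\setminus\{0,1,\infty\}$ joining $a$ and $b$: $\overrightarrow{01}$ is at $0$ in the positive real direction, $\overrightarrow{10}$ is at $1$ pointing towards $0$ along $(0,1)$, $\overrightarrow{0\infty}$ is at $0$ in the negative real direction, $\overrightarrow{\infty 0}$ is at $\infty$ pointing towards $0$ along the negative reals. **Base point $\vec v$.** $\vec v$ is the tangential base point of $V(\mathbb{C})$ over the point $(t^2,t)$, i.e. a path starting at $\vec v$ starts as $t\mapsto(t^2,t)$ for small real $t>0$. **Maps.** $f_1,\dots,f_9:V(\mathbb{C})\to\mathbb{P}^1(\mathbb{C})\setminus\{0,1,\infty\}$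 are $f_1=\frac{s_1(1-s_2)^2}{s_2(1-s_1)^2}$, $f_2=s_1s_2$, $f_3=\frac{s_1}{s_2}$, $f_4=\frac{s_1(1-s_2)}{s_2(1-s_1)}$, $f_5=\frac{s_1(1-s_2)}{s_1-1}$, $f_6=\frac{1-s_2}{1-s_1}$, $f_7=\frac{1-s_2}{s_2(s_1-1)}$, $f_8=s_1$, $f_9=s_2$. At $(t^2,t)$ their values are $\frac{t}{(1+t)^2},\,t^3,\,t,\,\frac{t}{1+t},\,\frac{-t^2}{1+t},\,\frac1{1+t},\,\frac{-1}{t(1+t)},\,t^2,\,t$; accordingly $f_i(\vec v)$ is identified with $\overrightarrow{01}$ for $i=1,2,3,4,8,9$, with $\overrightarrow{0\infty}$ for $i=5$, with $\overrightarrow{10}$ for $i=6$, and with $\overrightarrow{\infty0}$ for $i=7$. **Paths $\delta_i$ from $\overrightarrow{01}$ to $f_i(\vec v)$.** $\delta_i$ is trivial for $i=1,2,3,4,8,9$. $\delta_5=\delta_{\overrightarrow{0\infty}}$ is the half-turn around $0$ through the upper half-plane (counterclockwise) from $\overrightarrow{01}$ to $\overrightarrow{0\infty}$. $\delta_6=\delta_{\overrightarrow{10}}$ is the straight path along $(0,1)$ from $\overrightarrow{01}$ to $\overrightarrow{10}$. $\delta_7=\delta_{\overrightarrow{\infty0}}$ is the path from $\overrightarrow{01}$ to $\overrightarrow{\infty0}$ through the upper half-plane. **Logarithm and dilogarithm along a path.** For $\gamma\in\pi_1^{\mathrm{top}}(\mathbb{P}^1(\mathbb{C})\setminus\{0,1,\infty\};\overrightarrow{01},z)$,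 put $\log(z;\gamma):=\int_{\delta_{\overrightarrow{10}}^{-1}\cdot\gamma}\frac{dt}{t}$ (i.e. the continuation along $\gamma$ of the logarithm that is real on $(0,1)$ near $0$), $Li_1(z;\gamma):=\int_\gamma\frac{dt}{1-t}$, and $Li_2(z;\gamma):=\int_\gamma\frac1t Li_{1}(t;\gamma_t)\,dt$, where $\gamma_t$ is the initial part of $\gamma$ up to $t$. $\log^2(\cdot)$ denotes the square. *)

theory Defs
  imports "HOL-Complex_Analysis.Complex_Analysis"
begin

section \<open>Paths between possibly tangential base points\<close>

text \<open>
  A tangential base point is given by a germ of a curve \<open>b t\<close> for \<open>t \<rightarrow> 0+\<close>. Only the restriction
  of \<open>b\<close> to \<open>{0<..<1}\<close> matters, and it is meant to be a homeomorphism onto its image. A path that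
  starts at \<open>Tangential b\<close> is defined for positive times only, and for small times it runs on the
  curve, towards its origin as the time tends to \<open>0\<close>; its parametrisation is not prescribed.
  In this way the image of \<open>\<lambda>t. (t\<^sup>2, t)\<close> under \<open>(s\<^sub>1, s\<^sub>2) \<mapsto> s\<^sub>1 s\<^sub>2\<close>, say, starts at \<open>tb01\<close> below.
\<close>

datatype 'a basepoint = Pt 'a | Tangential "real \<Rightarrow> 'a"

fun is_Pt :: "'a basepoint \<Rightarrow> bool" where
  "is_Pt (Pt _) = True"
| "is_Pt (Tangential _) = False"

definition path_dom :: "'a basepoint \<Rightarrow> 'a basepoint \<Rightarrow> real set" where
  "path_dom a b =
     {0<..<1} \<union> (if is_Pt a then {0} else {}) \<union> (if is_Pt b then {1} else {})"

fun starts_at :: "real \<Rightarrow> 'a::topological_space basepoint \<Rightarrow> (real \<Rightarrow> 'a) \<Rightarrow> bool" where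
  "starts_at e (Pt w) p \<longleftrightarrow> p 0 = w"
| "starts_at e (Tangential b) p \<longleftrightarrow>
     (\<exists>u. continuous_on {0<..e} u \<and> (u \<longlongrightarrow> (0::real)) (at_right 0) \<and>
          (\<forall>t\<in>{0<..e}. 0 < u t \<and> u t < 1 \<and> p t = b (u t)))"

definition joins :: "real \<Rightarrow> 'a::topological_space basepoint \<Rightarrow> 'a basepoint \<Rightarrow> (real \<Rightarrow> 'a) \<Rightarrow> bool" where
  "joins e a b p \<longleftrightarrow> starts_at e a p \<and> starts_at e b (reversepath p)"

definition tpaths ::
  "'a::topological_space set \<Rightarrow> 'a basepoint \<Rightarrow> 'a basepoint \<Rightarrow> (real \<Rightarrow> 'a) set" where
  "tpaths W a b =
     {p. continuous_on (path_dom a b) p \<and> p ` path_dom a b \<subseteq> W \<and> (\<exists>e\<in>{0<..<1}. joins e a b p)}"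

text \<open>
  In a homotopy all intermediate paths run on the curve of a tangential base point during a common
  time interval \<open>{0<..e}\<close>; otherwise loops around the puncture could be contracted into it.
\<close>

definition thomotopic ::
  "'a::topological_space set \<Rightarrow> 'a basepoint \<Rightarrow> 'a basepoint \<Rightarrow> (real \<Rightarrow> 'a) \<Rightarrow> (real \<Rightarrow> 'a) \<Rightarrow> bool" where
  "thomotopic W a b p q \<longleftrightarrow>
     (\<exists>e\<in>{0<..<1}. homotopic_with (joins e a b) (top_of_set (path_dom a b)) (top_of_set W) p q)"

definition pi1 ::
  "'a::topological_space set \<Rightarrow> 'a basepoint \<Rightarrow> 'a basepoint \<Rightarrow> (real \<Rightarrow> 'a) set set" where
  "pi1 W a b = tpaths W a b // {(p, q). p \<in> tpaths W a b \<and> q \<in> tpaths W a b \<and> thomotopic W a b p q}"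

definition pclass ::
  "'a::topological_space set \<Rightarrow> 'a basepoint \<Rightarrow> 'a basepoint \<Rightarrow> (real \<Rightarrow> 'a) \<Rightarrow> (real \<Rightarrow> 'a) set" where
  "pclass W a b p = {q. thomotopic W a b p q}"

text \<open>
  To compose paths at a tangential base point, cut both at a common point of the final, respectively
  initial, segments lying on the curve.
\<close>

fun composite ::
  "'a::real_normed_vector basepoint \<Rightarrow> (real \<Rightarrow> 'a) \<Rightarrow> (real \<Rightarrow> 'a) \<Rightarrow> (real \<Rightarrow> 'a) \<Rightarrow> bool" where
  "composite (Pt w) p q r \<longleftrightarrow> r = p +++ q"
| "composite (Tangential b) p q r \<longleftrightarrow>
     (\<exists>\<tau>\<in>{0<..<1}. \<exists>\<sigma>\<in>{0<..<1}.
        starts_at (1 - \<tau>) (Tangential b) (reversepath p) \<and> starts_at \<sigma> (Tangential b) q \<and>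
        p \<tau> = q \<sigma> \<and> r = subpath 0 \<tau> p +++ subpath \<sigma> 1 q)"

definition pcomp ::
  "'a::real_normed_vector set \<Rightarrow> 'a basepoint \<Rightarrow> 'a basepoint \<Rightarrow> 'a basepoint
    \<Rightarrow> (real \<Rightarrow> 'a) set \<Rightarrow> (real \<Rightarrow> 'a) set \<Rightarrow> (real \<Rightarrow> 'a) set" where
  "pcomp W a b c C D = (\<Union>p\<in>C. \<Union>q\<in>D. \<Union>r\<in>{r. composite b p q r}. pclass W a c r)"

definition pinv :: "(real \<Rightarrow> 'a::topological_space) set \<Rightarrow> (real \<Rightarrow> 'a) set" where
  "pinv C = reversepath ` C"

text \<open>
  Image of a class under \<open>f\<close>; \<open>a\<close> and \<open>b\<close> are the base points of the target with which the images
  of the given base points are identified.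
\<close>

definition pimage ::
  "'b::topological_space set \<Rightarrow> 'b basepoint \<Rightarrow> 'b basepoint \<Rightarrow> ('a \<Rightarrow> 'b)
    \<Rightarrow> (real \<Rightarrow> 'a) set \<Rightarrow> (real \<Rightarrow> 'b) set" where
  "pimage W a b f C = (\<Union>p\<in>C. pclass W a b (f \<circ> p))"


section \<open>The projective line without \<open>0, 1, \<infinity>\<close>\<close>

text \<open>
  Since paths never take the value of a puncture, the affine line suffices; a path starting at
  \<open>tbinf0\<close> tends to infinity as its time tends to \<open>0\<close>.
\<close>

definition P1m :: "complex set" where
  "P1m = - {0, 1}"

definition tb01 :: "complex basepoint" where "tb01 = Tangential (\<lambda>t. of_real t)"
definition tb10 :: "complex basepoint" where "tb10 = Tangential (\<lambda>t. of_real (1 - t))"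
definition tb0inf :: "complex basepoint" where "tb0inf = Tangential (\<lambda>t. of_real (- t))"
definition tbinf0 :: "complex basepoint" where "tbinf0 = Tangential (\<lambda>t. of_real (- 1 / t))"

text \<open>
  The angle \<open>half_turn\<close> increases from \<open>0\<close> to \<open>pi\<close> on \<open>{1/3..2/3}\<close> and is constant elsewhere, so
  that \<open>delta_0inf\<close> and \<open>delta_inf0\<close> leave along the positive reals, pass through the upper half
  plane and arrive along the negative reals.
\<close>

definition half_turn :: "real \<Rightarrow> real" where
  "half_turn t = pi * max 0 (min 1 (3 * t - 1))"

definition delta_01 :: "(real \<Rightarrow> complex) set" where
  "delta_01 = pclass P1m tb01 tb01 (\<lambda>t. of_real (t * (1 - t)))"
definition delta_10 :: "(real \<Rightarrow> complex) set" where
  "delta_10 = pclass P1m tb01 tb10 (\<lambda>t. of_real t)"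
definition delta_0inf :: "(real \<Rightarrow> complex) set" where
  "delta_0inf = pclass P1m tb01 tb0inf (\<lambda>t. of_real (t * (1 - t)) * cis (half_turn t))"
definition delta_inf0 :: "(real \<Rightarrow> complex) set" where
  "delta_inf0 = pclass P1m tb01 tbinf0 (\<lambda>t. of_real (t / (1 - t)) * cis (half_turn t))"


section \<open>Logarithm and dilogarithm along a path\<close>

text \<open>
  The value of an integral on a homotopy class is its common value on the piecewise continuously
  differentiable paths of the class. Continuity at \<open>0\<close>, which is part of \<open>valid_path\<close>, forces such a
  path to take the value \<open>0\<close> (resp. \<open>1\<close>) there if the class starts at \<open>tb01\<close> (resp. \<open>tb10\<close>).
\<close>

definition class_value ::
  "((real \<Rightarrow> complex) \<Rightarrow> complex) \<Rightarrow> complex \<Rightarrow> (real \<Rightarrow> complex) set \<Rightarrow> complex" where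
  "class_value \<Phi> z C = (THE I. \<exists>g\<in>C. valid_path g \<and> pathfinish g = z \<and> I = \<Phi> g)"

definition log_along :: "complex \<Rightarrow> (real \<Rightarrow> complex) set \<Rightarrow> complex" where
  "log_along z C =
     class_value (\<lambda>g. contour_integral g (\<lambda>t. 1 / t)) z
       (pcomp P1m tb10 tb01 (Pt z) (pinv delta_10) C)"

definition Li1_path :: "(real \<Rightarrow> complex) \<Rightarrow> complex" where
  "Li1_path g = contour_integral g (\<lambda>t. 1 / (1 - t))"

definition Li2_path :: "(real \<Rightarrow> complex) \<Rightarrow> complex" where
  "Li2_path g =
     integral {0..1}
       (\<lambda>s. 1 / g s * Li1_path (subpath 0 s g) * vector_derivative g (at s within {0..1}))"

definition Li2 :: "complex \<Rightarrow> (real \<Rightarrow> complex) set \<Rightarrow> complex" where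
  "Li2 = class_value Li2_path"


section \<open>The variety and its nine maps\<close>

definition V :: "(complex \<times> complex) set" where
  "V = {(s1, s2). s1 * s2 * (1 - s1) * (1 - s2) * (s1 - s2) * (1 - s1 * s2) \<noteq> 0}"

definition tbv :: "(complex \<times> complex) basepoint" where
  "tbv = Tangential (\<lambda>t. (of_real (t\<^sup>2), of_real t))"

definition Vmap :: "nat \<Rightarrow> complex \<times> complex \<Rightarrow> complex" where
  "Vmap i = (\<lambda>(s1, s2).
     if i = 1 then s1 * (1 - s2)\<^sup>2 / (s2 * (1 - s1)\<^sup>2)
     else if i = 2 then s1 * s2
     else if i = 3 then s1 / s2
     else if i = 4 then s1 * (1 - s2) / (s2 * (1 - s1))
     else if i = 5 then s1 * (1 - s2) / (s1 - 1)
     else if i = 6 then (1 - s2) / (1 - s1)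
     else if i = 7 then (1 - s2) / (s2 * (s1 - 1))
     else if i = 8 then s1
     else s2)"

text \<open>The base point of \<open>P1m\<close> with which the image of \<open>tbv\<close> under \<open>Vmap i\<close> is identified.\<close>

definition Vbase :: "nat \<Rightarrow> complex basepoint" where
  "Vbase i = (if i = 5 then tb0inf else if i = 6 then tb10 else if i = 7 then tbinf0 else tb01)"

definition delta :: "nat \<Rightarrow> (real \<Rightarrow> complex) set" where
  "delta i =
     (if i = 5 then delta_0inf else if i = 6 then delta_10 else if i = 7 then delta_inf0
      else delta_01)"

definition path_system ::
  "complex \<times> complex \<Rightarrow> (real \<Rightarrow> complex \<times> complex) set \<Rightarrow> nat \<Rightarrow> (real \<Rightarrow> complex) set" where
  "path_system w \<gamma>0 i =
     pcomp P1m tb01 (Vbase i) (Pt (Vmap i w)) (delta i)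
       (pimage P1m (Vbase i) (Pt (Vmap i w)) (Vmap i) \<gamma>0)"

end

theory Submission
  imports Defs
begin

text \<open>
  Each of the three identities says that a combination of values \<open>Li2 (f\<^sub>i (x, y); \<gamma>\<^sub>i)\<close> equals an
  expression in logarithms. Along a path in \<open>V\<close> the function \<open>Li2 (f\<^sub>i)\<close> has the differential
  \<open>- log (1 - f\<^sub>i) d log f\<^sub>i\<close>, and all \<open>f\<^sub>i\<close> and \<open>1 - f\<^sub>i\<close> are, up to sign, products of powers of \<open>x\<close>, \<open>y\<close>,
  \<open>1 - x\<close>, \<open>1 - y\<close>, \<open>y - x\<close>, \<open>1 - x y\<close>. With one continuous logarithm for each factor, the difference
  of the two sides has derivative \<open>0\<close> identically (\<open>equations_at_parameter\<close>), so it equals its value at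
  any point \<open>(v\<^sup>2, v)\<close> of the tangential curve through which the path may be assumed to run. There all
  branches are principal; as \<open>v\<close> tends to \<open>0\<close> every dilogarithm tends to \<open>0\<close> except
  \<open>Li2 (f\<^sub>6) \<rightarrow> Li2 1 = pi\<^sup>2 / 6\<close> and \<open>Li2 (f\<^sub>7)\<close>, whose argument \<open>- 1 / (v (1 + v))\<close> goes to infinity
  and which is controlled by the inversion formula \<open>dilog_inversion\<close>. This gives the constants.

  Two facts make this meaningful for the values on homotopy classes, which are defined by a unique choice
  over the smooth paths of a class. The first is that all smooth paths of a class give the same integral.
  The iterated integral defining \<open>Li2\<close> becomes an ordinary contour integral once the path is lifted through
  \<open>z = 1 - exp w\<close>: the integrand turns into the form \<open>w exp w / (1 - exp w) dw\<close>, which is holomorphic on the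
  plane with the points \<open>2 pi i k\<close> (\<open>k \<noteq> 0\<close>) removed. In particular it is holomorphic at \<open>w = 0\<close>, so that the
  tangential base point at \<open>0\<close> lifts to an honest starting point and homotopy invariance follows from
  covering space theory and Cauchy's theorem (\<open>Li2_path_unique\<close>, \<open>log_path_unique\<close>). To apply them, a path with
  tangential end points is truncated near its ends and joined there to fixed points by segments; its
  homotopy class then determines an ordinary homotopy class of paths with fixed end points, compatibly with
  composition and with the maps \<open>f\<^sub>i\<close> (\<open>truncates_to_path_system\<close>).

  The second is that each class \<open>\<gamma>\<^sub>i\<close> contains an explicit smooth path. The given class in \<open>V\<close> contains, for
  every small \<open>v\<close>, a path that follows the tangential curve up to \<open>(v\<^sup>2, v)\<close> and continues along a polynomial path
  (\<open>curve_then_in_class\<close>). Hence \<open>\<gamma>\<^sub>i\<close> contains the initial part of the standard path \<open>\<delta>\<^sub>i\<close> up to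
  \<open>f\<^sub>i (v\<^sup>2, v)\<close> followed by the image of that polynomial path, and the fundamental theorem of calculus
  evaluates the integral there.
\<close>

section \<open>Truncating paths at tangential base points\<close>

text \<open>
  Joining the truncation of a path to fixed points \<open>k\<close> and \<open>l\<close> by segments replaces a path that is defined
  only for interior times by an ordinary path. The segments will stay in convex sets that contain the ends of
  the path, so neither the cut nor the choice of the fixed point matters up to homotopy.
\<close>

definition anchored :: "'a::real_normed_vector \<Rightarrow> 'a \<Rightarrow> real \<Rightarrow> real \<Rightarrow> (real \<Rightarrow> 'a) \<Rightarrow> real \<Rightarrow> 'a" where
  "anchored k l lo hi p = linepath k (p lo) +++ subpath lo hi p +++ linepath (p hi) l"

lemma homotopic_paths_in_convex:
  fixes K :: "'a::real_normed_vector set"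
  assumes "convex K" "K \<subseteq> X" "path p" "path_image p \<subseteq> K" "path q" "path_image q \<subseteq> K"
    and "pathstart q = pathstart p" "pathfinish q = pathfinish p"
  shows "homotopic_paths X p q"
  using convex_imp_simply_connected[OF assms(1)] assms homotopic_paths_subset[of K p q X]
  by (auto simp: simply_connected_eq_homotopic_paths)

text \<open>
  The homotopy and the places of the cuts may vary simultaneously. With a constant homotopy this shows
  independence of the cuts, with constant cuts it shows homotopy invariance.
\<close>

lemma anchored_homotopic:
  fixes H :: "real \<Rightarrow> real \<Rightarrow> 'a::real_normed_vector"
  assumes K: "convex K" "K \<subseteq> X" "k \<in> K" and L: "convex L" "L \<subseteq> X" "l \<in> L"
    and H: "continuous_on ({0..1} \<times> {m..M}) (\<lambda>y. H (fst y) (snd y))"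
    and HX: "\<And>s t. s \<in> {0..1} \<Longrightarrow> t \<in> {m..M} \<Longrightarrow> H s t \<in> X"
    and lo: "continuous_on {0..1} lo" "\<And>s. s \<in> {0..1} \<Longrightarrow> lo s \<in> {m..M}"
    and hi: "continuous_on {0..1} hi" "\<And>s. s \<in> {0..1} \<Longrightarrow> hi s \<in> {m..M}"
    and HK: "\<And>s. s \<in> {0..1} \<Longrightarrow> H s (lo s) \<in> K"
    and HL: "\<And>s. s \<in> {0..1} \<Longrightarrow> H s (hi s) \<in> L"
  shows "homotopic_paths X (anchored k l (lo 0) (hi 0) (H 0)) (anchored k l (lo 1) (hi 1) (H 1))"
proof -
  have conv: "(1 - t) * a + t * b \<in> {m..M}" if "t \<in> {0..1}" "a \<in> {m..M}" "b \<in> {m..M}" for t a b :: real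
    using convexD[of "{m..M}" a b "1 - t" t] that by auto
  have sub: "lo s + (hi s - lo s) * t \<in> {m..M}" if "s \<in> {0..1}" "t \<in> {0..1}" for s t
    using conv[OF that(2) lo(2)[OF that(1)] hi(2)[OF that(1)]] by (simp add: algebra_simps)
  have cH: "continuous_on S (\<lambda>y. H (f y) (g y))"
    if "continuous_on S f" "continuous_on S g" "\<And>y. y \<in> S \<Longrightarrow> f y \<in> {0..1} \<and> g y \<in> {m..M}"
    for S :: "(real \<times> real) set" and f g
    using continuous_on_compose2[OF H continuous_on_Pair[OF that(1,2)]] that(3) by force
  have clo: "continuous_on ({0..1} \<times> {0..1}) (\<lambda>y::real\<times>real. lo (fst y))"
    by (rule continuous_on_compose2[OF lo(1)]) (auto intro!: continuous_intros)
  have chi: "continuous_on ({0..1} \<times> {0..1}) (\<lambda>y::real\<times>real. hi (fst y))"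
    by (rule continuous_on_compose2[OF hi(1)]) (auto intro!: continuous_intros)
  have c1: "continuous_on ({0..1} \<times> {0..1}) (\<lambda>y. linepath k (H (fst y) (lo (fst y))) (snd y))"
    unfolding linepath_def using lo(2) by (intro continuous_intros cH clo) auto
  have c2: "continuous_on ({0..1} \<times> {0..1}) (\<lambda>y. subpath (lo (fst y)) (hi (fst y)) (H (fst y)) (snd y))"
    unfolding subpath_def using sub by (intro cH continuous_intros clo chi) (auto simp: algebra_simps)
  have c3: "continuous_on ({0..1} \<times> {0..1}) (\<lambda>y. linepath (H (fst y) (hi (fst y))) l (snd y))"
    unfolding linepath_def using hi(2) by (intro continuous_intros cH chi) auto
  have c: "continuous_on ({0..1} \<times> {0..1}) (\<lambda>y. anchored k l (lo (fst y)) (hi (fst y)) (H (fst y)) (snd y))"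
    unfolding anchored_def
    by (rule continuous_on_homotopic_join_lemma[OF c1 continuous_on_homotopic_join_lemma[OF c2 c3]]) auto
  have "anchored k l (lo s) (hi s) (H s) t \<in> X" if "s \<in> {0..1}" "t \<in> {0..1}" for s t
  proof -
    have "path_image (anchored k l (lo s) (hi s) (H s)) \<subseteq> X"
      unfolding anchored_def
    proof (intro subset_path_image_join)
      show "path_image (linepath k (H s (lo s))) \<subseteq> X" "path_image (linepath (H s (hi s)) l) \<subseteq> X"
        using closed_segment_subset[OF K(3) HK[OF that(1)] K(1)] K(2)
          closed_segment_subset[OF HL[OF that(1)] L(3) L(1)] L(2) by auto
      show "path_image (subpath (lo s) (hi s) (H s)) \<subseteq> X"
        using sub[OF that(1)] HX[OF that(1)] by (auto simp: path_image_def subpath_def add.commute)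
    qed
    then show ?thesis using that(2) by (auto simp: path_image_def)
  qed
  moreover have "pathstart (anchored k l u v p) = k" "pathfinish (anchored k l u v p) = l" for u v and p :: "real \<Rightarrow> 'a"
    by (simp_all add: anchored_def)
  ultimately show ?thesis
    unfolding homotopic_paths
    by (intro exI[of _ "\<lambda>y. anchored k l (lo (fst y)) (hi (fst y)) (H (fst y)) (snd y)"] conjI c)
       (auto simp: o_def)
qed

text \<open>
  An ordinary base point counts as a constant curve, so that both kinds of base point can be treated alike.
\<close>

fun region :: "'a basepoint \<Rightarrow> 'a set" where
  "region (Pt w) = {w}"
| "region (Tangential b) = b ` {0<..<1}"

text \<open>
  There is nothing to cut off at an ordinary base point.
\<close>

definition cutoff :: "'a basepoint \<Rightarrow> real \<Rightarrow> real" where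
  "cutoff a e = (if is_Pt a then 0 else e)"

lemma starts_at_mono: "starts_at e a p \<Longrightarrow> 0 < d \<Longrightarrow> d \<le> e \<Longrightarrow> starts_at d a p"
proof (cases a)
  case (Tangential b)
  assume "starts_at e a p" "0 < d" "d \<le> e"
  then obtain u where "continuous_on {0<..e} u" "(u \<longlongrightarrow> 0) (at_right 0)"
    "\<forall>t\<in>{0<..e}. 0 < u t \<and> u t < 1 \<and> p t = b (u t)" using Tangential by auto
  then show ?thesis
    using Tangential \<open>d \<le> e\<close> by (auto intro!: exI[of _ u] intro: continuous_on_subset)
qed auto

lemma joins_mono: "joins e a b p \<Longrightarrow> 0 < d \<Longrightarrow> d \<le> e \<Longrightarrow> joins d a b p"
  unfolding joins_def using starts_at_mono by blast

lemma starts_at_cut: "starts_at e a p \<Longrightarrow> 0 < t \<Longrightarrow> t \<le> e \<Longrightarrow> p (cutoff a t) \<in> region a"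
  by (cases a) (auto simp: cutoff_def)

lemma joins_cut:
  assumes "joins e a b p" "0 < t" "t \<le> e"
  shows "p (cutoff a t) \<in> region a" "p (1 - cutoff b t) \<in> region b"
  using assms starts_at_cut[of e a p t] starts_at_cut[of e b "reversepath p" t]
  by (auto simp: joins_def reversepath_def)

lemma starts_at_cong: 
  assumes "e < 1" "\<And>x. x \<in> path_dom a b \<Longrightarrow> p x = q x"
  shows "starts_at e a p \<longleftrightarrow> starts_at e a q"
proof (cases a)
  case (Tangential c)
  have "\<forall>t\<in>{0<..e}. p t = q t" using assms Tangential by (auto simp: path_dom_def)
  then show ?thesis using Tangential by auto
qed (use assms in \<open>auto simp: path_dom_def\<close>)

lemma path_dom_reverse: "x \<in> path_dom b a \<longleftrightarrow> 1 - x \<in> path_dom a b"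
  by (auto simp: path_dom_def split: if_splits)

lemma joins_cong: 
  assumes "e < 1" "\<And>x. x \<in> path_dom a b \<Longrightarrow> p x = q x"
  shows "joins e a b p \<longleftrightarrow> joins e a b q"
  unfolding joins_def using starts_at_cong[OF assms] starts_at_cong[of e b a "reversepath p" "reversepath q"] assms
  by (simp add: reversepath_def path_dom_reverse[of _ b a])

text \<open>
  Everything required of the intermediate paths concerns times in the domain of the paths only, so the homotopy
  may be an arbitrary function elsewhere.
\<close>

lemma thomotopic_iff:
  "thomotopic W a b p q \<longleftrightarrow> (\<exists>e H. 0 < e \<and> e < 1 \<and>
     continuous_on ({0..1::real} \<times> path_dom a b) (\<lambda>y. H (fst y) (snd y)) \<and>
     (\<forall>s\<in>{0..1}. \<forall>t\<in>path_dom a b. H s t \<in> W) \<and>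
     (\<forall>t\<in>path_dom a b. H 0 t = p t) \<and> (\<forall>t\<in>path_dom a b. H 1 t = q t) \<and>
     (\<forall>s\<in>{0..1}. joins e a b (H s)))" (is "?L \<longleftrightarrow> ?R")
proof -
  have *: "homotopic_with (joins e a b) (top_of_set (path_dom a b)) (top_of_set W) p q \<longleftrightarrow>
     (\<exists>h. continuous_map (prod_topology (top_of_set {0..1::real}) (top_of_set (path_dom a b))) (top_of_set W) h \<and>
          (\<forall>x\<in>topspace (top_of_set (path_dom a b)). h (0, x) = p x) \<and>
          (\<forall>x\<in>topspace (top_of_set (path_dom a b)). h (1, x) = q x) \<and>
          (\<forall>t\<in>{0..1}. joins e a b (\<lambda>x. h (t, x))))" if "e < 1" for e
    by (rule homotopic_with) (rule joins_cong[OF that], simp)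
  show ?thesis
  proof
    assume ?L
    then obtain e where e: "0 < e" "e < 1"
      and "homotopic_with (joins e a b) (top_of_set (path_dom a b)) (top_of_set W) p q"
      unfolding thomotopic_def by auto
    then obtain h where h: "continuous_on ({0..1::real} \<times> path_dom a b) h"
        "h \<in> {0..1} \<times> path_dom a b \<rightarrow> W"
        "\<forall>x\<in>path_dom a b. h (0, x) = p x" "\<forall>x\<in>path_dom a b. h (1, x) = q x"
        "\<forall>t\<in>{0..1}. joins e a b (\<lambda>x. h (t, x))"
      using *[of e] by auto
    then show ?R using e
      by (intro exI[of _ e] exI[of _ "\<lambda>s x. h (s, x)"]) 
         auto
  next
    assume ?R
    then obtain e and H :: "real \<Rightarrow> real \<Rightarrow> 'a" where e: "0 < e" "e < 1"
      and H: "continuous_on ({0..1} \<times> path_dom a b) (\<lambda>y. H (fst y) (snd y))"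
      "\<forall>s\<in>{0..1}. \<forall>t\<in>path_dom a b. H s t \<in> W"
      "\<forall>t\<in>path_dom a b. H 0 t = p t" "\<forall>t\<in>path_dom a b. H 1 t = q t"
      "\<forall>s\<in>{0..1}. joins e a b (H s)" by blast
    have "homotopic_with (joins e a b) (top_of_set (path_dom a b)) (top_of_set W) p q"
      unfolding *[OF e(2)] using H by (intro exI[of _ "\<lambda>y. H (fst y) (snd y)"]) auto
    then show ?L
      unfolding thomotopic_def using e by (intro bexI[of _ e]) auto
  qed
qed

lemma path_dom_Icc: "0 < e \<Longrightarrow> e < 1 / 2 \<Longrightarrow> {cutoff a e..1 - cutoff b e} \<subseteq> path_dom a b"
  by (auto simp: cutoff_def path_dom_def)

lemma thomotopic_imp_tpaths:
  assumes "thomotopic W a b p q"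
  shows "p \<in> tpaths W a b" "q \<in> tpaths W a b"
proof -
  obtain e H where e: "0 < e" "e < 1"
    and H: "continuous_on ({0..1::real} \<times> path_dom a b) (\<lambda>y. H (fst y) (snd y))"
     "\<forall>s\<in>{0..1}. \<forall>t\<in>path_dom a b. H s t \<in> W"
     "\<forall>t\<in>path_dom a b. H 0 t = p t" "\<forall>t\<in>path_dom a b. H 1 t = q t"
     "\<forall>s\<in>{0..1}. joins e a b (H s)"
    using assms unfolding thomotopic_iff by blast
  have c: "continuous_on (path_dom a b) (H s)" if "s \<in> {0..1}" for s
  proof -
    have "continuous_on (path_dom a b) (\<lambda>t. H (fst (s, t)) (snd (s, t)))"
      by (rule continuous_on_compose2[OF H(1)]) (use that in \<open>auto intro!: continuous_intros\<close>)
    then show ?thesis by simp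
  qed
  have "H s \<in> tpaths W a b" if "s \<in> {0..1}" for s
    using c[OF that] H(2,5) that e by (auto simp: tpaths_def intro!: bexI[of _ e])
  then have "H 0 \<in> tpaths W a b" "H 1 \<in> tpaths W a b" by auto
  moreover have "h \<in> tpaths W a b \<longleftrightarrow> g \<in> tpaths W a b" if "\<forall>t\<in>path_dom a b. h t = g t" for h g
    using joins_cong[of _ a b h g] that continuous_on_cong[of "path_dom a b" "path_dom a b" h g]
      image_cong[of "path_dom a b" "path_dom a b" h g]
    unfolding tpaths_def by auto
  ultimately show "p \<in> tpaths W a b" "q \<in> tpaths W a b" using H(3,4) by blast+
qed

lemma thomotopic_refl:
  assumes "p \<in> tpaths W a b" 
  shows "thomotopic W a b p p"
proof -
  obtain e where e: "0 < e" "e < 1" "joins e a b p" and "continuous_on (path_dom a b) p" "p ` path_dom a b \<subseteq> W"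
    using assms by (auto simp: tpaths_def)
  then show ?thesis
    unfolding thomotopic_iff by (intro exI[of _ e] exI[of _ "\<lambda>_. p"])
      (auto intro: continuous_on_compose2[of _ p _ snd] intro!: continuous_intros)
qed

lemma thomotopic_trans:
  assumes "thomotopic W a b p q" "thomotopic W a b q r"
  shows "thomotopic W a b p r"
proof -
  obtain d e where "0 < d" "d < 1" "0 < e" "e < 1"
    and h: "homotopic_with (joins d a b) (top_of_set (path_dom a b)) (top_of_set W) p q"
      "homotopic_with (joins e a b) (top_of_set (path_dom a b)) (top_of_set W) q r"
    using assms by (auto simp: thomotopic_def)
  have "homotopic_with (joins (min d e) a b) (top_of_set (path_dom a b)) (top_of_set W) p r"
    by (rule homotopic_with_trans[OF homotopic_with_mono[OF h(1)] homotopic_with_mono[OF h(2)]])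
       (use \<open>0 < d\<close> \<open>0 < e\<close> in \<open>auto intro: joins_mono\<close>)
  then show ?thesis
    unfolding thomotopic_def by (rule bexI) (use \<open>0 < d\<close> \<open>d < 1\<close> \<open>0 < e\<close> in auto)
qed

lemma thomotopic_reversepath:
  assumes "thomotopic W a b p q"
  shows "thomotopic W b a (reversepath p) (reversepath q)"
proof -
  obtain e H where e: "0 < e" "e < 1"
    and H: "continuous_on ({0..1::real} \<times> path_dom a b) (\<lambda>y. H (fst y) (snd y))"
     "\<forall>s\<in>{0..1}. \<forall>t\<in>path_dom a b. H s t \<in> W"
     "\<forall>t\<in>path_dom a b. H 0 t = p t" "\<forall>t\<in>path_dom a b. H 1 t = q t"
     "\<forall>s\<in>{0..1}. joins e a b (H s)"
    using assms unfolding thomotopic_iff by blast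
  have "continuous_on ({0..1} \<times> path_dom b a) (\<lambda>y. H (fst y) (1 - snd y))"
  proof -
    have "continuous_on ({0..1} \<times> path_dom b a) (\<lambda>y. H (fst (fst y, 1 - snd y)) (snd (fst y, 1 - snd y)))"
      by (rule continuous_on_compose2[OF H(1)])
        (auto simp: path_dom_reverse[of _ b a] intro!: continuous_intros)
    then show ?thesis by simp
  qed
  then show ?thesis unfolding thomotopic_iff
    using e H(2-) path_dom_reverse[of _ b a]
    by (intro exI[of _ e] exI[of _ "\<lambda>s. reversepath (H s)"])
       (auto simp: reversepath_def joins_def)
qed

text \<open>
  The path \<open>G\<close> does not depend on \<open>q\<close>. Applying the map \<open>f\<close> inside the statement is essential: the image
  under \<open>f\<close> of a homotopy between tangential paths need not be a homotopy between tangential paths, since the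
  image of the tangential curve may leave the target curve and only remains in a convex set \<open>K\<close>; and the time
  at which it re-enters the target curve need not be uniform in the homotopy parameter.
\<close>

lemma thomotopic_anchored:
  fixes f :: "'a::real_normed_vector \<Rightarrow> 'b::real_normed_vector"
  assumes p: "p \<in> tpaths W a b" and f: "continuous_on W f" "f ` W \<subseteq> X"
    and K: "convex K" "K \<subseteq> X" "k \<in> K" "f ` region a \<subseteq> K"
    and L: "convex L" "L \<subseteq> X" "l \<in> L" "f ` region b \<subseteq> L"
  shows "\<exists>G. \<forall>q. thomotopic W a b p q \<longrightarrow>
    (\<forall>\<^sub>F e in at_right 0. homotopic_paths X (anchored k l (cutoff a e) (1 - cutoff b e) (f \<circ> q)) G)"
proof -
  obtain e0 where e0: "e0 \<in> {0<..<1}" "joins e0 a b p" 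
    and pc: "continuous_on (path_dom a b) p" and pW: "p ` path_dom a b \<subseteq> W"
    using p by (auto simp: tpaths_def)
  define e1 where "e1 = min e0 (1/4)"
  have e1: "0 < e1" "e1 < 1/2" "joins e1 a b p"
    using e0 joins_mono[of e0 a b p e1] by (auto simp: e1_def)
  let ?A = "\<lambda>e. anchored k l (cutoff a e) (1 - cutoff b e)"
  show ?thesis
  proof (intro exI[of _ "?A e1 (f \<circ> p)"] allI impI)
    fix q assume "thomotopic W a b p q"
    then obtain e2 H where e2: "0 < e2" "e2 < 1"
      and H: "continuous_on ({0..1::real} \<times> path_dom a b) (\<lambda>y. H (fst y) (snd y))"
       "\<forall>s\<in>{0..1}. \<forall>t\<in>path_dom a b. H s t \<in> W"
       "\<forall>t\<in>path_dom a b. H 0 t = p t" "\<forall>t\<in>path_dom a b. H 1 t = q t"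
       "\<forall>s\<in>{0..1}. joins e2 a b (H s)"
      unfolding thomotopic_iff by blast
    have "homotopic_paths X (?A e (f \<circ> q)) (?A e1 (f \<circ> p))" if e: "0 < e" "e < min e1 e2" for e
    proof -
      let ?lo = "cutoff a e" and ?hi = "1 - cutoff b e"
      have e12: "e < 1/2" using e e1 by auto
      note dom = path_dom_Icc[OF e(1) e12, of a b]
      have lohi: "?lo \<in> {?lo..?hi}" "?hi \<in> {?lo..?hi}" using e e12 by (auto simp: cutoff_def)
      have 1: "homotopic_paths X (anchored k l ?lo ?hi (f \<circ> H 0)) (anchored k l ?lo ?hi (f \<circ> H 1))"
      proof (rule anchored_homotopic[OF K(1-3) L(1-3), where m = ?lo and M = ?hi and H = "\<lambda>s. f \<circ> H s"
            and lo = "\<lambda>_. ?lo" and hi = "\<lambda>_. ?hi"])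
        have "continuous_on ({0..1} \<times> {?lo..?hi}) (\<lambda>y. H (fst y) (snd y))"
          by (rule continuous_on_subset[OF H(1)]) (use dom in auto)
        then show "continuous_on ({0..1} \<times> {?lo..?hi}) (\<lambda>y. (f \<circ> H (fst y)) (snd y))"
          unfolding o_def by (rule continuous_on_compose2[OF f(1)]) (use H(2) dom in force)
        show "(f \<circ> H s) t \<in> X" if "s \<in> {0..1}" "t \<in> {?lo..?hi}" for s t
        proof -
          have "t \<in> path_dom a b" using dom that by blast
          then show ?thesis using H(2) that f(2) by auto
        qed
        show "(f \<circ> H s) ?lo \<in> K" "(f \<circ> H s) ?hi \<in> L" if "s \<in> {0..1}" for s
          using joins_cut[of e2 a b "H s" e] H(5) that e K(4) L(4) by auto
      qed (use lohi in auto)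
      have eq: "homotopic_paths X (anchored k l u v g) (anchored k l u v h) \<longleftrightarrow> homotopic_paths X (anchored k l u v g') (anchored k l u v h')"
        if "\<And>t. t \<in> path_dom a b \<Longrightarrow> g t = g' t" "\<And>t. t \<in> path_dom a b \<Longrightarrow> h t = h' t" "{u..v} \<subseteq> path_dom a b" "u \<le> v" 
        for g h g' h' u v
      proof -
        have in_uv: "u + (v - u) * t \<in> {u..v}" if "t \<in> {0..1}" for t 
          using that \<open>u \<le> v\<close> mult_left_le[of t "v - u"] by (auto simp: mult.commute)
        have *: "anchored k l u v g t = anchored k l u v g' t" 
          if "\<And>t. t \<in> path_dom a b \<Longrightarrow> g t = g' t" "t \<in> {0..1}" for g g' :: "real \<Rightarrow> 'b" and t
        proof -
          have "g u = g' u" "g v = g' v" using \<open>{u..v} \<subseteq> path_dom a b\<close> \<open>u \<le> v\<close> that by auto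
          moreover have "g (u + (v - u) * x) = g' (u + (v - u) * x)" if "x \<in> {0..1}" for x
            using in_uv[OF that] \<open>{u..v} \<subseteq> path_dom a b\<close> \<open>\<And>t. t \<in> path_dom a b \<Longrightarrow> g t = g' t\<close> by blast
          ultimately show ?thesis
            using that(2) by (auto simp: anchored_def joinpaths_def subpath_def add.commute)
        qed
        show ?thesis unfolding homotopic_paths
          using *[OF that(1)] *[OF that(2)] by (simp add: pathstart_def pathfinish_def)
      qed
      have le: "?lo \<le> ?hi" using lohi by auto
      have qp: "homotopic_paths X (?A e (f \<circ> q)) (?A e (f \<circ> p))"
        using homotopic_paths_sym[OF 1] eq[of "f \<circ> H 1" "f \<circ> q" "f \<circ> H 0" "f \<circ> p", OF _ _ dom le] H(3,4) by auto
      \<comment> \<open>Now \<open>p\<close> is kept fixed and the cut moves from \<open>e\<close> to \<open>e1\<close>.\<close>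
      have mv: "x * (1 - s) + y * s \<in> {x..y}" if "s \<in> {0..1}" "x \<le> y" for s x y :: real
        using that mult_left_le[of s "y - x"] mult_left_mono[of x y s] by (auto simp: algebra_simps)
      let ?e = "\<lambda>s. e * (1 - s) + e1 * s"
      have es: "?e s \<in> {e..e1}" if "s \<in> {0..1}" for s
        using mv[OF that, of e e1] e by auto
      have "homotopic_paths X (anchored k l (cutoff a (?e 0)) (1 - cutoff b (?e 0)) (f \<circ> p))
               (anchored k l (cutoff a (?e 1)) (1 - cutoff b (?e 1)) (f \<circ> p))"
      proof (rule anchored_homotopic[OF K(1-3) L(1-3), where m = ?lo and M = ?hi and H = "\<lambda>s. f \<circ> p"
            and lo = "\<lambda>s. cutoff a (?e s)" and hi = "\<lambda>s. 1 - cutoff b (?e s)"])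
        have "continuous_on {?lo..?hi} (f \<circ> p)"
          using continuous_on_subset[OF pc dom] pW dom
          by (intro continuous_on_compose continuous_on_subset[OF f(1)]) blast+
        then show "continuous_on ({0..1} \<times> {?lo..?hi}) (\<lambda>y. (f \<circ> p) (snd y))"
          by (rule continuous_on_compose2) (auto intro!: continuous_intros)
        show "(f \<circ> p) t \<in> X" if "t \<in> {?lo..?hi}" for t
        proof -
          have "t \<in> path_dom a b" using dom that by blast
          then show ?thesis using f(2) pW by auto
        qed
        show "(f \<circ> p) (cutoff a (?e s)) \<in> K" "(f \<circ> p) (1 - cutoff b (?e s)) \<in> L" if "s \<in> {0..1}" for s
          using joins_cut[OF e1(3), of "?e s"] es[OF that] e K(4) L(4) by auto
        show "continuous_on {0..1} (\<lambda>s. cutoff a (?e s))" "continuous_on {0..1} (\<lambda>s. 1 - cutoff b (?e s))"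
          unfolding cutoff_def by (cases "is_Pt a"; cases "is_Pt b"; simp; intro continuous_intros)+
        show "cutoff a (?e s) \<in> {?lo..?hi}" "1 - cutoff b (?e s) \<in> {?lo..?hi}" if "s \<in> {0..1}" for s
          using es[OF that] e e1 by (auto simp: cutoff_def)
      qed
      with qp show ?thesis using homotopic_paths_trans by fastforce
    qed
    then show "\<forall>\<^sub>F e in at_right 0. homotopic_paths X (?A e (f \<circ> q)) (?A e1 (f \<circ> p))"
      unfolding eventually_at_right_field using e1 e2 by (intro exI[of _ "min e1 e2"]) auto
  qed
qed

section \<open>Homotopy classes of truncated paths\<close>

fun anchor :: "'a basepoint \<Rightarrow> 'a" where
  "anchor (Pt w) = w"
| "anchor (Tangential b) = b (1 / 2)"

lemma anchor_in_region: "anchor a \<in> region a"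
  by (cases a) auto

text \<open>
  The cut must be small, with a bound depending on the path; hence the filter.
\<close>

definition truncates_to ::
  "'a::real_normed_vector set \<Rightarrow> 'a basepoint \<Rightarrow> 'a basepoint \<Rightarrow> (real \<Rightarrow> 'a) set \<Rightarrow> (real \<Rightarrow> 'a) \<Rightarrow> bool" where
  "truncates_to X a b C G \<longleftrightarrow> (\<forall>g\<in>C. g \<in> tpaths X a b \<and>
     (\<forall>\<^sub>F e in at_right 0. homotopic_paths X
        (anchored (anchor a) (anchor b) (cutoff a e) (1 - cutoff b e) g) G))"

text \<open>
  For the four tangential base points of the line the curve is an open segment or ray, hence convex.
\<close>

definition convex_region :: "'a::real_normed_vector set \<Rightarrow> 'a basepoint \<Rightarrow> bool" where
  "convex_region X a \<longleftrightarrow> convex (region a) \<and> region a \<subseteq> X"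

lemma truncates_to_pclass:
  assumes "p \<in> tpaths X a b" "convex_region X a" "convex_region X b"
  shows "\<exists>G. truncates_to X a b (pclass X a b p) G"
proof -
  have "\<exists>G. \<forall>q. thomotopic X a b p q \<longrightarrow>
    (\<forall>\<^sub>F e in at_right 0. homotopic_paths X (anchored (anchor a) (anchor b) (cutoff a e) (1 - cutoff b e) ((\<lambda>x. x) \<circ> q)) G)"
    by (rule thomotopic_anchored[OF assms(1), where K = "region a" and L = "region b"])
       (use assms(2,3) in \<open>auto simp: convex_region_def anchor_in_region\<close>)
  then obtain G where "\<forall>q. thomotopic X a b p q \<longrightarrow>
    (\<forall>\<^sub>F e in at_right 0. homotopic_paths X (anchored (anchor a) (anchor b) (cutoff a e) (1 - cutoff b e) q) G)"
    by (auto simp: o_def)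
  then have "truncates_to X a b (pclass X a b p) G"
    unfolding truncates_to_def pclass_def using thomotopic_imp_tpaths(2) by auto
  then show ?thesis by blast
qed

lemma truncates_to_Union_pclass:
  assumes "truncates_to X a b C G" "convex_region X a" "convex_region X b"
  shows "truncates_to X a b (\<Union>g\<in>C. pclass X a b g) G"
  unfolding truncates_to_def
proof safe
  fix g h assume g: "g \<in> C" and h: "h \<in> pclass X a b g"
  show "h \<in> tpaths X a b" using h thomotopic_imp_tpaths(2) by (auto simp: pclass_def)
  have gt: "g \<in> tpaths X a b" using assms(1) g by (auto simp: truncates_to_def)
  obtain G' where G': "truncates_to X a b (pclass X a b g) G'" 
    using truncates_to_pclass[OF gt assms(2,3)] by blast
  have "g \<in> pclass X a b g" using thomotopic_refl[OF gt] by (simp add: pclass_def)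
  show "\<forall>\<^sub>F e in at_right 0. homotopic_paths X
        (anchored (anchor a) (anchor b) (cutoff a e) (1 - cutoff b e) h) G"
    (is "eventually (\<lambda>e. ?P h G e) _")
  proof -
    have "eventually (?P g G') (at_right 0)" "eventually (?P h G') (at_right 0)" "eventually (?P g G) (at_right 0)"
      using \<open>g \<in> pclass X a b g\<close> G' h g assms(1) unfolding truncates_to_def by auto
    then show ?thesis
      by eventually_elim (meson homotopic_paths_sym homotopic_paths_trans)
  qed
qed

text \<open>
  When two truncated paths are joined, the detour from the meeting point to the fixed point and back stays in a
  convex set and can be cancelled.
\<close>

lemma homotopic_paths_cancel_detour:
  fixes A :: "real \<Rightarrow> 'a::real_normed_vector"
  assumes "path A" "path B" "path C" "path D" "path E" "path F"
    and "path_image A \<subseteq> X" "path_image B \<subseteq> X" "path_image E \<subseteq> X" "path_image F \<subseteq> X"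
    and K: "convex K" "K \<subseteq> X" and C: "path_image C \<subseteq> K" and D: "path_image D \<subseteq> K"
    and [simp]: "pathfinish A = pathstart B" "pathfinish B = pathstart C" "pathfinish C = pathstart D"
      "pathfinish D = pathstart C" "pathstart E = pathstart C" "pathfinish E = pathstart F"
  shows "homotopic_paths X ((A +++ B +++ C) +++ (D +++ E +++ F)) (A +++ (B +++ E) +++ F)"
proof -
  have CX: "path_image C \<subseteq> X" and DX: "path_image D \<subseteq> X" using K C D by auto
  note [simp] = assms(1-10) CX DX subset_path_image_join
  have mK: "pathstart C \<in> K" using C pathstart_in_path_image by blast
  have CD: "homotopic_paths X (C +++ D) (linepath (pathstart C) (pathstart C))"
    by (rule homotopic_paths_in_convex[OF K]) (use C D mK in \<open>auto simp: path_image_join\<close>)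
  have 1: "homotopic_paths X ((A +++ B +++ C) +++ (D +++ E +++ F)) (A +++ ((B +++ C) +++ (D +++ E +++ F)))"
    by (rule homotopic_paths_sym, rule homotopic_paths_assoc) auto
  have 2: "homotopic_paths X ((B +++ C) +++ (D +++ E +++ F)) (((B +++ C) +++ D) +++ (E +++ F))"
    by (rule homotopic_paths_assoc) auto
  have "homotopic_paths X ((B +++ C) +++ D) (B +++ (C +++ D))"
    by (rule homotopic_paths_sym, rule homotopic_paths_assoc) auto
  also have "homotopic_paths X \<dots> (B +++ linepath (pathstart C) (pathstart C))"
    by (rule homotopic_paths_join[OF _ CD]) auto
  also have "homotopic_paths X \<dots> B"
    by (rule homotopic_paths_rid') auto
  finally have 3: "homotopic_paths X ((B +++ C) +++ D) B" .
  have 4: "homotopic_paths X (((B +++ C) +++ D) +++ (E +++ F)) (B +++ (E +++ F))"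
    by (rule homotopic_paths_join[OF 3]) auto
  have 5: "homotopic_paths X (B +++ (E +++ F)) ((B +++ E) +++ F)"
    by (rule homotopic_paths_assoc) auto
  have 6: "homotopic_paths X ((B +++ C) +++ (D +++ E +++ F)) ((B +++ E) +++ F)"
    using homotopic_paths_trans[OF homotopic_paths_trans[OF 2 4] 5] .
  have "homotopic_paths X (A +++ ((B +++ C) +++ (D +++ E +++ F))) (A +++ ((B +++ E) +++ F))"
    by (rule homotopic_paths_join[OF _ 6]) auto
  with 1 show ?thesis using homotopic_paths_trans by blast
qed

lemma starts_at_compose:
  assumes "starts_at e (Tangential b) p" "continuous_on {0<..d} \<phi>" "\<phi> ` {0<..d} \<subseteq> {0<..e}"
    "(\<phi> \<longlongrightarrow> 0) (at_right 0)" "0 < d" "\<And>t. t \<in> {0<..d} \<Longrightarrow> q t = p (\<phi> t)"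
  shows "starts_at d (Tangential b) q"
proof -
  obtain u where u: "continuous_on {0<..e} u" "(u \<longlongrightarrow> 0) (at_right 0)"
    "\<forall>t\<in>{0<..e}. 0 < u t \<and> u t < 1 \<and> p t = b (u t)" using assms(1) by auto
  have "\<forall>\<^sub>F t in at_right 0. \<phi> t \<in> {0<..}"
    using assms(3) unfolding eventually_at_right_field
    by (intro exI[of _ d]) (use assms(5) in force)
  then have "filterlim \<phi> (at_right 0) (at_right 0)"
    using assms(4) by (auto simp: filterlim_at elim: eventually_mono)
  then have "((\<lambda>t. u (\<phi> t)) \<longlongrightarrow> 0) (at_right 0)"
    using u(2) filterlim_compose by blast
  moreover have "continuous_on {0<..d} (\<lambda>t. u (\<phi> t))"
    using continuous_on_compose2[OF u(1) assms(2,3)] .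
  moreover have "0 < u (\<phi> t) \<and> u (\<phi> t) < 1 \<and> q t = b (u (\<phi> t))" if "t \<in> {0<..d}" for t
  proof -
    have "\<phi> t \<in> {0<..e}" using assms(3) that by blast
    then show ?thesis using u(3) assms(6)[OF that] by auto
  qed
  ultimately show ?thesis by (auto intro!: exI[of _ "\<lambda>t. u (\<phi> t)"])
qed

text \<open>
  The truncation of a composite differs from the join of the truncations only by the detour to the fixed
  point of the middle base point and by the position of the cuts. The factor \<open>2 \<tau>\<close> occurs because the
  composite runs through \<open>p\<close> up to time \<open>\<tau>\<close> during its first half.
\<close>

lemma composite_truncates_to:
  fixes p q r :: "real \<Rightarrow> 'a::real_normed_vector"
  assumes a: "a = Tangential \<alpha>" and b: "b = Tangential \<beta>" and c: "c = Pt z"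
    and reg: "convex_region X a" "convex_region X b" "z \<in> X"
    and p: "p \<in> tpaths X a b" and q: "q \<in> tpaths X b c" and r: "composite b p q r"
    and pG: "\<forall>\<^sub>F e in at_right 0. homotopic_paths X (anchored (anchor a) (anchor b) (cutoff a e) (1 - cutoff b e) p) G1"
    and qG: "\<forall>\<^sub>F e in at_right 0. homotopic_paths X (anchored (anchor b) (anchor c) (cutoff b e) (1 - cutoff c e) q) G2"
  shows "r \<in> tpaths X a c \<and> 
    (\<forall>\<^sub>F e in at_right 0. homotopic_paths X (anchored (anchor a) (anchor c) (cutoff a e) (1 - cutoff c e) r) (G1 +++ G2))"
proof -
  obtain \<tau> \<sigma> where \<tau>: "0 < \<tau>" "\<tau> < 1" and \<sigma>: "0 < \<sigma>" "\<sigma> < 1"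
    and s1: "starts_at (1 - \<tau>) b (reversepath p)" and s2: "starts_at \<sigma> b q"
    and eq: "p \<tau> = q \<sigma>" and rdef: "r = subpath 0 \<tau> p +++ subpath \<sigma> 1 q"
    using r unfolding b composite.simps by (elim bexE conjE) (auto simp del: starts_at.simps)
  have dab: "path_dom a b = {0<..<1}" and dbc: "path_dom b c = {0<..1}" and dac: "path_dom a c = {0<..1}"
    unfolding a b c by (auto simp: path_dom_def)
  have [simp]: "cutoff a e = e" "cutoff b e = e" "cutoff c e = 0" for e
    unfolding a b c by (auto simp: cutoff_def)
  have pc: "continuous_on {0<..<1} p" and pX: "\<And>t. t \<in> {0<..<1} \<Longrightarrow> p t \<in> X"
    using p by (auto simp: tpaths_def dab)
  have qc: "continuous_on {0<..1} q" and qX: "\<And>t. t \<in> {0<..1} \<Longrightarrow> q t \<in> X"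
    using q by (auto simp: tpaths_def dbc)
  obtain e1 where e1: "0 < e1" "e1 < 1" "joins e1 a b p" using p by (auto simp: tpaths_def)
  obtain e2 where e2: "0 < e2" "e2 < 1" "joins e2 b c q" using q by (auto simp: tpaths_def)
  have q1: "q 1 = z" using e2(3) by (simp add: joins_def c reversepath_def)
  have rt: "r t = (if t \<le> 1/2 then p (2 * \<tau> * t) else q (\<sigma> + (1 - \<sigma>) * (2 * t - 1)))" for t
    by (simp add: rdef joinpaths_def subpath_def algebra_simps)
  have mem1: "2 * \<tau> * t \<in> {0<..\<tau>}" if "0 < t" "t \<le> 1/2" for t using that \<tau> by auto
  have mem1': "2 * \<tau> * t \<in> {0<..<1}" if "0 < t" "t \<le> 1/2" for t
  proof -
    have "0 < 2 * \<tau> * t" "2 * \<tau> * t \<le> \<tau>" using mem1[OF that] by (simp_all only: greaterThanAtMost_iff)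
    then show ?thesis using \<tau>(2) unfolding greaterThanLessThan_iff by linarith
  qed
  have mem2: "\<sigma> + (1 - \<sigma>) * (2 * t - 1) \<in> {\<sigma>..1}" if "t \<le> 1" "1/2 \<le> t" for t
  proof -
    have "(1 - \<sigma>) * (2 * t - 1) \<le> 1 - \<sigma>" "0 \<le> (1 - \<sigma>) * (2 * t - 1)"
      using that \<sigma> by (auto intro!: mult_left_le mult_nonneg_nonneg)
    then show ?thesis by simp
  qed
  have mem2': "\<sigma> + (1 - \<sigma>) * (2 * t - 1) \<in> {0<..1}" if "t \<le> 1" "1/2 \<le> t" for t
    using mem2[OF that] \<sigma>(1) unfolding greaterThanAtMost_iff atLeastAtMost_iff by linarith
  have "continuous_on {0<..1} r"
    unfolding rt
  proof (rule continuous_on_cases_le)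
    show "continuous_on {t \<in> {0<..1}. t \<le> 1/2} (\<lambda>t. p (2 * \<tau> * t))"
    proof (rule continuous_on_compose2[OF pc])
      show "(\<lambda>t. 2 * \<tau> * t) ` {t \<in> {0<..1}. t \<le> 1/2} \<subseteq> {0<..<1}"
        by (rule image_subsetI, rule mem1') auto
    qed (intro continuous_intros)
    show "continuous_on {t \<in> {0<..1}. 1/2 \<le> t} (\<lambda>t. q (\<sigma> + (1 - \<sigma>) * (2 * t - 1)))"
    proof (rule continuous_on_compose2[OF qc])
      show "(\<lambda>t. \<sigma> + (1 - \<sigma>) * (2 * t - 1)) ` {t \<in> {0<..1}. 1/2 \<le> t} \<subseteq> {0<..1}"
        by (rule image_subsetI, rule mem2') auto
    qed (intro continuous_intros)
    show "p (2 * \<tau> * t) = q (\<sigma> + (1 - \<sigma>) * (2 * t - 1))" if "t = 1/2" for t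
      using eq by (simp add: that)
  qed (intro continuous_intros)
  moreover have rX: "r t \<in> X" if "t \<in> {0<..1}" for t
  proof (cases "t \<le> 1/2")
    case True
    then show ?thesis using pX[OF mem1'] that by (simp add: rt)
  next
    case False
    then show ?thesis using qX[OF mem2'] that by (simp add: rt)
  qed
  moreover have "joins (e1 / 2) a c r"
    unfolding joins_def
  proof
    have "((\<lambda>t. 2 * \<tau> * t) \<longlongrightarrow> 2 * \<tau> * 0) (at_right 0)"
      by (intro tendsto_intros)
    moreover have img: "(\<lambda>t. 2 * \<tau> * t) ` {0<..e1 / 2} \<subseteq> {0<..e1}"
    proof (rule image_subsetI)
      fix t assume "t \<in> {0<..e1 / 2}"
      then have "0 < t" "t \<le> e1 / 2" by auto
      moreover have "\<tau> * t \<le> t" using \<tau> \<open>0 < t\<close> by (intro mult_left_le_one_le) auto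
      ultimately have "2 * \<tau> * t \<le> e1" by linarith
      moreover have "0 < 2 * \<tau> * t" using \<tau> \<open>0 < t\<close> by simp
      ultimately show "2 * \<tau> * t \<in> {0<..e1}" by (simp only: greaterThanAtMost_iff)
    qed
    moreover have "starts_at e1 (Tangential \<alpha>) p"
      using e1(3) by (simp only: joins_def a)
    moreover have "r t = p (2 * \<tau> * t)" if "t \<in> {0<..e1 / 2}" for t
      using that e1(2) by (simp add: rt)
    ultimately show "starts_at (e1 / 2) a r"
      unfolding a using e1(1)
      by - (rule starts_at_compose[where p = p and e = e1 and \<phi> = "\<lambda>t. 2 * \<tau> * t"],
          auto simp del: starts_at.simps intro!: continuous_intros)
    show "starts_at (e1 / 2) c (reversepath r)"
      by (simp add: c reversepath_def rt q1)
  qed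
  ultimately have rt_mem: "r \<in> tpaths X a c"
    unfolding tpaths_def dac mem_Collect_eq using e1(1,2)
    by (intro conjI bexI[of _ "e1/2"]) auto
  have small: "\<forall>\<^sub>F e in at_right 0. e < x \<and> 0 < e" if "0 < x" for x :: real
    unfolding eventually_at_right_field using that by blast
  let ?k = "anchor a" and ?l = "anchor b"
  have K: "convex (region a)" "region a \<subseteq> X" and L: "convex (region b)" "region b \<subseteq> X"
    using reg by (auto simp: convex_region_def)
  have mv: "x * (1 - s) + y * s \<in> {x..y}" if "s \<in> {0..1}" "x \<le> y" for s x y :: real
    using that mult_left_le[of s "y - x"] mult_left_mono[of x y s] by (auto simp: algebra_simps)
  have hp: "homotopic_paths X (anchored ?k ?l e (1 - e) p) (anchored ?k ?l e \<tau> p)" 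
    if e: "0 < e" "e < min e1 (min \<tau> (1 - \<tau>))" for e
  proof -
    have "homotopic_paths X (anchored ?k ?l e ((1 - e) * (1 - 0) + \<tau> * 0) p) (anchored ?k ?l e ((1 - e) * (1 - 1) + \<tau> * 1) p)"
    proof (rule anchored_homotopic[OF K anchor_in_region L anchor_in_region, where m = e and M = "1 - e" and lo = "\<lambda>_. e"])
      show "continuous_on ({0..1} \<times> {e..1 - e}) (\<lambda>y. p (snd y))"
        by (rule continuous_on_compose2[OF pc]) (use e in \<open>auto intro!: continuous_intros\<close>)
      fix s :: real assume s: "s \<in> {0..1}"
      have mem: "(1 - e) * (1 - s) + \<tau> * s \<in> {\<tau>..1 - e}" using mv[of "1 - s" \<tau> "1 - e"] s e by (auto simp: algebra_simps)
      then show "(1 - e) * (1 - s) + \<tau> * s \<in> {e..1 - e}" using e by auto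
      show "p e \<in> region a" using joins_cut(1)[OF e1(3), of e] e by auto
      show "p ((1 - e) * (1 - s) + \<tau> * s) \<in> region b" 
        using starts_at_cut[OF s1, of "1 - ((1 - e) * (1 - s) + \<tau> * s)"] mem e by (auto simp: reversepath_def)
    qed (use e pX in \<open>auto intro!: continuous_intros\<close>)
    then show ?thesis by simp
  qed
  have hq: "homotopic_paths X (anchored ?l z e 1 q) (anchored ?l z \<sigma> 1 q)"
    if e: "0 < e" "e < \<sigma>" for e
  proof -
    have "homotopic_paths X (anchored ?l z (e * (1 - 0) + \<sigma> * 0) 1 q) (anchored ?l z (e * (1 - 1) + \<sigma> * 1) 1 q)"
    proof (rule anchored_homotopic[OF L anchor_in_region, where L = "{z}" and m = e and M = 1 and hi = "\<lambda>_. 1"])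
      show "continuous_on ({0..1} \<times> {e..1}) (\<lambda>y. q (snd y))"
        by (rule continuous_on_compose2[OF qc]) (use e in \<open>auto intro!: continuous_intros\<close>)
      fix s :: real assume s: "s \<in> {0..1}"
      have mem: "e * (1 - s) + \<sigma> * s \<in> {e..\<sigma>}" using mv[of s e \<sigma>] s e by auto
      then show "e * (1 - s) + \<sigma> * s \<in> {e..1}" using \<sigma> by auto
      show "q (e * (1 - s) + \<sigma> * s) \<in> region b" 
        using starts_at_cut[OF s2, of "e * (1 - s) + \<sigma> * s"] mem e by auto
    qed (use e \<sigma> qX q1 reg(3) in \<open>auto intro!: continuous_intros\<close>)
    then show ?thesis by simp
  qed
  have "\<forall>\<^sub>F e in at_right 0. homotopic_paths X (anchored ?l z e 1 q) G2 \<and> e < \<sigma> \<and> 0 < e"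
    using eventually_conj[OF qG small[OF \<sigma>(1)]] by (simp add: b c cutoff_def)
  then obtain e' where "homotopic_paths X (anchored ?l z e' 1 q) G2" "e' < \<sigma>" "0 < e'"
    using eventually_happens'[OF trivial_limit_at_right_real] by blast
  then have qG2: "homotopic_paths X (anchored ?l z \<sigma> 1 q) G2"
    using hq homotopic_paths_sym homotopic_paths_trans by blast
  have "filterlim (\<lambda>e. 2 * \<tau> * e) (at_right 0) (at_right 0)"
  proof -
    have "((\<lambda>t. 2 * \<tau> * t) \<longlongrightarrow> 2 * \<tau> * 0) (at_right 0)" by (intro tendsto_intros)
    moreover have "\<forall>\<^sub>F e in at_right 0. 2 * \<tau> * e \<in> {0<..} \<and> 2 * \<tau> * e \<noteq> 0"
      using small[of 1] \<tau>(1) by (auto elim: eventually_mono)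
    ultimately show ?thesis by (simp add: filterlim_at)
  qed
  moreover have "\<forall>\<^sub>F e in at_right 0. homotopic_paths X (anchored ?k ?l e (1 - e) p) G1 \<and> e < min e1 (min \<tau> (1 - \<tau>)) \<and> 0 < e"
    using eventually_conj[OF pG small[of "min e1 (min \<tau> (1 - \<tau>))"]] e1 \<tau> by simp
  ultimately have "\<forall>\<^sub>F e in at_right 0. homotopic_paths X (anchored ?k ?l (2 * \<tau> * e) (1 - 2 * \<tau> * e) p) G1
       \<and> 2 * \<tau> * e < min e1 (min \<tau> (1 - \<tau>)) \<and> 0 < 2 * \<tau> * e"
    unfolding filterlim_iff by blast
  moreover have "homotopic_paths X (anchored ?k z e 1 r) (G1 +++ G2)"
    if G1: "homotopic_paths X (anchored ?k ?l (2 * \<tau> * e) (1 - 2 * \<tau> * e) p) G1"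
       and e: "2 * \<tau> * e < min e1 (min \<tau> (1 - \<tau>))" "0 < 2 * \<tau> * e" for e
  proof -
    have e0: "0 < e" "e < 1/2" using e \<tau> by (auto simp: zero_less_mult_iff)
    let ?e = "2 * \<tau> * e"
    have pG1: "homotopic_paths X (anchored ?k ?l ?e \<tau> p) G1"
      using homotopic_paths_trans[OF homotopic_paths_sym[OF hp] G1] e by auto
    have re: "r e = p ?e" "r 1 = z" using e0 q1 by (auto simp: rt)
    have pe: "p ?e \<in> region a" using joins_cut(1)[OF e1(3), of ?e] e by auto
    have p\<tau>: "p \<tau> \<in> region b" using starts_at_cut[OF s1, of "1 - \<tau>"] \<tau> by (auto simp: reversepath_def)
    define B where "B = subpath ?e \<tau> p"
    define E where "E = subpath \<sigma> 1 q"
    define R where "R = subpath e 1 r"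
    have R: "path R" "path_image R \<subseteq> X"
    proof -
      have m: "e + (1 - e) * x \<in> {0<..1}" if "x \<in> {0..1}" for x
      proof -
        have "(1 - e) * x \<le> 1 - e" "0 \<le> (1 - e) * x" using that e0 by (auto intro!: mult_left_le)
        then show ?thesis using e0 unfolding greaterThanAtMost_iff by linarith
      qed
      show "path R" unfolding path_def R_def subpath_def
        by (rule continuous_on_compose2[OF \<open>continuous_on {0<..1} r\<close>])
           (use m in \<open>auto intro!: continuous_intros simp: algebra_simps\<close>)
      show "path_image R \<subseteq> X" using m rX by (auto simp: path_image_def R_def subpath_def algebra_simps)
    qed
    \<comment> \<open>The time at which \<open>R\<close> passes from \<open>p\<close> to \<open>q\<close>.\<close>
    define \<kappa> where "\<kappa> = (1/2 - e) / (1 - e)"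
    have \<kappa>: "0 < \<kappa>" "\<kappa> < 1" "(1 - e) * \<kappa> = 1/2 - e" "(1 - e) * (1 - \<kappa>) = 1/2" using e0 by (auto simp: \<kappa>_def field_simps)
    have arg1: "e + (1 - e) * (\<kappa> * x) = e + (1/2 - e) * x" for x
      using \<kappa>(3) by (metis mult.assoc)
    have arg2: "e + (1 - e) * (\<kappa> + (1 - \<kappa>) * x) = 1/2 + x/2" for x
    proof -
      have "e + (1 - e) * (\<kappa> + (1 - \<kappa>) * x) = e + (1 - e) * \<kappa> + ((1 - e) * (1 - \<kappa>)) * x"
        by (simp only: distrib_left mult.assoc add.assoc)
      then show ?thesis unfolding \<kappa>(3,4) by simp
    qed
    have BR: "subpath 0 \<kappa> R x = B x" if "x \<in> {0..1}" for x
    proof -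
      have "(1/2 - e) * x \<le> 1/2 - e" using that e0 by (intro mult_left_le) auto
      then have "e + (1/2 - e) * x \<le> 1/2" by linarith
      then have "r (e + (1/2 - e) * x) = p (2 * \<tau> * (e + (1/2 - e) * x))"
        unfolding rt by (rule if_P)
      moreover have "subpath 0 \<kappa> R x = r (e + (1 - e) * (\<kappa> * x))"
        by (simp add: subpath_def R_def algebra_simps)
      ultimately have "subpath 0 \<kappa> R x = p (2 * \<tau> * (e + (1/2 - e) * x))"
        unfolding arg1 by simp
      then show ?thesis by (simp add: B_def subpath_def algebra_simps)
    qed
    have ER: "subpath \<kappa> 1 R x = E x" if "x \<in> {0..1}" for x
    proof -
      have "subpath \<kappa> 1 R x = r (1/2 + x/2)"
        unfolding arg2[of x, symmetric] by (simp add: subpath_def R_def algebra_simps)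
      also have "\<dots> = q (\<sigma> + (1 - \<sigma>) * x)"
        using that eq by (cases "x = 0") (auto simp: rt)
      finally show ?thesis by (simp add: E_def subpath_def algebra_simps)
    qed
    have sub: "path (subpath 0 \<kappa> R)" "path (subpath \<kappa> 1 R)"
      "path_image (subpath 0 \<kappa> R) \<subseteq> X" "path_image (subpath \<kappa> 1 R) \<subseteq> X"
      using R \<kappa> path_image_subpath_subset[of 0 \<kappa> R] path_image_subpath_subset[of \<kappa> 1 R] by auto
    have BE: "path B" "path_image B \<subseteq> X" "path E" "path_image E \<subseteq> X"
      using sub BR ER path_eq[of "subpath 0 \<kappa> R" B] path_eq[of "subpath \<kappa> 1 R" E]
      by (auto simp: path_image_def)
    have "homotopic_paths X (B +++ E) (subpath 0 \<kappa> R +++ subpath \<kappa> 1 R)"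
      using sub BE by (intro homotopic_paths_join homotopic_paths_eq) 
        (auto simp: BR ER B_def E_def eq)
    also have "homotopic_paths X \<dots> (subpath 0 1 R)"
      by (rule homotopic_join_subpaths) (use R \<kappa> in auto)
    finally have BER: "homotopic_paths X (B +++ E) R" by simp
    have lk: "path_image (linepath ?k (p ?e)) \<subseteq> X"
      using closed_segment_subset[OF anchor_in_region pe K(1)] K(2) by auto
    have hom: "homotopic_paths X ((linepath ?k (p ?e) +++ B +++ linepath (p \<tau>) ?l) +++
          (linepath ?l (q \<sigma>) +++ E +++ linepath (q 1) z))
         (linepath ?k (p ?e) +++ (B +++ E) +++ linepath (q 1) z)"
      using BE lk closed_segment_subset[OF anchor_in_region p\<tau> L(1)] closed_segment_subset[OF p\<tau> anchor_in_region L(1)]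
      by (intro homotopic_paths_cancel_detour[OF _ _ _ _ _ _ _ _ _ _ L])
         (auto simp: B_def E_def eq q1 reg(3))
    have "homotopic_paths X (linepath ?k (p ?e) +++ (B +++ E) +++ linepath (q 1) z) (linepath ?k (p ?e) +++ R +++ linepath (q 1) z)"
      using lk reg(3) by (intro homotopic_paths_join BER) (auto simp: B_def E_def q1)
    then have "homotopic_paths X (anchored ?k ?l ?e \<tau> p +++ anchored ?l z \<sigma> 1 q) (anchored ?k z e 1 r)"
      using homotopic_paths_trans[OF hom] by (simp add: anchored_def B_def E_def R_def re q1)
    moreover have "homotopic_paths X (anchored ?k ?l ?e \<tau> p +++ anchored ?l z \<sigma> 1 q) (G1 +++ G2)"
      by (rule homotopic_paths_join[OF pG1 qG2]) (simp add: anchored_def)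
    ultimately show ?thesis using homotopic_paths_sym homotopic_paths_trans by blast
  qed
  ultimately have "\<forall>\<^sub>F e in at_right 0. homotopic_paths X (anchored ?k z e 1 r) (G1 +++ G2)"
    by (auto elim!: eventually_mono)
  then show ?thesis using rt_mem by (simp add: a c cutoff_def)
qed

lemma truncates_to_pcomp:
  fixes C :: "(real \<Rightarrow> 'a::real_normed_vector) set"
  assumes "truncates_to X (Tangential \<alpha>) (Tangential \<beta>) C G1" "truncates_to X (Tangential \<beta>) (Pt z) D G2"
    and "convex_region X (Tangential \<alpha>)" "convex_region X (Tangential \<beta>)" "z \<in> X"
  shows "truncates_to X (Tangential \<alpha>) (Pt z) (pcomp X (Tangential \<alpha>) (Tangential \<beta>) (Pt z) C D) (G1 +++ G2)"
proof -
  let ?R = "\<Union>p\<in>C. \<Union>q\<in>D. {r. composite (Tangential \<beta>) p q r}"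
  have "truncates_to X (Tangential \<alpha>) (Pt z) ?R (G1 +++ G2)"
    using composite_truncates_to[OF refl refl refl assms(3-5)] assms(1,2) unfolding truncates_to_def by blast
  then have "truncates_to X (Tangential \<alpha>) (Pt z) (\<Union>g\<in>?R. pclass X (Tangential \<alpha>) (Pt z) g) (G1 +++ G2)"
    by (rule truncates_to_Union_pclass) (use assms in \<open>auto simp: convex_region_def\<close>)
  moreover have "(\<Union>g\<in>?R. pclass X (Tangential \<alpha>) (Pt z) g) = pcomp X (Tangential \<alpha>) (Tangential \<beta>) (Pt z) C D"
    unfolding pcomp_def by blast
  ultimately show ?thesis by simp
qed

section \<open>The dilogarithm integral on the logarithmic cover\<close>

lemma covering_space_restrict:
  assumes "covering_space c p S" "S' \<subseteq> S"
  shows "covering_space (c \<inter> p -` S') p S'"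
proof
  show "continuous_on (c \<inter> p -` S') p"
    using covering_space_imp_continuous[OF assms(1)] continuous_on_subset by blast
  show "p ` (c \<inter> p -` S') = S'"
    using covering_space_imp_surjective[OF assms(1)] assms(2) by auto
  fix x assume x: "x \<in> S'"
  then obtain T v where T: "x \<in> T" "openin (top_of_set S) T"
    and v: "\<Union>v = c \<inter> p -` T" "\<And>u. u \<in> v \<Longrightarrow> openin (top_of_set c) u" "pairwise disjnt v"
      "\<And>u. u \<in> v \<Longrightarrow> \<exists>q. homeomorphism u T p q"
    using assms unfolding covering_space_def by (meson subsetD)
  let ?v = "(\<lambda>u. u \<inter> p -` S') ` v"
  show "\<exists>T. x \<in> T \<and> openin (top_of_set S') T \<and>
     (\<exists>v. \<Union> v = (c \<inter> p -` S') \<inter> p -` T \<and> (\<forall>u\<in>v. openin (top_of_set (c \<inter> p -` S')) u) \<and>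
        pairwise disjnt v \<and> (\<forall>u\<in>v. \<exists>q. homeomorphism u T p q))"
  proof (intro exI[of _ "T \<inter> S'"] exI[of _ ?v] conjI ballI)
    show "x \<in> T \<inter> S'" using x T by auto
    show "openin (top_of_set S') (T \<inter> S')"
      using T(2) assms(2) by (auto simp: openin_open)
    show "\<Union> ?v = (c \<inter> p -` S') \<inter> p -` (T \<inter> S')" using v(1) by auto
    show "pairwise disjnt ?v"
      using v(3) by (auto simp: pairwise_def disjnt_def)
    fix u' assume "u' \<in> ?v"
    then obtain u where u: "u \<in> v" "u' = u \<inter> p -` S'" by auto
    show "openin (top_of_set (c \<inter> p -` S')) u'"
      using v(2)[OF u(1)] u(2) by (auto simp: openin_open)
    obtain q where q: "homeomorphism u T p q" using v(4)[OF u(1)] by blast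
    have "homeomorphism u' (T \<inter> S') p q"
      by (rule homeomorphism_of_subsets[OF q]) (use q u(2) in \<open>auto simp: homeomorphism_def\<close>)
    then show "\<exists>q. homeomorphism u' (T \<inter> S') p q" by blast
  qed
qed

text \<open>
  Composed with \<open>w \<mapsto> 1 - w\<close> this covers the thrice punctured sphere. Paths are transported by that reflection
  where needed.
\<close>

lemma covering_space_exp_minus_one: "covering_space {w::complex. exp w \<noteq> 1} exp (- {0, 1})"
  using covering_space_restrict[OF covering_space_exp_punctured_plane, of "- {0, 1}"]
  by (simp add: vimage_def Collect_neg_eq)

text \<open>
  The form \<open>- w dz / z\<close> written in the coordinate \<open>w\<close>, where \<open>z = 1 - exp w\<close>. It extends holomorphically to
  \<open>w = 0\<close>, where it takes the value \<open>- 1\<close>, but has poles at the other points over \<open>z = 0\<close>.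
\<close>

definition Li2_form :: "complex \<Rightarrow> complex" where
  "Li2_form w = (if w = 0 then -1 else w * exp w / (1 - exp w))"

definition Li2_plane :: "complex set" where
  "Li2_plane = {w. exp w = 1 \<longrightarrow> w = 0}"

lemma open_Li2_plane: "open Li2_plane"
proof -
  have "w = 0" if w: "exp w = 1" "norm w < 1" for w :: complex
  proof -
    obtain n :: int where n: "Re w = 0" "Im w = of_int (2 * n) * pi"
      using w(1) unfolding exp_eq_1 by blast
    have "\<bar>Im w\<bar> < 1" using abs_Im_le_cmod[of w] w(2) by linarith
    then have less: "\<bar>of_int (2 * n) :: real\<bar> * pi < 1" using n(2) by (simp add: abs_mult)
    have "n = 0"
    proof (rule ccontr)
      assume "n \<noteq> 0"
      then have "1 \<le> \<bar>of_int (2 * n) :: real\<bar>" by linarith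
      then have "1 * pi \<le> \<bar>of_int (2 * n) :: real\<bar> * pi" by (intro mult_right_mono) auto
      with less pi_gt3 show False by linarith
    qed
    then show ?thesis using n by (simp add: complex_eq_iff)
  qed
  then have "Li2_plane = {w. exp w \<noteq> 1} \<union> ball 0 1"
    by (auto simp: Li2_plane_def)
  moreover have "open ({w::complex. exp w \<noteq> 1} \<union> ball 0 1)"
    by (intro open_Un open_Collect_neq continuous_intros open_ball)
  ultimately show ?thesis by simp
qed

lemma Li2_form_holomorphic: "Li2_form holomorphic_on Li2_plane"
proof (rule no_isolated_singularity[OF _ _ open_Li2_plane, of _ "{0}"])
  have eq: "Li2_form w = w * exp w / (1 - exp w)" if "w \<in> Li2_plane - {0}" for w
    using that by (simp add: Li2_form_def)
  show hol: "Li2_form holomorphic_on Li2_plane - {0}"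
    by (subst holomorphic_cong[OF refl eq]) (auto intro!: holomorphic_intros simp: Li2_plane_def)
  have "((\<lambda>w::complex. (exp (0 + w) - exp 0) / w) \<longlongrightarrow> exp 0) (at 0)"
    using DERIV_exp[of 0] unfolding DERIV_def .
  then have "((\<lambda>w::complex. - exp w / ((exp (0 + w) - exp 0) / w)) \<longlongrightarrow> - exp 0 / exp 0) (at 0)"
    by (intro tendsto_intros) auto
  then have "((\<lambda>w::complex. - exp w / ((exp (0 + w) - exp 0) / w)) \<longlongrightarrow> -1) (at 0)"
    by simp
  then have "(Li2_form \<longlongrightarrow> -1) (at 0)"
  proof (rule Lim_transform_eventually)
    have "\<forall>\<^sub>F w in at 0. w \<in> Li2_plane - {0}"
      using open_Li2_plane by (intro eventually_at_in_open) (auto simp: Li2_plane_def)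
    then show "\<forall>\<^sub>F w in at 0. - exp w / ((exp (0 + w) - exp 0) / w) = Li2_form w"
    proof eventually_elim
      fix w assume w: "w \<in> Li2_plane - {0}"
      have "- a / (c / w) = w * a / (- c)" for a c by simp
      from this[of "exp w" "exp w - 1"] show "- exp w / ((exp (0 + w) - exp 0) / w) = Li2_form w"
        using w by (simp add: Li2_form_def)
    qed
  qed
  then have "isCont Li2_form 0" by (simp add: isCont_def Li2_form_def)
  moreover have "isCont Li2_form w" if "w \<in> Li2_plane - {0}" for w
    using holomorphic_on_imp_continuous_on[OF hol] that open_Li2_plane
    by (metis continuous_on_eq_continuous_at open_delete)
  ultimately show "continuous_on Li2_plane Li2_form"
    by (metis DiffI continuous_at_imp_continuous_on singletonD)
qed simp

lemma Li1_path_primitive: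
  assumes g: "valid_path g" "\<And>t. t \<in> {0..1} \<Longrightarrow> g t \<noteq> 1" and S: "finite S"
    and L: "continuous_on {0..1} L" "L 0 = 0"
      "\<And>t. t \<in> {0<..<1} - S \<Longrightarrow> (L has_vector_derivative vector_derivative g (at t) / (g t - 1)) (at t)"
    and s: "s \<in> {0..1}"
  shows "Li1_path (subpath 0 s g) = - L s"
proof -
  have int: "((\<lambda>t. 1 / (1 - g t) * vector_derivative g (at t)) has_integral (- L x)) {0..x}" if "x \<in> {0..1}" for x
  proof -
    have "((\<lambda>t. - (vector_derivative g (at t) / (g t - 1))) has_integral (- (L x - L 0))) {0..x}"
    proof (intro has_integral_neg fundamental_theorem_of_calculus_interior_strong[OF S])
      show "continuous_on {0..x} L" by (rule continuous_on_subset[OF L(1)]) (use that in auto)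
    qed (use that L(3) in auto)
    moreover have "- (v / (w - 1)) = 1 / (1 - w) * v" for v w :: complex
      by (metis minus_diff_eq minus_divide_right mult.left_neutral times_divide_eq_left)
    ultimately show ?thesis using L(2) by simp
  qed
  have "(\<lambda>t. 1 / (1 - t)) contour_integrable_on g"
    using int[of 1] by (auto simp: contour_integrable_on)
  then show ?thesis
    using contour_integral_subcontour_integral[of "\<lambda>t. 1 / (1 - t)" g 0 s] g(1) s int[OF s]
    by (simp add: Li1_path_def integral_unique)
qed

lemma valid_path_obtain_deriv:
  fixes g :: "real \<Rightarrow> complex"
  assumes "valid_path g"
  obtains S where "finite S" "{0, 1} \<subseteq> S" 
    "\<And>t. t \<in> {0..1} - S \<Longrightarrow> (g has_vector_derivative vector_derivative g (at t)) (at t)"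
    "continuous_on ({0..1} - S) (\<lambda>t. vector_derivative g (at t))"
proof -
  obtain S where S: "finite S" "g C1_differentiable_on ({0..1} - S)"
    using assms by (auto simp: valid_path_def piecewise_C1_differentiable_on_def)
  then have "g C1_differentiable_on ({0..1} - (S \<union> {0, 1}))"
    by (elim C1_differentiable_on_subset) auto
  then show ?thesis 
    using that[of "S \<union> {0, 1}"] S(1) by (auto simp: C1_differentiable_on_eq vector_derivative_works)
qed

text \<open>
  The lift is the integral of \<open>g' / (g - 1)\<close>. Lifting by integration rather than by the covering property gives
  a piecewise smooth lift and identifies it with the inner integral of the dilogarithm at the same time.
\<close>

lemma log_lift:
  assumes g: "valid_path g" "g 0 = 0" "\<And>t. t \<in> {0..1} \<Longrightarrow> g t \<noteq> 1"
  obtains w S where "valid_path w" "w 0 = 0" "\<And>t. t \<in> {0..1} \<Longrightarrow> exp (w t) = 1 - g t" "finite S"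
    "\<And>t. t \<in> {0<..<1} - S \<Longrightarrow> (w has_vector_derivative vector_derivative g (at t) / (g t - 1)) (at t)"
    "\<And>t. t \<in> {0..1} \<Longrightarrow> Li1_path (subpath 0 t g) = - w t"
proof -
  obtain S where S: "finite S" "{0, 1} \<subseteq> S"
    "\<And>t. t \<in> {0..1} - S \<Longrightarrow> (g has_vector_derivative vector_derivative g (at t)) (at t)"
    "continuous_on ({0..1} - S) (\<lambda>t. vector_derivative g (at t))"
    using valid_path_obtain_deriv[OF g(1)] by blast
  define F where "F = (\<lambda>t. vector_derivative g (at t) / (g t - 1))"
  define w where "w = (\<lambda>t. integral {0..t} F)"
  have gp: "g piecewise_C1_differentiable_on {0..1}" using g(1) by (simp add: valid_path_def)
  have gc: "continuous_on {0..1} g" using g(1) valid_path_imp_path path_def by blast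
  have exp: "exp (- w t) * (g t - 1) = g 0 - 1" if "t \<in> {0..1}" for t
    unfolding w_def F_def using that g(3)
    by (intro winding_number_exp_integral(2) piecewise_C1_differentiable_on_subset[OF gp]) auto
  have Fi: "F integrable_on {0..1}"
    unfolding F_def using g(3) by (intro winding_number_exp_integral(1) gp) auto
  have wc: "continuous_on {0..1} w"
    unfolding w_def by (rule indefinite_integral_continuous_1[OF Fi])
  have Fc: "continuous_on ({0..1} - S) F"
    unfolding F_def using S(4) continuous_on_subset[OF gc] g(3) by (intro continuous_intros) auto
  have eqS: "{0..1} - S = {0<..<1} - S"
  proof -
    have "t \<noteq> 0 \<and> t \<noteq> 1" if "t \<in> {0..1} - S" for t using that S(2) by blast
    then show ?thesis by fastforce
  qed
  then have op: "open ({0..1} - S)" using S(1) finite_imp_closed by (metis open_Diff open_greaterThanLessThan)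
  have wd: "(w has_vector_derivative F t) (at t)" if t: "t \<in> {0..1} - S" for t
  proof -
    have "continuous (at t within {0..1}) F"
      using Fc op t by (simp add: continuous_on_eq_continuous_at continuous_at_imp_continuous_at_within)
    then have "(w has_vector_derivative F t) (at t within {0..1})"
      unfolding w_def using integral_has_vector_derivative_continuous_at[OF Fi, of t "{}"] t
      by simp
    moreover have "0 < t" "t < 1" using t eqS by auto
    ultimately show ?thesis by (metis at_within_Icc_at)
  qed
  have "w C1_differentiable_on {0..1} - S"
    unfolding C1_differentiable_on_def by (intro exI[of _ F] conjI ballI wd Fc)
  then have "w piecewise_C1_differentiable_on {0..1}"
    unfolding piecewise_C1_differentiable_on_def by (intro exI[of _ S] conjI wc S(1))
  then have wv: "valid_path w" by (simp add: valid_path_def)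
  have w0: "w 0 = 0" by (simp add: w_def)
  have d: "(w has_vector_derivative vector_derivative g (at t) / (g t - 1)) (at t)" if "t \<in> {0<..<1} - S" for t
    using wd[of t] that by (auto simp: F_def)
  show ?thesis
  proof (rule that[OF wv w0 _ S(1)])
    show "exp (w t) = 1 - g t" if "t \<in> {0..1}" for t
    proof -
      have "exp (w t) * exp (- w t) * (g t - 1) = exp (w t) * (0 - 1)"
        using exp[OF that] g(2) by (simp only: mult.assoc)
      then have "g t - 1 = - exp (w t)" by (simp add: exp_minus_inverse)
      then show ?thesis by (simp add: algebra_simps)
    qed
    show "Li1_path (subpath 0 t g) = - w t" if "t \<in> {0..1}" for t
      by (rule Li1_path_primitive[where g = g and L = w and S = S]) (use g S(1) wc w0 d that in auto)
  qed (rule d)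
qed

text \<open>
  The iterated integral has become an ordinary one. The two integrands agree off finitely many times, so no
  integrability is involved.
\<close>

lemma Li2_path_eq_contour_integral:
  assumes g: "valid_path g" "\<And>t. t \<in> {0<..1} \<Longrightarrow> g t \<noteq> 0 \<and> g t \<noteq> 1"
    and w: "\<And>t. t \<in> {0..1} \<Longrightarrow> exp (w t) = 1 - g t" "finite S"
    "\<And>t. t \<in> {0<..<1} - S \<Longrightarrow> (w has_vector_derivative vector_derivative g (at t) / (g t - 1)) (at t)"
    "\<And>t. t \<in> {0..1} \<Longrightarrow> Li1_path (subpath 0 t g) = - w t"
  shows "Li2_path g = contour_integral w Li2_form"
proof -
  have "contour_integral w Li2_form = integral {0..1} (\<lambda>x. Li2_form (w x) * vector_derivative w (at x))"
    by (simp add: contour_integral_integral)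
  also have "\<dots> = Li2_path g"
    unfolding Li2_path_def
  proof (rule integral_spike)
    show "negligible (S \<union> {0, 1})" using w(2) by (auto intro: negligible_finite)
    fix t assume t: "t \<in> {0..1} - (S \<union> {0, 1})"
    then have t01: "t \<in> {0<..<1} - S" by auto
    have g0: "g t \<noteq> 0" "g t \<noteq> 1" using g(2)[of t] t by auto
    have e: "exp (w t) = 1 - g t" using w(1) t by auto
    then have "w t \<noteq> 0" using g0 by auto
    then have "Li2_form (w t) = w t * (1 - g t) / g t" using e by (simp add: Li2_form_def)
    moreover have "vector_derivative w (at t) = vector_derivative g (at t) / (g t - 1)"
      using w(3)[OF t01] by (rule vector_derivative_at)
    moreover have "vector_derivative g (at t within {0..1}) = vector_derivative g (at t)"
      using t by (simp add: at_within_Icc_at)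
    moreover have "g t - 1 \<noteq> 0" using g0 by simp
    moreover have cancel: "a * (1 - b) / b * (v / (b - 1)) = 1 / b * - a * v" if "b - 1 \<noteq> 0" "b \<noteq> 0" for a b v :: complex
    proof -
      have "a * (- c) / b * (v / c) = 1 / b * - a * v" if "c \<noteq> 0" for c
        using that \<open>b \<noteq> 0\<close> by simp
      from this[OF that(1)] show ?thesis by (simp only: minus_diff_eq)
    qed
    ultimately show "1 / g t * Li1_path (subpath 0 t g) * vector_derivative g (at t within {0..1}) =
         Li2_form (w t) * vector_derivative w (at t)"
      using w(4)[of t] t g0 by (simp add: cancel)
  qed
  finally show ?thesis by simp
qed

text \<open>
  Undoes a truncation: if the path does have a starting point, then it is homotopic to the detour through
  the fixed point \<open>c\<close> as long as the initial part lies in a convex set.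
\<close>

lemma homotopic_initial_detour:
  fixes w :: "real \<Rightarrow> 'a::real_normed_vector"
  assumes w: "path w" "path_image w \<subseteq> X" and e: "0 < e" "e < 1"
    and K: "convex K" "K \<subseteq> X" "w ` {0..e} \<subseteq> K" "c \<in> K"
    and \<alpha>: "path \<alpha>" "path_image \<alpha> \<subseteq> K" "pathstart \<alpha> = c" "pathfinish \<alpha> = w e"
  shows "homotopic_paths X w (linepath (w 0) c +++ (\<alpha> +++ (subpath e 1 w +++ linepath (w 1) (w 1))))"
proof -
  have sub: "path (subpath u v w)" "path_image (subpath u v w) \<subseteq> X" if "u \<in> {0..1}" "v \<in> {0..1}" for u v
    using w that path_image_subpath_subset[of u v w] by auto
  have w0: "w 0 \<in> K" using K e by auto
  have lin: "path_image (linepath (w 0) c) \<subseteq> K" 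
    using closed_segment_subset[OF w0 K(4) K(1)] by simp
  note [simp] = \<alpha> w
  have im: "path_image (linepath (w 0) c) \<subseteq> X" "path_image \<alpha> \<subseteq> X" "w 1 \<in> X"
    using lin \<alpha>(2) K(2) w(2) by (auto simp: path_image_def)
  have im2: "path_image (linepath (w 0) c +++ \<alpha>) \<subseteq> X"
    using im by (intro subset_path_image_join)
  have "homotopic_paths X (subpath 0 e w) (linepath (w 0) c +++ \<alpha>)"
    by (rule homotopic_paths_in_convex[OF K(1,2)])
       (use e lin \<alpha> K(3) sub(1)[of 0 e] in \<open>auto simp: path_image_join path_image_subpath\<close>)
  then have "homotopic_paths X (subpath 0 e w +++ subpath e 1 w) ((linepath (w 0) c +++ \<alpha>) +++ (subpath e 1 w +++ linepath (w 1) (w 1)))"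
  proof (rule homotopic_paths_join)
    show "homotopic_paths X (subpath e 1 w) (subpath e 1 w +++ linepath (w 1) (w 1))"
      using sub[of e 1] e by (intro homotopic_paths_sym[OF homotopic_paths_rid']) auto
  qed auto
  moreover have "homotopic_paths X (subpath 0 e w +++ subpath e 1 w) w"
    using homotopic_join_subpaths[OF w, of 0 e 1] e by auto
  moreover have "homotopic_paths X (linepath (w 0) c +++ (\<alpha> +++ (subpath e 1 w +++ linepath (w 1) (w 1)))) 
     ((linepath (w 0) c +++ \<alpha>) +++ (subpath e 1 w +++ linepath (w 1) (w 1)))"
    using im sub[of e 1] e by (intro homotopic_paths_assoc subset_path_image_join) auto
  ultimately show ?thesis
    using homotopic_paths_sym homotopic_paths_trans by blast
qed

section \<open>Homotopy invariance of the integrals\<close>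

definition slit_plane :: "complex set" where
  "slit_plane = {z. 1 - z \<notin> \<real>\<^sub>\<le>\<^sub>0}"

lemma Ln_one_minus_deriv:
  assumes "z \<in> slit_plane"
  shows "((\<lambda>z. - Ln (1 - z)) has_field_derivative 1 / (1 - z)) (at z)"
  using assms by (auto intro!: derivative_eq_intros simp: slit_plane_def inverse_eq_divide)

lemma Li1_path_slit:
  assumes "valid_path g" "path_image g \<subseteq> slit_plane" "pathstart g = 0"
  shows "Li1_path g = - Ln (1 - pathfinish g)"
proof -
  have "((\<lambda>z. 1 / (1 - z)) has_contour_integral (- Ln (1 - pathfinish g) - (- Ln (1 - pathstart g)))) g"
    by (rule contour_integral_primitive[OF _ assms(1,2)])
      (auto intro: Ln_one_minus_deriv has_field_derivative_at_within)
  then show ?thesis using assms(3) by (simp add: Li1_path_def contour_integral_unique)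
qed

lemma of_real_in_slit_plane: "x < 1 \<Longrightarrow> complex_of_real x \<in> slit_plane"
  by (auto simp: slit_plane_def complex_nonpos_Reals_iff)

lemma tangential_start:
  fixes g :: "real \<Rightarrow> 'a::t2_space"
  assumes "starts_at e (Tangential b) g" "0 < e" "path g" "(b \<longlongrightarrow> c) (at_right 0)"
  shows "g 0 = c"
proof -
  obtain u where u: "continuous_on {0<..e} u" "(u \<longlongrightarrow> (0::real)) (at_right 0)"
    "\<forall>t\<in>{0<..e}. 0 < u t \<and> u t < 1 \<and> g t = b (u t)" using assms(1) by auto
  have ev: "\<forall>\<^sub>F t in at_right 0. t \<in> {0<..e}"
    unfolding eventually_at_right_field using assms(2) by (intro exI[of _ e]) auto
  have "\<forall>\<^sub>F t in at_right 0. u t \<in> {0<..} \<and> u t \<noteq> 0"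
    using ev by eventually_elim (use u(3) in force)
  then have "filterlim u (at_right 0) (at_right 0)"
    using u(2) by (simp add: filterlim_at)
  then have "((\<lambda>t. b (u t)) \<longlongrightarrow> c) (at_right 0)"
    using assms(4) filterlim_compose by blast
  then have "(g \<longlongrightarrow> c) (at_right 0)"
    by (rule Lim_transform_eventually) (use ev in \<open>eventually_elim, use u(3) in auto\<close>)
  moreover have "(g \<longlongrightarrow> g 0) (at_right 0)"
  proof -
    have "(g \<longlongrightarrow> g 0) (at 0 within {0..1})"
      using assms(3) by (auto simp: path_def continuous_on)
    then show ?thesis by (simp add: at_within_Icc_at_right)
  qed
  ultimately show ?thesis using tendsto_unique[OF trivial_limit_at_right_real] by blast
qed

lemma tpaths_Tangential_PtD:
  assumes "g \<in> tpaths X (Tangential b) (Pt z)"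
  shows "g 1 = z" "\<And>t. t \<in> {0<..1} \<Longrightarrow> g t \<in> X"
    and "\<exists>e0\<in>{0<..<1}. starts_at e0 (Tangential b) g"
proof -
  have "path_dom (Tangential b) (Pt z) = {0<..1}" by (auto simp: path_dom_def)
  then show "g 1 = z" "\<And>t. t \<in> {0<..1} \<Longrightarrow> g t \<in> X" "\<exists>e0\<in>{0<..<1}. starts_at e0 (Tangential b) g"
    using assms by (auto simp: tpaths_def joins_def reversepath_def simp del: starts_at.simps(2))
qed

text \<open>
  On the initial part, \<open>1 - g\<close> takes values in \<open>(0, 1]\<close>, so the lift \<open>w\<close> is the principal logarithm there and runs
  in the non-positive reals, a convex subset of the domain of \<open>Li2_form\<close> which contains the starting point \<open>0\<close>. Hence \<open>w\<close> is
  homotopic to a fixed segment followed by a lift \<open>M\<close> of the truncation of \<open>g\<close>.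
\<close>

lemma lift_anchored:
  assumes g: "g \<in> tpaths P1m tb01 (Pt z)" and v: "valid_path g"
    and e0: "starts_at e0 tb01 g" and e: "0 < e" "e \<le> e0" "e < 1"
  shows "\<exists>M w. path M \<and> path_image M \<subseteq> {w. exp w \<noteq> 1} \<and> pathstart M = Ln (1 / 2) \<and>
    (\<forall>t\<in>{0..1}. exp (M t) = 1 - anchored (1 / 2) z e 1 g t) \<and> valid_path w \<and>
    Li2_path g = contour_integral w Li2_form \<and>
    homotopic_paths Li2_plane w (linepath 0 (Ln (1 / 2)) +++ M)"
proof -
  have g1: "g 1 = z" and gX: "\<And>t. t \<in> {0<..1} \<Longrightarrow> g t \<noteq> 0 \<and> g t \<noteq> 1"
    using tpaths_Tangential_PtD[OF g[unfolded tb01_def]] by (auto simp: P1m_def)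
  have g0: "g 0 = 0"
  proof (rule tangential_start[OF e0[unfolded tb01_def]])
    have "((\<lambda>t. complex_of_real t) \<longlongrightarrow> of_real 0) (at_right 0)" by (intro tendsto_intros)
    then show "((\<lambda>t. complex_of_real t) \<longlongrightarrow> 0) (at_right 0)" by simp
  qed (use e v in \<open>auto dest: valid_path_imp_path\<close>)
  have real: "\<exists>r. 0 < r \<and> r < 1 \<and> g t = complex_of_real r" if "t \<in> {0<..e}" for t
    using e0 that e(2) by (auto simp: tb01_def)
  have real0: "\<exists>r. 0 \<le> r \<and> r < 1 \<and> g t = complex_of_real r" if "t \<in> {0..e}" for t
  proof (cases "t = 0")
    case True
    then show ?thesis using g0 by (intro exI[of _ 0]) auto
  next
    case False
    then show ?thesis using real[of t] that by (auto intro: less_imp_le)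
  qed
  have gne1: "g t \<noteq> 1" if "t \<in> {0..1}" for t
    using gX[of t] g0 that by (cases "t = 0") auto
  obtain w S where w: "valid_path w" "w 0 = 0" "\<And>t. t \<in> {0..1} \<Longrightarrow> exp (w t) = 1 - g t" "finite S"
    "\<And>t. t \<in> {0<..<1} - S \<Longrightarrow> (w has_vector_derivative vector_derivative g (at t) / (g t - 1)) (at t)"
    "\<And>t. t \<in> {0..1} \<Longrightarrow> Li1_path (subpath 0 t g) = - w t"
    using log_lift[OF v g0 gne1] by blast
  have Li2: "Li2_path g = contour_integral w Li2_form"
    by (rule Li2_path_eq_contour_integral[OF v gX w(3,4,5,6)])
  have pw: "path w" using w(1) valid_path_imp_path by blast
  have wLn: "w t = Ln (1 - g t)" if t: "t \<in> {0..e}" for t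
  proof -
    have "path_image (subpath 0 t g) \<subseteq> slit_plane"
    proof -
      have "g ` {0..t} \<subseteq> slit_plane"
        using real0 of_real_in_slit_plane t by fastforce
      then show ?thesis using t by (simp add: path_image_subpath)
    qed
    moreover have "valid_path (subpath 0 t g)"
      using v t e by (intro valid_path_subpath) auto
    ultimately have "Li1_path (subpath 0 t g) = - Ln (1 - g t)"
      using Li1_path_slit[of "subpath 0 t g"] g0 by simp
    then show ?thesis using w(6)[of t] t e by simp
  qed
  define K where "K = {w :: complex. Im w = 0 \<and> Re w \<le> 0}"
  have K: "convex K" "K \<subseteq> Li2_plane"
  proof -
    show "convex K" unfolding K_def convex_def
      by (auto intro: add_nonpos_nonpos mult_nonneg_nonpos)
    show "K \<subseteq> Li2_plane" by (auto simp: K_def Li2_plane_def exp_eq_1 intro: complex_eqI)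
  qed
  have LnK: "Ln (1 - complex_of_real r) \<in> K" if "0 \<le> r" "r < 1" for r
  proof -
    have "Ln (1 - complex_of_real r) = complex_of_real (ln (1 - r))"
      using that Ln_of_real[of "1 - r"] by simp
    then show ?thesis using that by (simp add: K_def)
  qed
  have wK: "w ` {0..e} \<subseteq> K" using wLn real0 LnK by fastforce
  define \<alpha> where "\<alpha> = (\<lambda>t. Ln (1 - linepath (1/2) (g e) t))"
  obtain r where r: "0 < r" "r < 1" "g e = complex_of_real r" using real[of e] e by auto
  have line: "linepath (1/2) (g e) t = complex_of_real ((1 - t) / 2 + t * r)" for t
    by (simp add: linepath_def r(3) scaleR_conv_of_real)
  have line01: "(1 - t) / 2 + t * r \<in> {0<..<1}" if "t \<in> {0..1}" for t
  proof -
    have "0 \<le> t * r" "t * r \<le> t" using that r by (auto intro!: mult_left_le)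
    moreover have "0 < t * r" "t * r < t" if "0 < t" using that r by auto
    ultimately show ?thesis using that unfolding greaterThanLessThan_iff atLeastAtMost_iff
      by (cases "t = 0") (simp, argo)
  qed
  have line_ne: "linepath (1/2) (g e) t \<noteq> 0 \<and> linepath (1/2) (g e) t \<noteq> 1" if "t \<in> {0..1}" for t
  proof -
    have "complex_of_real x \<noteq> 0 \<and> complex_of_real x \<noteq> 1" if "x \<in> {0<..<1}" for x using that by simp
    from this[OF line01[OF that]] show ?thesis unfolding line .
  qed
  have \<alpha>: "path \<alpha>" "path_image \<alpha> \<subseteq> K" "pathstart \<alpha> = Ln (1/2)" "pathfinish \<alpha> = w e"
  proof -
    show "path \<alpha>" unfolding path_def \<alpha>_def
    proof (intro continuous_intros)
      show "1 - linepath (1/2) (g e) t \<notin> \<real>\<^sub>\<le>\<^sub>0" if "t \<in> {0..1}" for t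
        using of_real_in_slit_plane[of "(1 - t) / 2 + t * r"] line01[OF that] unfolding line slit_plane_def by simp
    qed
    show "path_image \<alpha> \<subseteq> K"
      unfolding path_image_def \<alpha>_def line
    proof (rule image_subsetI)
      fix t :: real assume "t \<in> {0..1}"
      from line01[OF this] show "Ln (1 - complex_of_real ((1 - t) / 2 + t * r)) \<in> K"
        by (intro LnK) (simp_all only: greaterThanLessThan_iff less_imp_le)
    qed
    show "pathstart \<alpha> = Ln (1/2)" by (simp add: \<alpha>_def pathstart_def linepath_def)
    show "pathfinish \<alpha> = w e" using wLn[of e] e by (simp add: \<alpha>_def pathfinish_def linepath_def)
  qed
  define M where "M = \<alpha> +++ (subpath e 1 w +++ linepath (w 1) (w 1))"
  have conv: "(1 - e) * t + e \<in> {0..1}" if "t \<in> {0..1}" for t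
  proof -
    have "(1 - e) * t \<le> 1 - e" "0 \<le> (1 - e) * t" using that e by (auto intro!: mult_left_le)
    then show ?thesis using e unfolding atLeastAtMost_iff by linarith
  qed
  have expM: "exp (M t) = 1 - anchored (1 / 2) z e 1 g t" if t: "t \<in> {0..1}" for t
  proof -
    have 1: "exp (\<alpha> s) = 1 - linepath (1/2) (g e) s" if "s \<in> {0..1}" for s
    proof -
      show ?thesis using line_ne[OF that] by (simp add: \<alpha>_def)
    qed
    have 2: "exp (subpath e 1 w s) = 1 - subpath e 1 g s" if "s \<in> {0..1}" for s
      using w(3)[OF conv[OF that]] by (simp add: subpath_def)
    have 3: "exp (linepath (w 1) (w 1) s) = 1 - linepath (g 1) z s" for s
      using w(3)[of 1] g1 by (simp add: linepath_refl)
    show ?thesis unfolding M_def anchored_def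
      using t 1[of "2 * t"] 2[of "2 * (2 * t - 1)"] 3 by (auto simp: joinpaths_def)
  qed
  have hom: "homotopic_paths Li2_plane w (linepath (w 0) (Ln (1/2)) +++ M)"
    unfolding M_def
  proof (rule homotopic_initial_detour[OF pw _ e(1,3) K wK])
    have "w t \<in> Li2_plane" if "t \<in> {0..1}" for t
      using w(2) w(3)[OF that] gX[of t] that by (cases "t = 0") (auto simp: Li2_plane_def)
    then show "path_image w \<subseteq> Li2_plane" by (auto simp: path_image_def)
    show "Ln (1/2) \<in> K" using LnK[of "1/2"] by simp
  qed (use \<alpha> in auto)
  have pM: "path M" using pw e \<alpha> by (auto simp: M_def)
  have "exp (M t) \<noteq> 1" if t: "t \<in> {0..1}" for t
  proof -
    have a: "\<alpha> s \<in> {w. exp w \<noteq> 1}" if "s \<in> {0..1}" for s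
    proof -
      show ?thesis using line_ne[OF that] by (simp add: \<alpha>_def)
    qed
    have b: "exp (w s) \<noteq> 1" if "s \<in> {0<..1}" for s
      using w(3)[of s] gX[of s] that by auto
    have "path_image M \<subseteq> {w. exp w \<noteq> 1}" unfolding M_def
    proof (intro subset_path_image_join)
      show "path_image \<alpha> \<subseteq> {w. exp w \<noteq> 1}" using a by (auto simp: path_image_def)
      show "path_image (subpath e 1 w) \<subseteq> {w. exp w \<noteq> 1}"
        using b e by (auto simp: path_image_subpath)
      show "path_image (linepath (w 1) (w 1)) \<subseteq> {w. exp w \<noteq> 1}" using b[of 1] by auto
    qed
    then show ?thesis using t unfolding path_image_def by blast
  qed
  then have "path_image M \<subseteq> {w. exp w \<noteq> 1}" by (auto simp: path_image_def)
  moreover have "pathstart M = Ln (1/2)" using \<alpha>(3) by (simp add: M_def)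
  ultimately show ?thesis using pM expM w(1) Li2 hom unfolding w(2)
    by (intro exI[of _ M] exI[of _ w] conjI ballI) assumption+
qed

lemma eventually_small_cutoff:
  assumes "\<forall>\<^sub>F e in at_right 0. P e" "\<forall>\<^sub>F e in at_right 0. Q e" "0 < (c::real)"
  shows "\<exists>e. 0 < e \<and> e < c \<and> P e \<and> Q e"
proof -
  have "\<forall>\<^sub>F e in at_right 0. e < c \<and> 0 < e"
    unfolding eventually_at_right_field using assms(3) by blast
  then have "\<forall>\<^sub>F e in at_right 0. P e \<and> Q e \<and> e < c \<and> 0 < e"
    using assms(1,2) by eventually_elim auto
  then show ?thesis using eventually_happens'[OF trivial_limit_at_right_real] by blast
qed

text \<open>
  Homotopic truncations have homotopic lifts in the covering. As the domain of \<open>Li2_form\<close> contains the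
  covering space, Cauchy's theorem applies to the lifts of the whole paths.
\<close>

lemma Li2_path_unique:
  assumes C: "truncates_to P1m tb01 (Pt z) C G" and g: "g \<in> C" "valid_path g" and h: "h \<in> C" "valid_path h"
  shows "Li2_path g = Li2_path h"
proof -
  have t: "g \<in> tpaths P1m tb01 (Pt z)" "h \<in> tpaths P1m tb01 (Pt z)"
    and ev: "\<forall>\<^sub>F e in at_right 0. homotopic_paths P1m (anchored (1/2) z e 1 g) G"
      "\<forall>\<^sub>F e in at_right 0. homotopic_paths P1m (anchored (1/2) z e 1 h) G"
    using C g(1) h(1) by (auto simp: truncates_to_def cutoff_def tb01_def)
  obtain eg eh where eg: "0 < eg" "eg < 1" "starts_at eg tb01 g" and eh: "0 < eh" "eh < 1" "starts_at eh tb01 h"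
    using tpaths_Tangential_PtD(3)[OF t(1)[unfolded tb01_def]] tpaths_Tangential_PtD(3)[OF t(2)[unfolded tb01_def]]
    unfolding tb01_def greaterThanLessThan_iff Bex_def by blast
  obtain e where e: "0 < e" "e < min eg eh" and hom: "homotopic_paths P1m (anchored (1/2) z e 1 g) G"
    "homotopic_paths P1m (anchored (1/2) z e 1 h) G"
    using eventually_small_cutoff[OF ev, of "min eg eh"] eg(1) eh(1) unfolding min_less_iff_conj by blast
  have le: "e \<le> eg" "e \<le> eh" "e < 1" using e eg(2) by auto
  obtain M w where M: "path M" "path_image M \<subseteq> {w. exp w \<noteq> 1}" "pathstart M = Ln (1 / 2)"
    "\<forall>t\<in>{0..1}. exp (M t) = 1 - anchored (1 / 2) z e 1 g t" and w: "valid_path w"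
    "Li2_path g = contour_integral w Li2_form" "homotopic_paths Li2_plane w (linepath 0 (Ln (1 / 2)) +++ M)"
    using lift_anchored[OF t(1) g(2) eg(3) e(1) le(1,3)] by blast
  obtain N v where N: "path N" "path_image N \<subseteq> {w. exp w \<noteq> 1}" "pathstart N = Ln (1 / 2)"
    "\<forall>t\<in>{0..1}. exp (N t) = 1 - anchored (1 / 2) z e 1 h t" and v: "valid_path v"
    "Li2_path h = contour_integral v Li2_form" "homotopic_paths Li2_plane v (linepath 0 (Ln (1 / 2)) +++ N)"
    using lift_anchored[OF t(2) h(2) eh(3) e(1) le(2,3)] by blast
  have gh: "homotopic_paths P1m (anchored (1/2) z e 1 g) (anchored (1/2) z e 1 h)"
    using hom homotopic_paths_sym homotopic_paths_trans by blast
  have gh': "homotopic_paths (- {0, 1}) ((\<lambda>x. 1 - x) \<circ> anchored (1/2) z e 1 g) ((\<lambda>x. 1 - x) \<circ> anchored (1/2) z e 1 h)"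
  proof (rule homotopic_paths_continuous_image[OF gh])
    show "(\<lambda>x::complex. 1 - x) \<in> P1m \<rightarrow> - {0, 1}" by (auto simp: P1m_def)
  qed (intro continuous_intros)
  have "homotopic_paths {w. exp w \<noteq> 1} M N"
  proof (rule covering_space_lift_homotopic_paths[OF covering_space_exp_minus_one _ _ _ _ gh' M(1,2) _ N(1,2)])
    show "exp (M t) = ((\<lambda>x. 1 - x) \<circ> anchored (1/2) z e 1 g) t" "exp (N t) = ((\<lambda>x. 1 - x) \<circ> anchored (1/2) z e 1 h) t"
      if "t \<in> {0..1}" for t
      using M(4) N(4) that by auto
    show "pathstart M = pathstart N" by (simp only: M(3) N(3))
  qed (use homotopic_paths_imp_path[OF gh'] homotopic_paths_imp_subset[OF gh'] in simp_all)
  then have "homotopic_paths Li2_plane M N"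
    by (rule homotopic_paths_subset) (auto simp: Li2_plane_def)
  moreover have "homotopic_paths Li2_plane (linepath 0 (Ln (1 / 2))) (linepath 0 (Ln (1 / 2)))"
  proof -
    have "path_image (linepath 0 (Ln (1 / 2)) +++ M) = path_image (linepath 0 (Ln (1 / 2))) \<union> path_image M"
      by (rule path_image_join) (simp add: M(3))
    then have "path_image (linepath 0 (Ln (1 / 2))) \<subseteq> Li2_plane"
      using homotopic_paths_imp_subset[OF w(3)] by blast
    then show ?thesis by (simp only: homotopic_paths_refl path_linepath simp_thms)
  qed
  ultimately have "homotopic_paths Li2_plane (linepath 0 (Ln (1 / 2)) +++ M) (linepath 0 (Ln (1 / 2)) +++ N)"
    by (intro homotopic_paths_join) (simp_all add: M(3))
  then have "homotopic_paths Li2_plane w v"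
    by (rule homotopic_paths_trans[OF homotopic_paths_trans[OF w(3)] homotopic_paths_sym[OF v(3)]])
  then show ?thesis
    using Cauchy_theorem_homotopic_paths[OF _ open_Li2_plane Li2_form_holomorphic w(1) v(1)] unfolding w(2) v(2) by blast
qed

text \<open>
  Here the puncture of the integrand is \<open>0\<close> and the paths start at \<open>1\<close>, so Cauchy's theorem applies without passing
  to a covering.
\<close>

lemma log_path_unique:
  assumes C: "truncates_to P1m tb10 (Pt z) C G" and g: "g \<in> C" "valid_path g" and h: "h \<in> C" "valid_path h"
  shows "contour_integral g (\<lambda>t. 1 / t) = contour_integral h (\<lambda>t. 1 / t)"
proof -
  have t: "g \<in> tpaths P1m tb10 (Pt z)" "h \<in> tpaths P1m tb10 (Pt z)"
    and ev: "\<forall>\<^sub>F e in at_right 0. homotopic_paths P1m (anchored (1/2) z e 1 g) G"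
      "\<forall>\<^sub>F e in at_right 0. homotopic_paths P1m (anchored (1/2) z e 1 h) G"
    using C g(1) h(1) by (auto simp: truncates_to_def cutoff_def tb10_def)
  obtain eg eh where eg: "0 < eg" "eg < 1" "starts_at eg tb10 g" and eh: "0 < eh" "eh < 1" "starts_at eh tb10 h"
    using tpaths_Tangential_PtD(3)[OF t(1)[unfolded tb10_def]] tpaths_Tangential_PtD(3)[OF t(2)[unfolded tb10_def]]
    unfolding tb10_def greaterThanLessThan_iff Bex_def by blast
  obtain e where e: "0 < e" "e < min eg eh" and hom: "homotopic_paths P1m (anchored (1/2) z e 1 g) G"
    "homotopic_paths P1m (anchored (1/2) z e 1 h) G"
    using eventually_small_cutoff[OF ev, of "min eg eh"] eg(1) eh(1) unfolding min_less_iff_conj by blast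
  define K where "K = complex_of_real ` {0<..1}"
  have K: "convex K" "K \<subseteq> - {0}"
  proof -
    show "convex K" unfolding K_def 
      by (rule convex_linear_image[OF linearI]) (simp_all add: scaleR_conv_of_real)
    show "K \<subseteq> - {0}" by (auto simp: K_def)
  qed
  have half: "1/2 \<in> K" unfolding K_def by (rule image_eqI[of _ _ "1/2"]) auto
  have one: "1 \<in> K" unfolding K_def by (rule image_eqI[of _ _ 1]) auto
  have key: "homotopic_paths (- {0}) p (linepath 1 (1/2) +++ anchored (1/2) z e 1 p)"
    if p: "p \<in> tpaths P1m tb10 (Pt z)" "valid_path p" "starts_at e0 tb10 p" "e < e0" "e0 < 1" for p e0
  proof -
    have p1: "p 1 = z" and pX: "\<And>t. t \<in> {0<..1} \<Longrightarrow> p t \<noteq> 0"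
      using tpaths_Tangential_PtD(1,2)[OF p(1)[unfolded tb10_def]] by (auto simp: P1m_def)
    have pp: "path p" using p(2) valid_path_imp_path by blast
    have p0: "p 0 = 1"
    proof (rule tangential_start[OF p(3)[unfolded tb10_def]])
      have "((\<lambda>t. complex_of_real (1 - t)) \<longlongrightarrow> of_real (1 - 0)) (at_right 0)" by (intro tendsto_intros)
      then show "((\<lambda>t. complex_of_real (1 - t)) \<longlongrightarrow> 1) (at_right 0)"
        by (simp only: diff_zero of_real_1)
    qed (use e(1) p(4) pp in simp_all)
    have "p t \<in> K" if t: "t \<in> {0..e}" for t
    proof (cases "t = 0")
      case False
      then have "t \<in> {0<..e0}" using p(4) t by auto
      moreover obtain u where "\<forall>t\<in>{0<..e0}. 0 < u t \<and> u t < 1 \<and> p t = complex_of_real (1 - u t)"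
        using p(3)[unfolded tb10_def starts_at.simps] by (elim exE conjE)
      ultimately have "0 < u t \<and> u t < 1 \<and> p t = complex_of_real (1 - u t)" by blast
      then show ?thesis unfolding K_def by (intro image_eqI[of _ _ "1 - u t"]) simp_all
    next
      case True
      then show ?thesis unfolding K_def by (intro image_eqI[of _ _ 1]) (simp_all add: p0)
    qed
    then have pK: "p ` {0..e} \<subseteq> K" by (rule image_subsetI)
    have pe: "p e \<in> K" using e(1) by (intro subsetD[OF pK] imageI) simp
    have "homotopic_paths (- {0}) p (linepath (p 0) (1/2) +++ (linepath (1/2) (p e) +++ (subpath e 1 p +++ linepath (p 1) (p 1))))"
    proof (rule homotopic_initial_detour[OF pp _ e(1) _ K pK half])
      have "p t \<noteq> 0" if "t \<in> {0..1}" for t using pX[of t] p0 that by (cases "t = 0") simp_all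
      then show "path_image p \<subseteq> - {0}" unfolding path_image_def by (intro image_subsetI) simp
      show "e < 1" using p(4,5) by linarith
      show "path_image (linepath (1 / 2) (p e)) \<subseteq> K" using closed_segment_subset[OF half pe K(1)] by simp
    qed simp_all
    then show ?thesis by (simp add: anchored_def p0 p1)
  qed
  have "P1m \<subseteq> - {0}" by (auto simp: P1m_def)
  then have gh: "homotopic_paths (- {0}) (anchored (1/2) z e 1 g) (anchored (1/2) z e 1 h)"
    by (rule homotopic_paths_subset[OF homotopic_paths_trans[OF hom(1) homotopic_paths_sym[OF hom(2)]]])
  have "closed_segment 1 (1/2) \<subseteq> - {0 :: complex}"
    using closed_segment_subset[OF one half K(1)] K(2) by blast
  then have "homotopic_paths (- {0}) (linepath 1 (1/2)) (linepath 1 (1/2) :: real \<Rightarrow> complex)"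
    by simp
  then have "homotopic_paths (- {0}) (linepath 1 (1/2) +++ anchored (1/2) z e 1 g) (linepath 1 (1/2) +++ anchored (1/2) z e 1 h)"
    by (rule homotopic_paths_join[OF _ gh]) (simp add: anchored_def)
  then have "homotopic_paths (- {0}) (linepath 1 (1/2) +++ anchored (1/2) z e 1 g) h"
    by (rule homotopic_paths_trans[OF _ homotopic_paths_sym[OF key[OF t(2) h(2) eh(3)]]]) (use e eh in auto)
  moreover have "homotopic_paths (- {0}) g (linepath 1 (1/2) +++ anchored (1/2) z e 1 g)"
    by (rule key[OF t(1) g(2) eg(3)]) (use e eg in auto)
  ultimately have gh: "homotopic_paths (- {0}) g h"
    using homotopic_paths_trans by blast
  have "(\<lambda>t. 1 / t) holomorphic_on - {0}" by (intro holomorphic_intros) auto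
  then show ?thesis
    by (rule Cauchy_theorem_homotopic_paths[OF gh open_Compl[OF closed_singleton] _ g(2) h(2)])
qed

lemma Li2_eqI:
  assumes "truncates_to P1m tb01 (Pt z) C G" "g \<in> C" "valid_path g"
  shows "Li2 z C = Li2_path g"
  unfolding Li2_def class_value_def
proof (rule the_equality)
  have "g \<in> tpaths P1m tb01 (Pt z)" using assms(1,2) unfolding truncates_to_def by blast
  then have "pathfinish g = z"
    using tpaths_Tangential_PtD(1) unfolding tb01_def pathfinish_def by blast
  then show "\<exists>h\<in>C. valid_path h \<and> pathfinish h = z \<and> Li2_path g = Li2_path h" using assms by blast
  show "I = Li2_path g" if "\<exists>h\<in>C. valid_path h \<and> pathfinish h = z \<and> I = Li2_path h" for I
    using that Li2_path_unique[OF assms(1) _ _ assms(2,3)] by auto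
qed

lemma log_along_eqI:
  assumes "truncates_to P1m tb10 (Pt z) (pcomp P1m tb10 tb01 (Pt z) (pinv delta_10) C) G"
    "g \<in> pcomp P1m tb10 tb01 (Pt z) (pinv delta_10) C" "valid_path g"
  shows "log_along z C = contour_integral g (\<lambda>t. 1 / t)"
  unfolding log_along_def class_value_def
proof (rule the_equality)
  have "g \<in> tpaths P1m tb10 (Pt z)" using assms(1,2) unfolding truncates_to_def by blast
  then have "pathfinish g = z"
    using tpaths_Tangential_PtD(1) unfolding tb10_def pathfinish_def by blast
  then show "\<exists>h\<in>pcomp P1m tb10 tb01 (Pt z) (pinv delta_10) C. valid_path h \<and> pathfinish h = z \<and>
      contour_integral g (\<lambda>t. 1 / t) = contour_integral h (\<lambda>t. 1 / t)" using assms by blast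
  show "I = contour_integral g (\<lambda>t. 1 / t)" if "\<exists>h\<in>pcomp P1m tb10 tb01 (Pt z) (pinv delta_10) C. 
      valid_path h \<and> pathfinish h = z \<and> I = contour_integral h (\<lambda>t. 1 / t)" for I
    using that log_path_unique[OF assms(1) _ _ assms(2,3)] by auto
qed

section \<open>The principal branch of the dilogarithm\<close>

lemma slit_plane_iff: "z \<in> slit_plane \<longleftrightarrow> (Im z = 0 \<longrightarrow> Re z < 1)"
  by (auto simp: slit_plane_def complex_nonpos_Reals_iff)

lemma open_slit_plane: "open slit_plane"
proof -
  have "open ((\<lambda>z::complex. 1 - z) -` (- \<real>\<^sub>\<le>\<^sub>0))"
    by (intro open_vimage open_Compl closed_nonpos_Reals_complex continuous_intros)
  moreover have "(\<lambda>z::complex. 1 - z) -` (- \<real>\<^sub>\<le>\<^sub>0) = slit_plane" by (auto simp: slit_plane_def)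
  ultimately show ?thesis by simp
qed

lemma starlike_slit_plane: "starlike slit_plane"
  unfolding starlike_def
proof (intro bexI ballI subsetI)
  show "0 \<in> slit_plane" by (simp add: slit_plane_iff)
  fix z w assume z: "z \<in> slit_plane" and "w \<in> closed_segment 0 z"
  then obtain u where u: "0 \<le> u" "u \<le> 1" "w = u *\<^sub>R z" by (auto simp: closed_segment_def)
  show "w \<in> slit_plane"
  proof (cases "Im z = 0")
    case True
    then have "Re z < 1" using z by (simp add: slit_plane_iff)
    then have "u * Re z < 1"
    proof (cases "0 \<le> Re z")
      case True
      then have "u * Re z \<le> Re z" using u by (simp add: mult_left_le_one_le)
      then show ?thesis using \<open>Re z < 1\<close> by linarith
    next
      case False
      then have "u * Re z \<le> 0" using u by (simp add: mult_nonneg_nonpos)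
      then show ?thesis by linarith
    qed
    then show ?thesis using u by (simp add: slit_plane_iff)
  next
    case False
    then show ?thesis using u by (auto simp: slit_plane_iff)
  qed
qed

text \<open>
  The value at \<open>0\<close> makes the function holomorphic there.
\<close>

definition dilog_deriv :: "complex \<Rightarrow> complex" where
  "dilog_deriv z = (if z = 0 then 1 else - Ln (1 - z) / z)"

lemma ex_dilog: "\<exists>f. f 0 = 0 \<and> (\<forall>z\<in>slit_plane. (f has_field_derivative dilog_deriv z) (at z))"
proof -
  have z0: "0 \<in> slit_plane" by (simp add: slit_plane_iff)
  have op: "open (slit_plane - {0})" using open_slit_plane by (rule open_delete)
  have "(\<lambda>z. - Ln (1 - z) / z) holomorphic_on slit_plane - {0}"
    by (intro holomorphic_intros) (auto simp: slit_plane_def)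
  then have "dilog_deriv holomorphic_on slit_plane - {0}"
    by (rule holomorphic_transform) (auto simp: dilog_deriv_def)
  then have d: "dilog_deriv field_differentiable at z" if "z \<in> slit_plane - {0}" for z
    using op that by (rule holomorphic_on_imp_differentiable_at)
  have "((\<lambda>z. - Ln (1 - z)) has_field_derivative 1) (at 0)"
    by (auto intro!: derivative_eq_intros)
  then have "((\<lambda>z. - Ln (1 - z) / z) \<longlongrightarrow> 1) (at 0)"
    unfolding DERIV_def by simp
  moreover have "(dilog_deriv \<longlongrightarrow> 1) (at 0) \<longleftrightarrow> ((\<lambda>z. - Ln (1 - z) / z) \<longlongrightarrow> 1) (at 0)"
    by (rule LIM_equal) (simp add: dilog_deriv_def)
  ultimately have "(dilog_deriv \<longlongrightarrow> 1) (at 0)" by simp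
  then have "isCont dilog_deriv 0" by (simp add: isCont_def dilog_deriv_def)
  then have "isCont dilog_deriv z" if "z \<in> slit_plane" for z
    using d[of z] that field_differentiable_imp_continuous_at by (cases "z = 0") auto
  then have "continuous_on slit_plane dilog_deriv"
    by (simp add: continuous_at_imp_continuous_on)
  then obtain f where f: "\<forall>z\<in>slit_plane. (f has_field_derivative dilog_deriv z) (at z)"
    using holomorphic_starlike_primitive[OF _ starlike_slit_plane open_slit_plane, of dilog_deriv "{0}"] d by auto
  have "((\<lambda>z. f z - f 0) has_field_derivative dilog_deriv z) (at z)" if "z \<in> slit_plane" for z
    using f that by (auto intro!: derivative_eq_intros)
  then show ?thesis by (intro exI[of _ "\<lambda>z. f z - f 0"]) auto
qed

definition dilog :: "complex \<Rightarrow> complex" where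
  "dilog = (SOME f. f 0 = 0 \<and> (\<forall>z\<in>slit_plane. (f has_field_derivative dilog_deriv z) (at z)))"

lemma dilog_0: "dilog 0 = 0"
  and dilog_has_deriv: "z \<in> slit_plane \<Longrightarrow> (dilog has_field_derivative dilog_deriv z) (at z)"
  using someI_ex[OF ex_dilog] unfolding dilog_def by auto

definition dilog_coeff :: "nat \<Rightarrow> complex" where
  "dilog_coeff n = (if n = 0 then 0 else 1 / of_nat n ^ 2)"

lemma dilog_coeff_sums: "dilog_coeff sums (of_real pi ^ 2 / 6)"
proof -
  have "(\<lambda>n. of_real (1 / (real n + 1)\<^sup>2) :: complex) sums of_real (pi\<^sup>2 / 6)"
    using inverse_squares_sums by (intro sums_of_real) (simp add: add.commute)
  moreover have "complex_of_real (1 / (real n + 1)\<^sup>2) = dilog_coeff (Suc n)" for n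
    by (simp add: dilog_coeff_def add.commute)
  ultimately have "(\<lambda>n. dilog_coeff (Suc n)) sums (of_real pi ^ 2 / 6)"
    by (simp only: of_real_divide of_real_power of_real_numeral)
  moreover have "dilog_coeff 0 = 0" by (simp add: dilog_coeff_def)
  ultimately show ?thesis using sums_Suc[of dilog_coeff] by (simp only: add_0_right)
qed

lemma norm_dilog_coeff_summable: "summable (\<lambda>n. norm (dilog_coeff n))"
proof -
  have "summable (\<lambda>n. 1 / real n ^ 2)"
    using inverse_power_summable[of 2, where 'a = real] by (simp add: inverse_eq_divide)
  then show ?thesis
    by (rule summable_comparison_test'[where N = 0]) (simp add: dilog_coeff_def norm_divide norm_power)
qed

definition dilog_series :: "complex \<Rightarrow> complex" where
  "dilog_series z = (\<Sum>n. dilog_coeff n * z ^ n)"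

lemma dilog_term_bound: "norm z \<le> 1 \<Longrightarrow> norm (dilog_coeff n * z ^ n) \<le> norm (dilog_coeff n)"
  by (simp add: norm_mult norm_power mult_left_le power_le_one)

lemma dilog_series_sums: "norm z \<le> 1 \<Longrightarrow> (\<lambda>n. dilog_coeff n * z ^ n) sums dilog_series z"
  unfolding dilog_series_def
  by (rule summable_sums, rule summable_comparison_test'[OF norm_dilog_coeff_summable, of 0])
    (rule dilog_term_bound)

text \<open>
  The series converges uniformly on the closed disc; this is what gives the values at \<open>1\<close> and \<open>- 1\<close>.
\<close>

lemma continuous_on_dilog_series: "continuous_on (cball 0 1) dilog_series"
proof -
  have "uniform_limit (cball 0 1) (\<lambda>n z. \<Sum>i<n. dilog_coeff i * z ^ i) (\<lambda>z. \<Sum>i. dilog_coeff i * z ^ i) sequentially"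
    by (rule Weierstrass_m_test[OF dilog_term_bound norm_dilog_coeff_summable]) simp
  then have "uniform_limit (cball 0 1) (\<lambda>n z. \<Sum>i<n. dilog_coeff i * z ^ i) dilog_series sequentially"
    unfolding dilog_series_def .
  then show ?thesis
    by (rule uniform_limit_theorem[rotated]) (auto intro!: always_eventually continuous_intros)
qed

lemma dilog_eq_series:
  assumes "norm z < 1"
  shows "dilog z = dilog_series z"
proof -
  have slit: "w \<in> slit_plane" if "norm w < 1" for w
    using that complex_Re_le_cmod[of w] by (auto simp: slit_plane_iff)
  have sd: "(dilog_series has_field_derivative dilog_deriv w) (at w)" if w: "norm w < 1" for w
  proof -
    have "summable (\<lambda>n. dilog_coeff n * 1 ^ n)" using dilog_coeff_sums by (simp add: sums_iff)
    then have "(dilog_series has_field_derivative (\<Sum>n. diffs dilog_coeff n * w ^ n)) (at w)"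
      unfolding dilog_series_def by (rule termdiffs_strong) (use w in simp)
    moreover have "(\<Sum>n. diffs dilog_coeff n * w ^ n) = dilog_deriv w"
    proof (cases "w = 0")
      case True
      have "(\<Sum>n. diffs dilog_coeff n * 0 ^ n) = diffs dilog_coeff 0" by (rule powser_zero)
      then show ?thesis using True by (simp add: dilog_deriv_def diffs_def dilog_coeff_def)
    next
      case False
      have "(\<lambda>n. - ((- (- w)) ^ n) / of_nat n) sums Ln (1 + (- w))"
        using w by (intro Ln_series') simp
      then have "(\<lambda>n. - (w ^ n / of_nat n)) sums Ln (1 - w)" by simp
      then have "(\<lambda>n. w ^ n / of_nat n) sums (- Ln (1 - w))"
        using sums_minus[of "\<lambda>n. - (w ^ n / of_nat n)" "Ln (1 - w)"] by (simp only: minus_minus)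
      then have "(\<lambda>n. w ^ Suc n / of_nat (Suc n)) sums (- Ln (1 - w))"
        by (subst sums_Suc_iff) simp
      then have "(\<lambda>n. w ^ Suc n / of_nat (Suc n) / w) sums (- Ln (1 - w) / w)"
        by (rule sums_divide)
      moreover have "w ^ Suc n / of_nat (Suc n) / w = diffs dilog_coeff n * w ^ n" for n
      proof -
        have "of_nat (Suc n) \<noteq> (0 :: complex)" by (rule of_nat_neq_0)
        then have "b * w / a / w = a * (1 / a ^ 2) * b" if "a = of_nat (Suc n)" for a b
          using False that by (simp add: power2_eq_square)
        from this[OF refl, of "w ^ n"] show ?thesis
          by (simp add: diffs_def dilog_coeff_def mult.commute del: of_nat_Suc)
      qed
      ultimately show ?thesis using False by (simp add: sums_iff dilog_deriv_def)
    qed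
    ultimately show ?thesis by simp
  qed
  have "((\<lambda>w. dilog_series w - dilog w) has_field_derivative dilog_deriv w - dilog_deriv w) (at w)" if "norm w < 1" for w
    by (intro DERIV_diff dilog_has_deriv slit sd that)
  then have "((\<lambda>w. dilog_series w - dilog w) has_field_derivative 0) (at w within ball 0 1)" if "w \<in> ball 0 1" for w
    using that by (simp add: has_field_derivative_at_within)
  then have "\<exists>c. \<forall>w\<in>ball 0 1. dilog_series w - dilog w = c"
    by (rule has_field_derivative_zero_constant[OF convex_ball])
  then obtain c where c: "\<And>w. norm w < 1 \<Longrightarrow> dilog_series w - dilog w = c" by auto
  have "dilog_series 0 = dilog_coeff 0" unfolding dilog_series_def by (rule powser_zero)
  then have "c = 0" using c[of 0] dilog_0 by (simp add: dilog_coeff_def)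
  then show ?thesis using c[OF assms] by simp
qed

lemma tendsto_dilog_1:
  assumes "(f \<longlongrightarrow> 1) F" "\<forall>\<^sub>F x in F. norm (f x) < 1"
  shows "((\<lambda>x. dilog (f x)) \<longlongrightarrow> of_real pi ^ 2 / 6) F"
proof -
  have "((\<lambda>x. dilog_series (f x)) \<longlongrightarrow> dilog_series 1) F"
    by (rule continuous_on_tendsto_compose[OF continuous_on_dilog_series assms(1)])
      (use assms(2) in \<open>auto elim: eventually_mono\<close>)
  moreover have "dilog_series 1 = of_real pi ^ 2 / 6"
    using dilog_coeff_sums by (simp add: dilog_series_def sums_iff)
  ultimately have "((\<lambda>x. dilog_series (f x)) \<longlongrightarrow> of_real pi ^ 2 / 6) F" by simp
  then show ?thesis
    by (rule Lim_transform_eventually) (use assms(2) in \<open>auto elim: eventually_mono simp: dilog_eq_series\<close>)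
qed

lemma tendsto_dilog_0:
  assumes "(f \<longlongrightarrow> 0) F"
  shows "((\<lambda>x. dilog (f x)) \<longlongrightarrow> 0) F"
proof -
  have "isCont dilog 0" using dilog_has_deriv[of 0] by (auto simp: slit_plane_iff intro: DERIV_isCont)
  then show ?thesis using isCont_tendsto_compose[OF _ assms] dilog_0 by fastforce
qed

text \<open>
  In the sum of the series at \<open>1\<close> and at \<open>- 1\<close> only the even terms survive, and they add up to half of the
  series at \<open>1\<close>.
\<close>

lemma dilog_series_minus_1: "dilog_series (- 1) = - (of_real pi ^ 2 / 12)"
proof -
  let ?f = "\<lambda>n. dilog_coeff n * 1 ^ n + dilog_coeff n * (- 1) ^ n"
  have 1: "dilog_series 1 = of_real pi ^ 2 / 6"
    using dilog_coeff_sums by (simp add: dilog_series_def sums_iff)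
  have s: "?f sums (dilog_series 1 + dilog_series (- 1))"
    by (intro sums_add dilog_series_sums) auto
  have "(\<lambda>n. ?f (2 * n)) sums (dilog_series 1 + dilog_series (- 1))"
  proof (subst sums_mono_reindex[of "\<lambda>n. 2 * n" ?f])
    show "?f n = 0" if "n \<notin> range (\<lambda>n. 2 * n)" for n
    proof -
      have "odd n" using that by (metis evenE rangeI)
      then show ?thesis by simp
    qed
  qed (use s in \<open>simp_all add: strict_mono_def\<close>)
  moreover have "?f (2 * n) = dilog_coeff n * (1 / 2)" for n
    by (simp add: dilog_coeff_def power_mult_distrib)
  ultimately have "(\<lambda>n. dilog_coeff n * (1 / 2)) sums (dilog_series 1 + dilog_series (- 1))"
    by (simp only:)
  moreover have "(\<lambda>n. dilog_coeff n * (1 / 2)) sums (of_real pi ^ 2 / 6 * (1 / 2))"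
    by (intro sums_mult2 dilog_coeff_sums)
  ultimately have "dilog_series 1 + dilog_series (- 1) = of_real pi ^ 2 / 6 * (1 / 2)"
    by (rule sums_unique2)
  then have "dilog_series (- 1) = of_real pi ^ 2 / 6 * (1 / 2) - of_real pi ^ 2 / 6"
    unfolding 1 by (metis add_diff_cancel_left')
  moreover have "p / 6 * (1 / 2) - p / 6 = - (p / 12)" for p :: complex by simp
  ultimately show ?thesis by simp
qed

lemma dilog_minus_1: "dilog (- 1) = - (of_real pi ^ 2 / 12)"
proof -
  have lim: "((\<lambda>x. - complex_of_real x) \<longlongrightarrow> - of_real 1) (at_left 1)" by (intro tendsto_intros)
  have ev: "\<forall>\<^sub>F x in at_left 1. norm (- complex_of_real x) < 1"
    unfolding eventually_at_left_field by (intro exI[of _ 0]) auto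
  have "isCont dilog (- of_real 1)"
    using dilog_has_deriv[of "- 1"] by (auto simp: slit_plane_iff intro: DERIV_isCont)
  then have "((\<lambda>x. dilog (- complex_of_real x)) \<longlongrightarrow> dilog (- of_real 1)) (at_left 1)"
    by (rule isCont_tendsto_compose[OF _ lim])
  moreover have "((\<lambda>x. dilog_series (- complex_of_real x)) \<longlongrightarrow> dilog_series (- of_real 1)) (at_left 1)"
    by (rule continuous_on_tendsto_compose[OF continuous_on_dilog_series lim])
      (use ev in \<open>auto elim: eventually_mono\<close>)
  then have "((\<lambda>x. dilog (- complex_of_real x)) \<longlongrightarrow> dilog_series (- of_real 1)) (at_left 1)"
    by (rule Lim_transform_eventually)
       (use ev in \<open>auto elim!: eventually_mono simp: dilog_eq_series\<close>)
  ultimately have "dilog (- of_real 1) = dilog_series (- of_real 1)"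
    by (rule tendsto_unique[OF trivial_limit_at_left_real])
  then show ?thesis by (simp add: dilog_series_minus_1)
qed

text \<open>
  The derivative of the left-hand side vanishes, because \<open>ln (1 + 1 / u) - ln (1 + u) + ln u = 0\<close>; the constant
  is \<open>2 dilog (- 1)\<close>.
\<close>

lemma dilog_inversion:
  assumes "0 < u"
  shows "dilog (of_real (- 1 / u)) + dilog (of_real (- u)) + of_real ((ln u)\<^sup>2 / 2) = - (of_real pi ^ 2 / 6)"
proof -
  define F where "F = (\<lambda>u. dilog (of_real (- 1 / u)) + dilog (of_real (- u)) + of_real ((ln u)\<^sup>2 / 2))"
  have slit: "of_real x \<in> slit_plane" if "x < 0" for x using that by (simp add: slit_plane_iff)
  have "(F has_vector_derivative 0) (at u within {0<..})" if u: "u \<in> {0<..}" for u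
  proof -
    have u0: "0 < u" using u by simp
    have dd: "dilog_deriv (of_real (- x)) = of_real (ln (1 + x) / x)" if "0 < x" for x
      using that Ln_of_real[of "1 + x"] by (simp add: dilog_deriv_def)
    have "((\<lambda>u. complex_of_real (- 1 / u)) has_vector_derivative of_real (1 / u\<^sup>2)) (at u)"
      using u0 by (intro has_vector_derivative_of_real) (auto intro!: derivative_eq_intros simp: power2_eq_square)
    from field_vector_diff_chain_at[OF this dilog_has_deriv[OF slit]] u0
    have 1: "((\<lambda>u. dilog (complex_of_real (- 1 / u))) has_vector_derivative of_real (1 / u\<^sup>2) * of_real (ln (1 + 1 / u) / (1 / u))) (at u)"
      using dd[of "1 / u"] by (simp add: o_def)
    have "((\<lambda>u. complex_of_real (- u)) has_vector_derivative of_real (- 1)) (at u)"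
      by (intro has_vector_derivative_of_real) (auto intro!: derivative_eq_intros)
    from field_vector_diff_chain_at[OF this dilog_has_deriv[OF slit]] u0
    have 2: "((\<lambda>u. dilog (complex_of_real (- u))) has_vector_derivative of_real (- 1) * of_real (ln (1 + u) / u)) (at u)"
      using dd[of u] by (simp add: o_def)
    have 3: "((\<lambda>u. complex_of_real ((ln u)\<^sup>2 / 2)) has_vector_derivative of_real (ln u / u)) (at u)"
      using u0 by (intro has_vector_derivative_of_real) (auto intro!: derivative_eq_intros)
    have "1 + 1 / u = (1 + u) / u" using u0 by (simp add: field_simps)
    then have "ln (1 + 1 / u) = ln (1 + u) - ln u" using u0 by (simp add: ln_div)
    then have "1 / u\<^sup>2 * (ln (1 + 1 / u) / (1 / u)) + (- 1) * (ln (1 + u) / u) + ln u / u = 0"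
      using u0 by (simp add: power2_eq_square field_simps)
    then have "of_real (1 / u\<^sup>2) * of_real (ln (1 + 1 / u) / (1 / u)) + of_real (- 1) * of_real (ln (1 + u) / u) + of_real (ln u / u) = (0 :: complex)"
      unfolding of_real_mult[symmetric] of_real_add[symmetric] of_real_eq_0_iff .
    then have "(F has_vector_derivative 0) (at u)"
      using has_vector_derivative_add[OF has_vector_derivative_add[OF 1 2] 3] unfolding F_def by simp
    then show ?thesis by (rule has_vector_derivative_at_within)
  qed
  then obtain c where c: "\<And>u. u \<in> {0<..} \<Longrightarrow> F u = c"
    using has_vector_derivative_zero_constant[of "{0<..}" F] by auto
  have "F u = F 1" using c[of u] c[of 1] assms by simp
  also have "F 1 = - (of_real pi ^ 2 / 6)" by (simp add: F_def dilog_minus_1)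
  finally show ?thesis by (simp add: F_def)
qed

section \<open>Smooth representatives of tangential classes\<close>

lemma continuous_on_join_half:
  fixes f g :: "real \<times> real \<Rightarrow> 'a::topological_space"
  assumes "continuous_on {y\<in>S. snd y \<le> 1 / 2} f" "continuous_on {y\<in>S. 1 / 2 \<le> snd y} g"
    "\<And>y. y \<in> S \<Longrightarrow> snd y = 1 / 2 \<Longrightarrow> f y = g y"
  shows "continuous_on S (\<lambda>y. if snd y \<le> 1 / 2 then f y else g y)"
  by (rule continuous_on_cases_le[where h = snd and a = "1/2"]) (use assms in \<open>auto intro: continuous_intros\<close>)

text \<open>
  Some initial part of the path ends at the point \<open>b v\<close> of the curve. The initial part can be deformed along the
  curve to the uniform parametrisation. The rest is an ordinary path in an open set, so it is homotopic
  to a polynomial path with the same end points.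
\<close>

lemma tangential_polynomial_representative:
  fixes p :: "real \<Rightarrow> 'a::euclidean_space"
  assumes p: "p \<in> tpaths W (Tangential b) (Pt z)" and W: "open W"
    and b: "continuous_on {0<..<1} b" "b ` {0<..<1} \<subseteq> W"
  shows "\<forall>\<^sub>F v in at_right 0. \<exists>P. polynomial_function P \<and> P 0 = b v \<and> P 1 = z \<and> P ` {0..1} \<subseteq> W \<and>
           thomotopic W (Tangential b) (Pt z) p (\<lambda>t. if t \<le> 1 / 2 then b (2 * v * t) else P (2 * t - 1))"
proof -
  let ?a = "Tangential b" and ?c = "Pt z"
  have dom: "path_dom ?a ?c = {0<..1}" by (auto simp: path_dom_def)
  have pc: "continuous_on {0<..1} p" and pW: "\<And>t. t \<in> {0<..1} \<Longrightarrow> p t \<in> W" and p1: "p 1 = z"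
    using p tpaths_Tangential_PtD(1,2)[OF p] by (simp_all add: tpaths_def dom)
  obtain e0 where e0: "0 < e0" "e0 < 1" and st: "starts_at e0 ?a p"
    using tpaths_Tangential_PtD(3)[OF p] unfolding Bex_def greaterThanLessThan_iff by blast
  obtain u where uc: "continuous_on {0<..e0} u" and u0: "(u \<longlongrightarrow> 0) (at_right 0)"
    and u: "\<forall>t\<in>{0<..e0}. 0 < u t \<and> u t < 1 \<and> p t = b (u t)"
    using st unfolding starts_at.simps by (elim exE conjE)
  have main: "\<exists>P. polynomial_function P \<and> P 0 = b v \<and> P 1 = z \<and> P ` {0..1} \<subseteq> W \<and>
           thomotopic W ?a ?c p (\<lambda>t. if t \<le> 1 / 2 then b (2 * v * t) else P (2 * t - 1))"
    if v: "0 < v" "v < u e0" for v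
  proof -
    have "\<forall>\<^sub>F t in at_right 0. u t < v" using u0 v(1) by (rule order_tendstoD)
    moreover have "\<forall>\<^sub>F t in at_right 0. 0 < t \<and> t < e0"
      unfolding eventually_at_right_field using e0(1) by blast
    ultimately have "\<forall>\<^sub>F t in at_right 0. u t < v \<and> 0 < t \<and> t < e0" by eventually_elim simp
    then obtain t1 where t1: "u t1 < v" "0 < t1" "t1 < e0"
      using eventually_happens'[OF trivial_limit_at_right_real] by blast
    have "\<exists>x\<ge>t1. x \<le> e0 \<and> u x = v"
      by (rule IVT') (use t1 v in \<open>auto intro: continuous_on_subset[OF uc]\<close>)
    then obtain e where "t1 \<le> e" and e2: "e \<le> e0" "u e = v" by blast
    then have e: "0 < e" "e \<le> e0" "u e = v" using t1(2) by simp_all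
    have e1: "e < 1" using e e0 by simp
    have v1: "v < 1" using u e by auto
    have pe: "p e = b v" using u e by auto
    define R where "R = subpath e 1 p"
    have mem: "e + (1 - e) * x \<in> {0<..1}" if "x \<in> {0..1}" for x
    proof -
      have "(1 - e) * x \<le> 1 - e" "0 \<le> (1 - e) * x" using that e1 by (auto intro!: mult_left_le)
      then show ?thesis using e unfolding greaterThanAtMost_iff by linarith
    qed
    have Rx: "R x = p (e + (1 - e) * x)" for x by (simp add: R_def subpath_def add.commute)
    have Rp: "path R" unfolding path_def Rx
      by (rule continuous_on_compose2[OF pc]) (use mem in \<open>auto intro!: continuous_intros\<close>)
    have RW: "path_image R \<subseteq> W" using mem pW unfolding path_image_def Rx by (intro image_subsetI) blast
    obtain d where d: "0 < d" and dh: "\<And>h. path h \<Longrightarrow> pathstart h = pathstart R \<Longrightarrow> pathfinish h = pathfinish R \<Longrightarrow>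
       (\<forall>t\<in>{0..1}. norm (h t - R t) < d) \<Longrightarrow> homotopic_paths W R h"
      using homotopic_nearby_paths[OF Rp W RW] by blast
    obtain P where P: "polynomial_function P" "pathstart P = pathstart R" "pathfinish P = pathfinish R"
      "\<And>t. t \<in> {0..1} \<Longrightarrow> norm (P t - R t) < d"
      using path_approx_polynomial_function[OF Rp d] by blast
    have hom: "homotopic_paths W R P"
      using dh[OF path_polynomial_function[OF P(1)] P(2,3)] P(4) by blast
    have P01: "P 0 = b v" "P 1 = z"
      using P(2,3) pe p1 by (simp_all add: R_def pathstart_def pathfinish_def subpath_def)
    have PW: "P ` {0..1} \<subseteq> W" using homotopic_paths_imp_subset[OF hom] by (simp add: path_image_def)
    obtain K where K: "continuous_on ({0..1} \<times> {0..1}) K" "K \<in> {0..1} \<times> {0..1} \<rightarrow> W"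
      "\<forall>x\<in>{0..1}. K (0, x) = R x" "\<forall>x\<in>{0..1}. K (1, x) = P x"
      "\<forall>t\<in>{0..1::real}. pathstart (K \<circ> Pair t) = pathstart R \<and> pathfinish (K \<circ> Pair t) = pathfinish R"
      using hom unfolding homotopic_paths by blast
    have K0: "K (s, 0) = b v" "K (s, 1) = z" if "s \<in> {0..1}" for s
      using K(5) that pe p1 by (auto simp: R_def pathstart_def pathfinish_def subpath_def)

    define \<phi> where "\<phi> = (\<lambda>t. if t \<le> 1 / 2 then 2 * e * t else e + (1 - e) * (2 * t - 1))"
    have \<phi>c: "continuous_on {0<..1} \<phi>"
      unfolding \<phi>_def
    proof (rule continuous_on_cases_le[where h = "\<lambda>t. t"])
      show "2 * e * t = e + (1 - e) * (2 * t - 1)" if "t = 1 / 2" for t by (simp add: that)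
    qed (intro continuous_intros)+
    have \<phi>m: "\<phi> t \<in> {0<..1}" if "t \<in> {0<..1}" for t
    proof (cases "t \<le> 1/2")
      case True
      have "0 < e * t" "e * (2 * t) \<le> e" using True that e by (auto intro!: mult_left_le)
      then have "2 * e * t \<in> {0<..1}" using e1 unfolding greaterThanAtMost_iff by linarith
      then show ?thesis using True by (simp add: \<phi>_def)
    next
      case False
      then show ?thesis using mem[of "2 * t - 1"] that by (simp add: \<phi>_def)
    qed
    have conv: "(1 - s) * x + s * y \<in> S" if "s \<in> {0..1}" "x \<in> S" "y \<in> S" "convex S" for s x y :: real and S
      using convexD[OF that(4,2,3), of "1 - s" s] that(1) by simp
    have ivl: "convex {0<..1::real}" "convex {0<..e}" "convex {0<..<1::real}" by auto
    \<comment> \<open>First change the parametrisation so that \<open>b v\<close> is reached at time \<open>1 / 2\<close>.\<close>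
    have h1: "thomotopic W ?a ?c p (\<lambda>t. p (\<phi> t))"
      unfolding thomotopic_iff dom
    proof (intro exI[of _ "e / 2"] exI[of _ "\<lambda>s t. p ((1 - s) * t + s * \<phi> t)"] conjI ballI)
      show "0 < e / 2" "e / 2 < 1" using e e1 by auto
      have "continuous_on ({0..1} \<times> {0<..1}) (\<lambda>y::real\<times>real. \<phi> (snd y))"
        by (rule continuous_on_compose2[OF \<phi>c]) (auto intro!: continuous_intros)
      then have c: "continuous_on ({0..1} \<times> {0<..1}) (\<lambda>y::real\<times>real. (1 - fst y) * snd y + fst y * \<phi> (snd y))"
        by (intro continuous_intros)
      have m: "(1 - s) * t + s * \<phi> t \<in> {0<..1}" if "s \<in> {0..1}" "t \<in> {0<..1}" for s t
        by (rule conv[OF that \<phi>m[OF that(2)] ivl(1)])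
      show "continuous_on ({0..1} \<times> {0<..1}) (\<lambda>y. p ((1 - fst y) * snd y + fst y * \<phi> (snd y)))"
        by (rule continuous_on_compose2[OF pc c]) (use m in force)
      show "p ((1 - s) * t + s * \<phi> t) \<in> W" if "s \<in> {0..1}" "t \<in> {0<..1}" for s t
        using pW[OF m[OF that]] .
      show "joins (e / 2) ?a ?c (\<lambda>t. p ((1 - s) * t + s * \<phi> t))" if s: "s \<in> {0..1}" for s
        unfolding joins_def
      proof
        show "starts_at (e / 2) ?a (\<lambda>t. p ((1 - s) * t + s * \<phi> t))"
        proof (rule starts_at_compose[OF st, where \<phi> = "\<lambda>t. (1 - s) * t + s * (2 * e * t)"])
          show "(\<lambda>t. (1 - s) * t + s * (2 * e * t)) ` {0<..e / 2} \<subseteq> {0<..e0}"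
          proof (rule image_subsetI)
            fix t assume t: "t \<in> {0<..e / 2}"
            have "e * (2 * t) \<le> e" using t e e1 by (intro mult_left_le) auto
            moreover have "0 < e * t" using t e by auto
            ultimately have "t \<in> {0<..e}" "2 * e * t \<in> {0<..e}"
              using t e unfolding greaterThanAtMost_iff by linarith+
            from conv[OF s this ivl(2)] show "(1 - s) * t + s * (2 * e * t) \<in> {0<..e0}"
              using e(2) unfolding greaterThanAtMost_iff by linarith
          qed
          have "((\<lambda>t. (1 - s) * t + s * (2 * e * t)) \<longlongrightarrow> (1 - s) * 0 + s * (2 * e * 0)) (at_right 0)"
            by (intro tendsto_intros)
          then show "((\<lambda>t. (1 - s) * t + s * (2 * e * t)) \<longlongrightarrow> 0) (at_right 0)" by simp
        qed (use e e1 in \<open>auto simp: \<phi>_def intro!: continuous_intros\<close>)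
        show "starts_at (e / 2) ?c (reversepath (\<lambda>t. p ((1 - s) * t + s * \<phi> t)))"
          by (simp add: reversepath_def \<phi>_def p1)
      qed
    qed simp_all
    \<comment> \<open>Then deform the parameter \<open>u\<close> of the curve linearly on the first half, and use \<open>K\<close> on the second half.\<close>
    have h2: "thomotopic W ?a ?c (\<lambda>t. p (\<phi> t)) (\<lambda>t. if t \<le> 1 / 2 then b (2 * v * t) else P (2 * t - 1))"
      unfolding thomotopic_iff dom
    proof (intro exI[of _ "1 / 4"] exI[of _ "\<lambda>s t. if t \<le> 1 / 2 then b ((1 - s) * u (2 * e * t) + s * (2 * v * t)) else K (s, 2 * t - 1)"] conjI ballI)
      have m0: "2 * e * t \<in> {0<..e0}" if "0 < t" "t \<le> 1/2" for t
      proof -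
        have "0 < e * t" "e * (2 * t) \<le> e" using that e by (auto intro!: mult_left_le)
        then show ?thesis using e(2) unfolding greaterThanAtMost_iff by linarith
      qed
      have m: "(1 - s) * u (2 * e * t) + s * (2 * v * t) \<in> {0<..<1}" if "s \<in> {0..1}" "0 < t" "t \<le> 1/2" for s t
      proof (rule conv[OF that(1) _ _ ivl(3)])
        show "u (2 * e * t) \<in> {0<..<1}" using u m0[OF that(2,3)] by auto
        have "0 < v * t" "v * (2 * t) \<le> v" using that v by (auto intro!: mult_left_le)
        then show "2 * v * t \<in> {0<..<1}" using v1 unfolding greaterThanLessThan_iff by linarith
      qed
      have uc2: "continuous_on {t. 0 < t \<and> t \<le> 1/2} (\<lambda>t. u (2 * e * t))"
        by (rule continuous_on_compose2[OF uc]) (use m0 in \<open>force intro!: continuous_intros\<close>)+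
      have "continuous_on ({0..1} \<times> {0<..1})
         (\<lambda>y. if snd y \<le> 1 / 2 then b ((1 - fst y) * u (2 * e * snd y) + fst y * (2 * v * snd y)) else K (fst y, 2 * snd y - 1))"
      proof (rule continuous_on_join_half)
        have "continuous_on {y \<in> {0..1} \<times> {0<..1}. snd y \<le> 1 / 2} (\<lambda>y::real\<times>real. u (2 * e * snd y))"
          by (rule continuous_on_compose2[OF uc2]) (auto intro!: continuous_intros)
        then have "continuous_on {y \<in> {0..1} \<times> {0<..1}. snd y \<le> 1 / 2}
            (\<lambda>y. (1 - fst y) * u (2 * e * snd y) + fst y * (2 * v * snd y))"
          by (intro continuous_intros)
        then show "continuous_on {y \<in> {0..1} \<times> {0<..1}. snd y \<le> 1 / 2}
            (\<lambda>y. b ((1 - fst y) * u (2 * e * snd y) + fst y * (2 * v * snd y)))"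
          by (rule continuous_on_compose2[OF b(1)]) (use m in force)
        show "continuous_on {y \<in> {0..1} \<times> {0<..1}. 1 / 2 \<le> snd y} (\<lambda>y. K (fst y, 2 * snd y - 1))"
          by (rule continuous_on_compose2[OF K(1)]) (auto intro!: continuous_intros)
        show "b ((1 - fst y) * u (2 * e * snd y) + fst y * (2 * v * snd y)) = K (fst y, 2 * snd y - 1)"
          if yS: "y \<in> {0..1} \<times> {0<..1}" and yh: "snd y = 1 / 2" for y
        proof -
          obtain s where y: "y = (s, 1 / 2)" using yh by (cases y) simp
          have "s \<in> {0..1}" using yS y by simp
          moreover have "(1 - s) * v + s * v = v" by (simp add: algebra_simps)
          ultimately show ?thesis using K0(1)[of s] e(3) by (simp add: y)
        qed
      qed
      then show "continuous_on ({0..1} \<times> {0<..1}) (\<lambda>y. if snd y \<le> 1 / 2 then b ((1 - fst y) * u (2 * e * snd y) + fst y * (2 * v * snd y)) else K (fst y, 2 * snd y - 1))" .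
      show "(if t \<le> 1 / 2 then b ((1 - s) * u (2 * e * t) + s * (2 * v * t)) else K (s, 2 * t - 1)) \<in> W"
        if "s \<in> {0..1}" "t \<in> {0<..1}" for s t
        using m[of s t] that b(2) K(2) by (auto simp: image_subset_iff Pi_iff)
      show "(if t \<le> 1 / 2 then b ((1 - 0) * u (2 * e * t) + 0 * (2 * v * t)) else K (0, 2 * t - 1)) = p (\<phi> t)"
        if "t \<in> {0<..1}" for t
      proof (cases "t \<le> 1/2")
        case True
        then show ?thesis using u m0[of t] that by (auto simp: \<phi>_def)
      next
        case False
        then show ?thesis using K(3) that Rx[of "2 * t - 1"] by (auto simp: \<phi>_def)
      qed
      show "(if t \<le> 1 / 2 then b ((1 - 1) * u (2 * e * t) + 1 * (2 * v * t)) else K (1, 2 * t - 1)) =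
         (if t \<le> 1 / 2 then b (2 * v * t) else P (2 * t - 1))" if "t \<in> {0<..1}" for t
        using K(4) that by auto
      show "joins (1 / 4) ?a ?c (\<lambda>t. if t \<le> 1 / 2 then b ((1 - s) * u (2 * e * t) + s * (2 * v * t)) else K (s, 2 * t - 1))"
        if s: "s \<in> {0..1}" for s
        unfolding joins_def
      proof
        have "filterlim (\<lambda>t. 2 * e * t) (at_right 0) (at_right 0)"
        proof -
          have "((\<lambda>t. 2 * e * t) \<longlongrightarrow> 2 * e * 0) (at_right 0)" by (intro tendsto_intros)
          moreover have "\<forall>\<^sub>F t in at_right 0. 2 * e * t \<in> {0<..} \<and> 2 * e * t \<noteq> 0"
            unfolding eventually_at_right_field using e(1) by (intro exI[of _ 1]) simp
          ultimately show ?thesis by (simp add: filterlim_at)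
        qed
        then have "((\<lambda>t. u (2 * e * t)) \<longlongrightarrow> 0) (at_right 0)" using u0 filterlim_compose by blast
        then have "((\<lambda>t. (1 - s) * u (2 * e * t) + s * (2 * v * t)) \<longlongrightarrow> (1 - s) * 0 + s * (2 * v * 0)) (at_right 0)"
          by (intro tendsto_intros)
        then have l: "((\<lambda>t. (1 - s) * u (2 * e * t) + s * (2 * v * t)) \<longlongrightarrow> 0) (at_right 0)" by simp
        have c: "continuous_on {0<..1/4} (\<lambda>t. (1 - s) * u (2 * e * t) + s * (2 * v * t))"
          by (intro continuous_intros continuous_on_subset[OF uc2]) auto
        show "starts_at (1 / 4) ?a (\<lambda>t. if t \<le> 1 / 2 then b ((1 - s) * u (2 * e * t) + s * (2 * v * t)) else K (s, 2 * t - 1))"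
          unfolding starts_at.simps
          by (intro exI[of _ "\<lambda>t. (1 - s) * u (2 * e * t) + s * (2 * v * t)"] conjI c l ballI)
             (use m[OF s] in auto)
        show "starts_at (1 / 4) ?c (reversepath (\<lambda>t. if t \<le> 1 / 2 then b ((1 - s) * u (2 * e * t) + s * (2 * v * t)) else K (s, 2 * t - 1)))"
          using K0(2)[OF s] by (simp add: reversepath_def)
      qed
    qed simp_all
    show ?thesis
      using P(1) P01 PW thomotopic_trans[OF h1 h2] by (intro exI[of _ P] conjI)
  qed
  have "0 < u e0" using u e0 by auto
  then show ?thesis
    unfolding eventually_at_right_field using main by blast
qed

section \<open>The nine maps along the tangential curve and the standard paths\<close>

lemma composite_in_pcomp:
  fixes C :: "(real \<Rightarrow> 'a::real_normed_vector) set"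
  assumes "truncates_to X (Tangential \<alpha>) (Tangential \<beta>) C G1" "truncates_to X (Tangential \<beta>) (Pt z) D G2"
    and "convex_region X (Tangential \<alpha>)" "convex_region X (Tangential \<beta>)" "z \<in> X"
    and "p \<in> C" "q \<in> D" "composite (Tangential \<beta>) p q r"
  shows "r \<in> pcomp X (Tangential \<alpha>) (Tangential \<beta>) (Pt z) C D"
proof -
  have "r \<in> tpaths X (Tangential \<alpha>) (Pt z)"
    using composite_truncates_to[OF refl refl refl assms(3-5) _ _ assms(8)] assms(1,2,6,7) unfolding truncates_to_def by blast
  then have "r \<in> pclass X (Tangential \<alpha>) (Pt z) r"
    unfolding pclass_def using thomotopic_refl by blast
  then show ?thesis unfolding pcomp_def using assms(6-8) by blast
qed

lemma convex_of_real_image: "convex J \<Longrightarrow> convex (complex_of_real ` J)"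
  by (rule convex_linear_image[OF linearI]) (simp_all add: scaleR_conv_of_real)

text \<open>
  The curve of the base point with which the image of \<open>tbv\<close> under \<open>Vmap i\<close> is identified.
\<close>

definition vcurve :: "nat \<Rightarrow> real \<Rightarrow> complex" where
  "vcurve i = (if i = 5 then (\<lambda>t. of_real (- t)) else if i = 6 then (\<lambda>t. of_real (1 - t))
     else if i = 7 then (\<lambda>t. of_real (- 1 / t)) else (\<lambda>t. of_real t))"

lemma Vbase_eq: "Vbase i = Tangential (vcurve i)"
  by (simp add: Vbase_def vcurve_def tb01_def tb10_def tb0inf_def tbinf0_def)

lemma vcurve_cases:
  "vcurve 5 t = of_real (- t)" "vcurve 6 t = of_real (1 - t)" "vcurve 7 t = of_real (- 1 / t)"
  "i \<noteq> 5 \<Longrightarrow> i \<noteq> 6 \<Longrightarrow> i \<noteq> 7 \<Longrightarrow> vcurve i t = of_real t"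
  by (simp_all add: vcurve_def)

lemma convex_region_Vbase: "convex_region P1m (Vbase i)"
proof -
  have *: "convex_region P1m (Tangential b)"
    if "b ` {0<..<1} = complex_of_real ` J" "convex J" "0 \<notin> J" "1 \<notin> J" for b J
    using that convex_of_real_image[OF that(2)] by (auto simp: convex_region_def P1m_def)
  consider "i = 5" | "i = 6" | "i = 7" | "i \<noteq> 5 \<and> i \<noteq> 6 \<and> i \<noteq> 7" by blast
  then show ?thesis
  proof cases
    case 1
    have "(\<lambda>t. - t) ` {0<..<1} = {- 1<..<0::real}" by (auto intro!: image_eqI[of _ uminus "- x" for x])
    then have "(\<lambda>t. of_real (- t)) ` {0<..<1} = complex_of_real ` {- 1<..<0}"
      by (metis image_image)
    from *[OF this] show ?thesis using 1 by (simp add: Vbase_def tb0inf_def)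
  next
    case 2
    have "(\<lambda>t. 1 - t) ` {0<..<1} = {0<..<1::real}" by (auto intro!: image_eqI[of _ "\<lambda>t. 1 - t" "1 - x" for x])
    then have "(\<lambda>t. of_real (1 - t)) ` {0<..<1} = complex_of_real ` {0<..<1}"
      by (metis image_image)
    from *[OF this] show ?thesis using 2 by (simp add: Vbase_def tb10_def)
  next
    case 3
    have "(\<lambda>t. - 1 / t) ` {0<..<1} = {..<- 1::real}"
    proof (intro set_eqI iffI)
      fix x :: real assume "x \<in> {..<- 1}"
      then show "x \<in> (\<lambda>t. - 1 / t) ` {0<..<1}"
        by (intro image_eqI[of _ _ "- 1 / x"]) (auto simp: divide_simps)
    qed (auto simp: divide_simps)
    then have "(\<lambda>t. of_real (- 1 / t)) ` {0<..<1} = complex_of_real ` {..<- 1}"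
      by (metis image_image)
    from *[OF this] show ?thesis using 3 by (simp add: Vbase_def tbinf0_def)
  next
    case 4
    then show ?thesis using *[of "\<lambda>t. of_real t" "{0<..<1}"] by (simp add: Vbase_def tb01_def)
  qed
qed

text \<open>
  The reparametrisation through which \<open>Vmap i\<close> carries the curve \<open>(v\<^sup>2, v)\<close> to \<open>vcurve i\<close>.
\<close>

definition vparam :: "nat \<Rightarrow> real \<Rightarrow> real" where
  "vparam i v = (if i = 1 then v / (1 + v)\<^sup>2 else if i = 2 then v ^ 3 else if i = 4 then v / (1 + v)
     else if i = 5 then v\<^sup>2 / (1 + v) else if i = 6 then v / (1 + v) else if i = 7 then v * (1 + v)
     else if i = 8 then v\<^sup>2 else v)"

lemma Vmap_curve:
  assumes "0 < v" "v < 1"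
  shows "Vmap i (of_real (v\<^sup>2), of_real v) = vcurve i (vparam i v)"
proof -
  define c where "c = complex_of_real v"
  have c: "c \<noteq> 0" "1 - c \<noteq> 0" "1 + c \<noteq> 0"
  proof -
    show "c \<noteq> 0" using assms by (simp add: c_def)
    have "complex_of_real (1 - v) \<noteq> 0" "complex_of_real (1 + v) \<noteq> 0"
      using assms unfolding of_real_eq_0_iff by auto
    then show "1 - c \<noteq> 0" "1 + c \<noteq> 0" by (simp_all add: c_def)
  qed
  have sq: "1 - c\<^sup>2 = (1 - c) * (1 + c)" "c\<^sup>2 - 1 = - ((1 - c) * (1 + c))"
    by (simp_all add: algebra_simps power2_eq_square)
  have 1: "c\<^sup>2 * (1 - c)\<^sup>2 / (c * ((1 - c) * (1 + c))\<^sup>2) = c / (1 + c)\<^sup>2"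
    using c by (simp add: power_mult_distrib power2_eq_square)
  have 4: "c\<^sup>2 * (1 - c) / (c * ((1 - c) * (1 + c))) = c / (1 + c)"
    using c by (simp add: power2_eq_square)
  have 5: "c\<^sup>2 * (1 - c) / (- ((1 - c) * (1 + c))) = - (c\<^sup>2 / (1 + c))"
    using c by simp
  have 6: "(1 - c) / ((1 - c) * (1 + c)) = 1 - c / (1 + c)"
  proof -
    have "1 - c / (1 + c) = 1 / (1 + c)" using c(3) by (simp add: field_simps)
    then show ?thesis using c by simp
  qed
  have 7: "(1 - c) / (c * (- ((1 - c) * (1 + c)))) = - 1 / (c * (1 + c))"
    using c by (simp add: power2_eq_square)
  have 3: "c\<^sup>2 / c = c" using c by (simp add: power2_eq_square)
  have 2: "c\<^sup>2 * c = c ^ 3" by (simp add: power2_eq_square power3_eq_cube)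
  have eqs: "complex_of_real (v\<^sup>2) = c\<^sup>2" "complex_of_real v = c"
    "complex_of_real (v / (1 + v)\<^sup>2) = c / (1 + c)\<^sup>2" "complex_of_real (v ^ 3) = c ^ 3"
    "complex_of_real (v / (1 + v)) = c / (1 + c)" "complex_of_real (- (v\<^sup>2 / (1 + v))) = - (c\<^sup>2 / (1 + c))"
    "complex_of_real (1 - v / (1 + v)) = 1 - c / (1 + c)"
    "complex_of_real (- 1 / (v * (1 + v))) = - 1 / (c * (1 + c))"
    by (simp_all add: c_def)
  consider "i = 1" | "i = 2" | "i = 3" | "i = 4" | "i = 5" | "i = 6" | "i = 7" | "i = 8" | "i \<notin> {1..8}"
    by force
  then show ?thesis
  proof cases
    case 9
    then have "i \<noteq> 1 \<and> i \<noteq> 2 \<and> i \<noteq> 3 \<and> i \<noteq> 4 \<and> i \<noteq> 5 \<and> i \<noteq> 6 \<and> i \<noteq> 7 \<and> i \<noteq> 8" by auto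
    then show ?thesis by (simp add: Vmap_def vcurve_cases vparam_def)
  qed (simp_all only: Vmap_def vcurve_cases vparam_def case_prod_conv eqs sq if_True if_False refl simp_thms
        numeral_eq_iff one_eq_numeral_iff numeral_eq_one_iff num.distinct num.inject 1 2 3 4 5 6 7)
qed

lemma vparam_pos: "0 < v \<Longrightarrow> 0 < vparam i v"
  by (auto simp: vparam_def intro!: divide_pos_pos add_pos_pos)

text \<open>
  The bound \<open>1 / 5\<close> is below the maximum of \<open>t (1 - t)\<close> on \<open>[2 / 3, 1]\<close>, namely \<open>2 / 9\<close>. So every standard path passes
  through the point with this parameter while it runs on its final curve.
\<close>

lemma vparam_small:
  assumes "0 < v" "v < 1 / 10"
  shows "vparam i v < 1 / 5"
proof -
  have d: "v / w \<le> v" if "1 \<le> w" for w :: real using assms that by (simp add: divide_le_eq mult_left_le_one_le mult_le_cancel_left1)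
  have "1 \<le> 1 + v" "1 \<le> (1 + v)\<^sup>2" using assms by (auto intro: one_le_power)
  note d1 = d[OF this(1)] and d2 = d[OF this(2)]
  have sq: "v\<^sup>2 \<le> v" using assms by (simp add: power2_eq_square mult_left_le_one_le)
  have cu: "v ^ 3 \<le> v" using assms power_decreasing[of 1 3 v] by simp
  have "v\<^sup>2 / (1 + v) \<le> v\<^sup>2" using assms by (simp add: divide_le_eq mult_le_cancel_left1)
  moreover have "v * (1 + v) = v + v\<^sup>2" by (simp add: power2_eq_square algebra_simps)
  ultimately have "v / (1 + v)\<^sup>2 < 1/5" "v ^ 3 < 1/5" "v / (1 + v) < 1/5" "v\<^sup>2 / (1 + v) < 1/5"
     "v * (1 + v) < 1/5" "v\<^sup>2 < 1/5" "v < 1/5"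
    using d1 d2 sq cu assms by linarith+
  then show ?thesis by (simp add: vparam_def)
qed

lemma vparam_isCont: "0 \<le> v \<Longrightarrow> isCont (vparam i) v"
  unfolding vparam_def
  by (cases "i = 1"; cases "i = 2"; cases "i = 4"; cases "i = 5"; cases "i = 6"; cases "i = 7"; cases "i = 8"; simp;
      intro continuous_intros; simp)

lemma vparam_0: "vparam i 0 = 0" by (simp add: vparam_def)

lemma Vmap_maps: "w \<in> V \<Longrightarrow> Vmap i w \<in> P1m"
proof -
  assume w: "w \<in> V"
  obtain x y where xy: "w = (x, y)" by (cases w)
  have nz: "x \<noteq> 0" "y \<noteq> 0" "1 - x \<noteq> 0" "1 - y \<noteq> 0" "y - x \<noteq> 0" "1 - x * y \<noteq> 0" "x - 1 \<noteq> 0"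
    using w by (auto simp: V_def xy)
  have e1: "y * (1 - x)\<^sup>2 - x * (1 - y)\<^sup>2 = (y - x) * (1 - x * y)"
    by (simp add: power2_eq_square algebra_simps)
  have e4: "y * (1 - x) - x * (1 - y) = y - x" by (simp add: algebra_simps)
  have e5: "(x - 1) - x * (1 - y) = - (1 - x * y)" by (simp add: algebra_simps)
  have e6: "(1 - x) - (1 - y) = y - x" by (simp add: algebra_simps)
  have e7: "y * (x - 1) - (1 - y) = - (1 - x * y)" by (simp add: algebra_simps)
  have div1: "a / b \<noteq> 1" if "b - a \<noteq> 0" "b \<noteq> 0" for a b :: complex using that by auto
  have a1: "x * (1 - y)\<^sup>2 / (y * (1 - x)\<^sup>2) \<noteq> 1" by (rule div1) (use nz in \<open>simp_all add: e1\<close>)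
  have a4: "x * (1 - y) / (y * (1 - x)) \<noteq> 1" by (rule div1) (use nz in \<open>simp_all add: e4\<close>)
  have a5: "x * (1 - y) / (x - 1) \<noteq> 1" by (rule div1) (use nz in \<open>simp_all only: e5 neg_equal_0_iff_equal not_False_eq_True\<close>)
  have a6: "(1 - y) / (1 - x) \<noteq> 1" by (rule div1) (use nz in \<open>simp_all only: e6 not_False_eq_True\<close>)
  have a7: "(1 - y) / (y * (x - 1)) \<noteq> 1" by (rule div1) (use nz in \<open>simp_all only: e7 neg_equal_0_iff_equal mult_eq_0_iff not_False_eq_True simp_thms\<close>)
  have a3: "x / y \<noteq> 1" by (rule div1) (use nz in simp_all)
  have z: "x * (1 - y)\<^sup>2 / (y * (1 - x)\<^sup>2) \<noteq> 0" "x * y \<noteq> 0" "x / y \<noteq> 0" "x * (1 - y) / (y * (1 - x)) \<noteq> 0"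
     "x * (1 - y) / (x - 1) \<noteq> 0" "(1 - y) / (1 - x) \<noteq> 0" "(1 - y) / (y * (x - 1)) \<noteq> 0"
    using nz by simp_all
  have o: "x * y \<noteq> 1" "x \<noteq> 1" "y \<noteq> 1" using nz by auto
  show ?thesis
    unfolding xy Vmap_def case_prod_conv P1m_def using a1 a3 a4 a5 a6 a7 z o nz(1,2)
    by (simp only: Compl_iff insert_iff empty_iff simp_thms split: if_splits)
qed

lemma continuous_on_Vmap: "continuous_on V (Vmap i)"
proof -
  have nz: "fst w \<noteq> 0" "snd w \<noteq> 0" "1 - fst w \<noteq> 0" "fst w - 1 \<noteq> 0" if "w \<in> V" for w
    using that by (auto simp: V_def)
  have "continuous_on V (\<lambda>w. Vmap i (fst w, snd w))"
    unfolding Vmap_def case_prod_conv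
    by (cases "i = 1"; cases "i = 2"; cases "i = 3"; cases "i = 4"; cases "i = 5"; cases "i = 6"; cases "i = 7"; cases "i = 8"; simp;
        intro continuous_intros; use nz in simp)
  then show ?thesis by simp
qed

definition delta_path :: "nat \<Rightarrow> real \<Rightarrow> complex" where
  "delta_path i = (if i = 5 then (\<lambda>t. of_real (t * (1 - t)) * cis (half_turn t)) else if i = 6 then (\<lambda>t. of_real t)
     else if i = 7 then (\<lambda>t. of_real (t / (1 - t)) * cis (half_turn t)) else (\<lambda>t. of_real (t * (1 - t))))"

lemma delta_eq: "delta i = pclass P1m tb01 (Vbase i) (delta_path i)"
  by (simp add: delta_def delta_01_def delta_10_def delta_0inf_def delta_inf0_def Vbase_def delta_path_def)

text \<open>
  The parameter of the standard path on the curve of \<open>tb01\<close>, valid up to time \<open>1 / 3\<close>.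
\<close>

definition delta_start_param :: "nat \<Rightarrow> real \<Rightarrow> real" where
  "delta_start_param i t = (if i = 6 then t else if i = 7 then t / (1 - t) else t * (1 - t))"

text \<open>
  The parameter of the standard path on its final curve, valid from time \<open>2 / 3\<close> on.
\<close>

definition delta_end_param :: "nat \<Rightarrow> real \<Rightarrow> real" where
  "delta_end_param i t = (if i = 6 then 1 - t else if i = 7 then (1 - t) / t else t * (1 - t))"

lemma half_turn_values:
  "t \<le> 1 / 3 \<Longrightarrow> half_turn t = 0"
  "1 / 3 \<le> t \<Longrightarrow> t \<le> 2 / 3 \<Longrightarrow> half_turn t = pi * (3 * t - 1)"
  "2 / 3 \<le> t \<Longrightarrow> half_turn t = pi"
  by (simp_all add: half_turn_def)

lemma delta_path_start: "t \<le> 1 / 3 \<Longrightarrow> delta_path i t = of_real (delta_start_param i t)"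
  by (simp add: delta_path_def delta_start_param_def half_turn_values(1))

lemma delta_path_end: "2 / 3 \<le> t \<Longrightarrow> t < 1 \<Longrightarrow> delta_path i t = vcurve i (delta_end_param i t)"
  by (simp add: delta_path_def delta_end_param_def vcurve_def half_turn_values(3))

lemma mult_one_minus_le_quarter: "t * (1 - t) \<le> 1 / 4" for t :: real
proof -
  have "0 \<le> (t - 1 / 2)\<^sup>2" by simp
  also have "(t - 1 / 2)\<^sup>2 = 1 / 4 - t * (1 - t)" by (simp add: power2_eq_square algebra_simps)
  finally show ?thesis by linarith
qed

lemma delta_start_param_bounds: "0 < t \<Longrightarrow> t \<le> 1 / 3 \<Longrightarrow> 0 < delta_start_param i t \<and> delta_start_param i t < 1"
  using mult_one_minus_le_quarter[of t] by (auto simp: delta_start_param_def divide_less_eq)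

lemma delta_end_param_bounds: "2 / 3 \<le> t \<Longrightarrow> t < 1 \<Longrightarrow> 0 < delta_end_param i t \<and> delta_end_param i t < 1"
  using mult_one_minus_le_quarter[of t] by (auto simp: delta_end_param_def divide_less_eq)

lemma delta_path_nonzero: "0 < t \<Longrightarrow> t < 1 \<Longrightarrow> delta_path i t \<noteq> 0"
  by (simp add: delta_path_def)

text \<open>
  The paths with a half turn stay in the upper half plane, and they reach modulus \<open>1\<close> only when their real part
  is no longer positive. Hence the dilogarithm along the standard paths is the principal one.
\<close>

lemma delta_path_slit:
  assumes "0 \<le> t" "t < 1"
  shows "delta_path i t \<in> slit_plane"
proof -
  have small: "z \<in> slit_plane" if "norm z < 1" for z
    using that complex_Re_le_cmod[of z] by (auto simp: slit_plane_iff)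
  have q: "0 \<le> t * (1 - t)" "t * (1 - t) < 1" using assms mult_one_minus_le_quarter[of t] by auto
  have 1: "complex_of_real (t * (1 - t)) \<in> slit_plane" by (rule of_real_in_slit_plane[OF q(2)])
  have 5: "complex_of_real (t * (1 - t)) * cis (half_turn t) \<in> slit_plane"
    by (rule small) (use q in \<open>simp only: norm_mult norm_cis mult_1_right norm_of_real abs_of_nonneg\<close>)
  have 7: "complex_of_real (t / (1 - t)) * cis (half_turn t) \<in> slit_plane"
  proof (cases "t < 1 / 2")
    case True
    then have "t / (1 - t) < 1" "0 \<le> t / (1 - t)" using assms by (auto simp: divide_less_eq)
    then show ?thesis
      by (intro small) (simp only: norm_mult norm_cis mult_1_right norm_of_real abs_of_nonneg)
  next
    case False
    have "pi / 2 \<le> half_turn t \<and> half_turn t \<le> pi"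
    proof (cases "t \<le> 2 / 3")
      case True
      have "pi * (1 / 2) \<le> pi * (3 * t - 1)" "pi * (3 * t - 1) \<le> pi * 1"
        using False True by (intro mult_left_mono; simp)+
      then show ?thesis using half_turn_values(2)[of t] True False by simp
    next
      case False
      then show ?thesis using half_turn_values(3)[of t] by simp
    qed
    then have "cos (half_turn t) \<le> cos (pi / 2)" by (intro cos_monotone_0_pi_le) auto
    then have c: "cos (half_turn t) \<le> 0" by simp
    have "Re (complex_of_real (t / (1 - t)) * cis (half_turn t)) = t / (1 - t) * cos (half_turn t)" by simp
    also have "\<dots> \<le> 0" using c assms by (intro mult_nonneg_nonpos) auto
    finally show ?thesis unfolding slit_plane_iff by linarith
  qed
  show ?thesis
    using 1 5 7 of_real_in_slit_plane[OF assms(2)] by (simp add: delta_path_def del: of_real_mult of_real_diff of_real_divide)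
qed

text \<open>
  The half turn is constant outside \<open>[1 / 3, 2 / 3]\<close> and affine on it.
\<close>

lemma half_turn_piecewise:
  assumes d: "\<And>t. t \<in> {0..\<tau>} \<Longrightarrow> (\<rho> has_real_derivative \<rho>' t) (at t)" and c: "continuous_on {0..\<tau>} \<rho>'"
    and \<tau>: "2 / 3 \<le> \<tau>"
  shows "(\<lambda>t. of_real (\<rho> t) * cis (half_turn t)) piecewise_C1_differentiable_on {0..\<tau>}"
proof -
  have d1: "((\<lambda>t. complex_of_real (\<rho> t)) has_vector_derivative of_real (\<rho>' t)) (at t)" if "t \<in> {0..\<tau>}" for t
    using d[OF that] by (intro has_vector_derivative_of_real) (simp add: has_real_derivative_iff_has_vector_derivative)
  have c1: "continuous_on S (\<lambda>t. complex_of_real (\<rho>' t))" if "S \<subseteq> {0..\<tau>}" for S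
    by (intro continuous_intros continuous_on_subset[OF c that])
  have r: "continuous_on S (\<lambda>t. complex_of_real (\<rho> t))" if "S \<subseteq> {0..\<tau>}" for S
    by (intro continuous_at_imp_continuous_on ballI has_vector_derivative_continuous[OF d1]) (use that in blast)
  have 1: "(\<lambda>t. complex_of_real (\<rho> t)) piecewise_C1_differentiable_on {0..1 / 3}"
    by (rule C1_differentiable_imp_piecewise)
       (use \<tau> d1 c1[of "{0..1/3}"] in \<open>auto simp: C1_differentiable_on_def intro!: exI[of _ "\<lambda>t. complex_of_real (\<rho>' t)"]\<close>)
  have 3: "(\<lambda>t. - complex_of_real (\<rho> t)) piecewise_C1_differentiable_on {2 / 3..\<tau>}"
    by (rule C1_differentiable_imp_piecewise)
       (use d1 c1[of "{2/3..\<tau>}"] in \<open>auto simp: C1_differentiable_on_def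
          intro!: exI[of _ "\<lambda>t. - complex_of_real (\<rho>' t)"] has_vector_derivative_minus continuous_on_minus\<close>)
  define e where "e = (\<lambda>t. cis (pi * (3 * t - 1)))"
  define e' where "e' = (\<lambda>t. 3 * of_real pi * \<i> * e t)"
  have de: "(e has_vector_derivative e' t) (at t)" for t
  proof -
    have "((\<lambda>t. \<i> * of_real (pi * (3 * t - 1))) has_vector_derivative \<i> * of_real (3 * pi)) (at t)"
      by (intro has_vector_derivative_mult_right has_vector_derivative_of_real)
         (auto simp: has_real_derivative_iff_has_vector_derivative[symmetric] intro!: derivative_eq_intros)
    from field_vector_diff_chain_at[OF this DERIV_exp] show ?thesis
      by (simp add: e_def e'_def o_def cis_conv_exp mult_ac)
  qed
  have ce: "continuous_on S e" for S
    using de by (intro continuous_at_imp_continuous_on ballI) (auto intro: has_vector_derivative_continuous)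
  have 2: "(\<lambda>t. complex_of_real (\<rho> t) * e t) piecewise_C1_differentiable_on {1 / 3..2 / 3}"
    unfolding C1_differentiable_on_def
  proof (rule C1_differentiable_imp_piecewise, unfold C1_differentiable_on_def, intro exI conjI ballI)
    show "((\<lambda>t. complex_of_real (\<rho> t) * e t) has_vector_derivative (of_real (\<rho> t) * e' t + of_real (\<rho>' t) * e t)) (at t)"
      if "t \<in> {1 / 3..2 / 3}" for t
      using that \<tau> by (intro has_vector_derivative_mult d1 de) auto
    show "continuous_on {1 / 3..2 / 3} (\<lambda>t. of_real (\<rho> t) * e' t + of_real (\<rho>' t) * e t)"
      unfolding e'_def using \<tau> by (intro continuous_intros ce r c1) auto
  qed
  have "(\<lambda>t. if t \<le> 1 / 3 then of_real (\<rho> t) else if t \<le> 2 / 3 then of_real (\<rho> t) * e t else - complex_of_real (\<rho> t))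
          piecewise_C1_differentiable_on {0..\<tau>}"
    by (rule piecewise_C1_differentiable_cases[OF 1 piecewise_C1_differentiable_cases[OF 2 3]])
       (use \<tau> in \<open>auto simp: e_def\<close>)
  moreover have "(if t \<le> 1 / 3 then of_real (\<rho> t) else if t \<le> 2 / 3 then of_real (\<rho> t) * e t else - complex_of_real (\<rho> t))
      = of_real (\<rho> t) * cis (half_turn t)" for t
    using half_turn_values[of t] by (simp add: e_def)
  ultimately show ?thesis by simp
qed

lemma delta_path_valid:
  assumes \<tau>: "2 / 3 \<le> \<tau>" "\<tau> < 1"
  shows "valid_path (subpath 0 \<tau> (delta_path i))"
proof -
  have d1: "((\<lambda>t::real. t * (1 - t)) has_real_derivative (1 - 2 * t)) (at t)" for t :: real
    by (auto intro!: derivative_eq_intros)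
  have d7: "((\<lambda>t::real. t / (1 - t)) has_real_derivative 1 / (1 - t)\<^sup>2) (at t)" if "t \<in> {0..\<tau>}" for t :: real
    using that \<tau> by (auto intro!: derivative_eq_intros simp: power2_eq_square)
  have c7: "continuous_on {0..\<tau>} (\<lambda>t::real. 1 / (1 - t)\<^sup>2)"
    using \<tau> by (intro continuous_intros) auto
  have C1: "(\<lambda>t. complex_of_real (f t)) piecewise_C1_differentiable_on {0..\<tau>}"
    if "\<And>t. (f has_real_derivative f' t) (at t)" "continuous_on {0..\<tau>} f'" for f f'
  proof (rule C1_differentiable_imp_piecewise, unfold C1_differentiable_on_def, intro exI conjI ballI)
    show "((\<lambda>t. complex_of_real (f t)) has_vector_derivative of_real (f' t)) (at t)" for t
      using that(1) by (intro has_vector_derivative_of_real) (simp add: has_real_derivative_iff_has_vector_derivative)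
    show "continuous_on {0..\<tau>} (\<lambda>t. complex_of_real (f' t))" by (intro continuous_intros that(2))
  qed
  have 5: "(\<lambda>t. of_real (t * (1 - t)) * cis (half_turn t)) piecewise_C1_differentiable_on {0..\<tau>}"
    by (rule half_turn_piecewise[OF d1 _ \<tau>(1)]) (intro continuous_intros)
  have 7: "(\<lambda>t. of_real (t / (1 - t)) * cis (half_turn t)) piecewise_C1_differentiable_on {0..\<tau>}"
    by (rule half_turn_piecewise[OF d7 c7 \<tau>(1)])
  have 1: "(\<lambda>t. complex_of_real (t * (1 - t))) piecewise_C1_differentiable_on {0..\<tau>}"
    by (rule C1[OF d1]) (intro continuous_intros)
  have 6: "(\<lambda>t. complex_of_real t) piecewise_C1_differentiable_on {0..\<tau>}"
    by (rule C1[OF DERIV_ident]) (intro continuous_intros)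
  have "delta_path i piecewise_C1_differentiable_on {0..\<tau>}"
    unfolding delta_path_def using 1 5 6 7 by (simp only: split: if_split) blast
  moreover have "(\<lambda>x. \<tau> * x) ` {0..1} = {0..\<tau>}"
    using \<tau> by (simp add: image_mult_atLeastAtMost_if)
  ultimately have "delta_path i \<circ> (\<lambda>x. \<tau> * x) piecewise_C1_differentiable_on {0..1}"
  proof (intro piecewise_C1_differentiable_compose)
    show "(\<lambda>x. \<tau> * x) piecewise_C1_differentiable_on {0..1}"
      by (intro C1_differentiable_imp_piecewise) (auto simp: C1_differentiable_on_def intro!: exI[of _ "\<lambda>_. \<tau>"] derivative_eq_intros)
    show "finite ({0..1} \<inter> (\<lambda>x. \<tau> * x) -` {x})" for x
    proof -
      have "{0..1} \<inter> (\<lambda>x. \<tau> * x) -` {x} \<subseteq> {x / \<tau>}" using \<tau> by auto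
      then show ?thesis by (rule finite_subset) simp
    qed
  qed simp_all
  then show ?thesis by (simp add: valid_path_def subpath_def o_def)
qed

section \<open>The path system\<close>

lemma tb01_Vbase: "tb01 = Vbase 0" "Vbase 9 = tb01" by (simp_all add: Vbase_def)

lemma tb10_Vbase: "tb10 = Vbase 6" by (simp add: Vbase_def)

lemma path_dom_Tangential: "path_dom (Tangential a) (Tangential b) = {0<..<1}" "path_dom (Tangential a) (Pt z) = {0<..1}"
  by (auto simp: path_dom_def)

lemma delta_end_param_starts:
  assumes \<tau>: "2 / 3 \<le> \<tau>" "\<tau> < 1"
  shows "starts_at (1 - \<tau>) (Vbase i) (reversepath (delta_path i))"
  unfolding Vbase_eq starts_at.simps
proof (intro exI[of _ "\<lambda>t. delta_end_param i (1 - t)"] conjI ballI)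
  have c: "isCont (\<lambda>t. delta_end_param i (1 - t)) t" if "t < 1" for t
    unfolding delta_end_param_def by (cases "i = 6"; cases "i = 7"; simp; intro continuous_intros; use that in simp)
  show "continuous_on {0<..1 - \<tau>} (\<lambda>t. delta_end_param i (1 - t))"
    by (intro continuous_at_imp_continuous_on ballI c) (use \<tau> in auto)
  have "((\<lambda>t. delta_end_param i (1 - t)) \<longlongrightarrow> delta_end_param i (1 - 0)) (at 0)"
    using c[of 0] by (simp add: isCont_def)
  moreover have "delta_end_param i (1 - 0) = 0" by (simp add: delta_end_param_def)
  ultimately have "((\<lambda>t. delta_end_param i (1 - t)) \<longlongrightarrow> 0) (at 0)" by metis
  then show "((\<lambda>t. delta_end_param i (1 - t)) \<longlongrightarrow> 0) (at_right 0)" by (rule filterlim_mono) (simp_all add: at_le)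
  fix t assume t: "t \<in> {0<..1 - \<tau>}"
  then have t': "2 / 3 \<le> 1 - t" "1 - t < 1" using \<tau> by auto
  show "0 < delta_end_param i (1 - t)" "delta_end_param i (1 - t) < 1" using delta_end_param_bounds[OF t'] by auto
  show "reversepath (delta_path i) t = vcurve i (delta_end_param i (1 - t))"
    using delta_path_end[OF t'] by (simp add: reversepath_def)
qed

lemma delta_path_tpaths: "delta_path i \<in> tpaths P1m tb01 (Vbase i)"
proof -
  have dom: "path_dom tb01 (Vbase i) = {0<..<1}" by (simp add: tb01_def Vbase_eq path_dom_Tangential)
  have h: "continuous_on S half_turn" for S
    unfolding half_turn_def by (intro continuous_intros)
  have hc: "continuous_on S (\<lambda>t. cis (half_turn t))" for S
    by (intro continuous_on_compose2[OF _ h, of UNIV cis]) (auto intro!: continuous_intros)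
  have "continuous_on {0<..<1} (delta_path i)"
    unfolding delta_path_def
    by (cases "i = 5"; cases "i = 6"; cases "i = 7"; simp; intro continuous_intros hc; simp)
  moreover have "delta_path i t \<in> P1m" if "t \<in> {0<..<1}" for t
  proof -
    have "delta_path i t \<in> slit_plane" by (rule delta_path_slit) (use that in auto)
    moreover have "1 \<notin> slit_plane" by (simp add: slit_plane_iff)
    ultimately have "delta_path i t \<noteq> 1" by metis
    then show ?thesis using delta_path_nonzero[of t i] that by (simp add: P1m_def)
  qed
  moreover have "joins (1 / 3) tb01 (Vbase i) (delta_path i)"
    unfolding joins_def
  proof
    have c: "isCont (delta_start_param i) t" if "t < 1" for t
      unfolding delta_start_param_def by (cases "i = 6"; cases "i = 7"; simp; intro continuous_intros; use that in simp)
    have "((delta_start_param i) \<longlongrightarrow> delta_start_param i 0) (at 0)" using c[of 0] by (simp add: isCont_def)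
    moreover have "delta_start_param i 0 = 0" by (simp add: delta_start_param_def)
    ultimately have "((delta_start_param i) \<longlongrightarrow> 0) (at 0)" by metis
    then have l: "((delta_start_param i) \<longlongrightarrow> 0) (at_right 0)" by (rule filterlim_mono) (simp_all add: at_le)
    show "starts_at (1 / 3) tb01 (delta_path i)"
      unfolding tb01_def starts_at.simps
    proof (intro exI[of _ "delta_start_param i"] conjI ballI l)
      show "continuous_on {0<..1 / 3} (delta_start_param i)"
        by (intro continuous_at_imp_continuous_on ballI c) auto
      fix t :: real assume t: "t \<in> {0<..1 / 3}"
      then show "0 < delta_start_param i t" "delta_start_param i t < 1" using delta_start_param_bounds[of t i] by auto
      show "delta_path i t = complex_of_real (delta_start_param i t)" using delta_path_start t by simp
    qed
    show "starts_at (1 / 3) (Vbase i) (reversepath (delta_path i))"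
      using delta_end_param_starts[of "2/3" i] by simp
  qed
  ultimately show ?thesis
    unfolding tpaths_def dom mem_Collect_eq by (intro conjI bexI[of _ "1/3"] image_subsetI) auto
qed

lemma truncates_to_delta: "\<exists>G. truncates_to P1m tb01 (Vbase i) (delta i) G"
  unfolding delta_eq
  by (rule truncates_to_pclass[OF delta_path_tpaths]) (simp_all add: tb01_Vbase(1) convex_region_Vbase)

lemma pi1_memD:
  assumes "\<gamma>0 \<in> pi1 W a b"
  obtains p where "p \<in> tpaths W a b" "\<gamma>0 = {q \<in> tpaths W a b. thomotopic W a b p q}"
  using assms unfolding pi1_def quotient_def by auto

lemma vparam_starts:
  assumes "continuous_on {0<..e} u" "(u \<longlongrightarrow> 0) (at_right 0)" "0 < e"
    and u: "\<And>t. t \<in> {0<..e} \<Longrightarrow> 0 < u t \<and> u t < 1 / 10 \<and> q t = (of_real ((u t)\<^sup>2), of_real (u t))"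
  shows "starts_at e (Vbase i) (Vmap i \<circ> q)"
  unfolding Vbase_eq starts_at.simps
proof (intro exI[of _ "\<lambda>t. vparam i (u t)"] conjI ballI)
  have "continuous_on {0<..} (vparam i)"
    by (intro continuous_at_imp_continuous_on ballI vparam_isCont) simp
  then show "continuous_on {0<..e} (\<lambda>t. vparam i (u t))"
    by (rule continuous_on_compose2[OF _ assms(1)]) (use u in auto)
  have "isCont (vparam i) 0" by (rule vparam_isCont) simp
  from isCont_tendsto_compose[OF this assms(2)]
  show "((\<lambda>t. vparam i (u t)) \<longlongrightarrow> 0) (at_right 0)" by (simp add: vparam_0)
  fix t assume "t \<in> {0<..e}"
  note ut = u[OF this]
  show "0 < vparam i (u t)" using vparam_pos ut by blast
  show "vparam i (u t) < 1" using vparam_small[of "u t" i] ut by simp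
  have "Vmap i (of_real ((u t)\<^sup>2), of_real (u t)) = vcurve i (vparam i (u t))"
    using Vmap_curve[of "u t" i] ut by simp
  then show "(Vmap i \<circ> q) t = vcurve i (vparam i (u t))" using ut by simp
qed

lemma Vmap_starts:
  assumes "starts_at e tbv q" "0 < e"
  shows "\<exists>d. 0 < d \<and> d \<le> e \<and> starts_at d (Vbase i) (Vmap i \<circ> q)"
proof -
  obtain u where uc: "continuous_on {0<..e} u" and u0: "(u \<longlongrightarrow> 0) (at_right 0)"
    and u: "\<forall>t\<in>{0<..e}. 0 < u t \<and> u t < 1 \<and> q t = (of_real ((u t)\<^sup>2), of_real (u t))"
    using assms(1)[unfolded tbv_def starts_at.simps] by (elim exE conjE)
  have "\<forall>\<^sub>F t in at_right 0. u t < 1 / 10" using u0 by (rule order_tendstoD) simp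
  then obtain d0 where d0: "0 < d0" "\<And>t. 0 < t \<Longrightarrow> t < d0 \<Longrightarrow> u t < 1 / 10"
    unfolding eventually_at_right_field by blast
  define d where "d = min e (d0 / 2)"
  have d: "0 < d" "d \<le> e" "d < d0" using d0 assms(2) by (auto simp: d_def)
  have "starts_at d (Vbase i) (Vmap i \<circ> q)"
  proof (rule vparam_starts[OF _ u0 d(1)])
    show "continuous_on {0<..d} u" by (rule continuous_on_subset[OF uc]) (use d in auto)
    fix t assume t: "t \<in> {0<..d}"
    then have "t \<in> {0<..e}" "u t < 1 / 10" using d d0(2)[of t] by auto
    then show "0 < u t \<and> u t < 1 / 10 \<and> q t = (of_real ((u t)\<^sup>2), of_real (u t))" using u by blast
  qed
  then show ?thesis using d by blast
qed

lemma Vmap_tpaths: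
  assumes "q \<in> tpaths V tbv (Pt w)"
  shows "Vmap i \<circ> q \<in> tpaths P1m (Vbase i) (Pt (Vmap i w))"
proof -
  note q = assms[unfolded tbv_def]
  have dom: "path_dom (Vbase i) (Pt (Vmap i w)) = {0<..1}" by (simp add: Vbase_eq path_dom_Tangential)
  have qc: "continuous_on {0<..1} q" using q by (simp add: tpaths_def path_dom_Tangential)
  obtain e where e: "0 < e" "e < 1" "starts_at e tbv q"
    using tpaths_Tangential_PtD(3)[OF q] unfolding tbv_def Bex_def greaterThanLessThan_iff by blast
  obtain d where d: "0 < d" "d \<le> e" "starts_at d (Vbase i) (Vmap i \<circ> q)"
    using Vmap_starts[OF e(3,1)] by blast
  have "joins d (Vbase i) (Pt (Vmap i w)) (Vmap i \<circ> q)"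
    using d(3) tpaths_Tangential_PtD(1)[OF q] by (simp add: joins_def reversepath_def)
  moreover have "continuous_on {0<..1} (Vmap i \<circ> q)"
    unfolding o_def by (rule continuous_on_compose2[OF continuous_on_Vmap qc])
      (use tpaths_Tangential_PtD(2)[OF q] in blast)
  moreover have "(Vmap i \<circ> q) ` {0<..1} \<subseteq> P1m"
    using tpaths_Tangential_PtD(2)[OF q] Vmap_maps by (intro image_subsetI) simp
  ultimately show ?thesis
    unfolding tpaths_def dom mem_Collect_eq using d(1,2) e(2) by (intro conjI bexI[of _ d]) auto
qed

text \<open>
  For \<open>i = 7\<close> the image of the curve is not contained in the curve of \<open>tbinf0\<close>, which ends at \<open>- 1\<close>, but it
  stays on the negative axis.
\<close>

lemma Vmap_region:
  obtains K where "convex K" "K \<subseteq> P1m" "Vmap i ` region tbv \<subseteq> K" "anchor (Vbase i) \<in> K"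
proof -
  define J where "J = (if i = 5 \<or> i = 7 then {..<0} else {0<..<1::real})"
  have J: "convex J" "0 \<notin> J" "1 \<notin> J" by (auto simp: J_def)
  have small: "vparam i v < 1" if "0 < v" "v < 1" "i \<noteq> 7" for v
  proof -
    have d: "v / x < 1" if "1 \<le> x" for x using that \<open>0 < v\<close> \<open>v < 1\<close> by (simp add: divide_less_eq)
    have sq: "v\<^sup>2 < 1" "v ^ 3 < 1" using that by (simp_all add: power_less_one_iff)
    have "1 \<le> 1 + v" "1 \<le> (1 + v)\<^sup>2" using that by (auto intro: one_le_power)
    moreover have "v\<^sup>2 / (1 + v) < 1" using sq that by (simp add: divide_less_eq)
    ultimately show ?thesis using d[of "1 + v"] d[of "(1 + v)\<^sup>2"] sq that by (simp add: vparam_def)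
  qed
  have vJ: "vcurve i x \<in> of_real ` J" if "0 < x" "x < 1 \<or> i = 7" for x
  proof -
    have m: "complex_of_real y \<in> of_real ` J" if "y \<in> J" for y using that by (rule imageI)
    consider "i = 5" | "i = 6" | "i = 7" | "i \<noteq> 5 \<and> i \<noteq> 6 \<and> i \<noteq> 7" by blast
    then show ?thesis
    proof cases
      case 1 then show ?thesis unfolding 1 vcurve_cases by (intro m) (use that 1 in \<open>simp add: J_def\<close>)
    next
      case 2 then show ?thesis unfolding 2 vcurve_cases by (intro m) (use that 2 in \<open>simp add: J_def\<close>)
    next
      case 3 then show ?thesis unfolding 3 vcurve_cases by (intro m) (use that 3 in \<open>simp add: J_def\<close>)
    next
      case 4
      then have "vcurve i x = of_real x" by (simp add: vcurve_cases)
      then show ?thesis using m[of x] that 4 by (simp add: J_def)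
    qed
  qed
  show ?thesis
  proof (rule that[of "of_real ` J"])
    show "convex (complex_of_real ` J)" by (rule convex_of_real_image[OF J(1)])
    show "complex_of_real ` J \<subseteq> P1m" using J(2,3) by (auto simp: P1m_def)
    show "anchor (Vbase i) \<in> of_real ` J" using vJ[of "1/2"] by (simp add: Vbase_eq)
    show "Vmap i ` region tbv \<subseteq> of_real ` J"
    proof (rule image_subsetI)
      fix w assume "w \<in> region tbv"
      then obtain t where t: "0 < t" "t < 1" "w = (of_real (t\<^sup>2), of_real t)" by (auto simp: tbv_def)
      show "Vmap i w \<in> of_real ` J"
        unfolding t(3) Vmap_curve[OF t(1,2)]
        by (rule vJ) (use vparam_pos[OF t(1)] small[OF t(1,2)] in auto)
    qed
  qed
qed

text \<open>
  All paths of the class have the same truncation up to homotopy, which is what uniqueness of the values requires.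
\<close>

lemma truncates_to_path_system:
  assumes w: "w \<in> V" and \<gamma>: "\<gamma>0 \<in> pi1 V tbv (Pt w)"
  shows "\<exists>G. truncates_to P1m (Vbase i) (Pt (Vmap i w)) (pimage P1m (Vbase i) (Pt (Vmap i w)) (Vmap i) \<gamma>0) G"
    "\<exists>G. truncates_to P1m tb01 (Pt (Vmap i w)) (path_system w \<gamma>0 i) G"
proof -
  let ?z = "Vmap i w"
  have z: "?z \<in> P1m" by (rule Vmap_maps[OF w])
  have reg: "convex_region P1m (Pt ?z)" using z by (simp add: convex_region_def)
  obtain p where p: "p \<in> tpaths V tbv (Pt w)" and \<gamma>0: "\<gamma>0 = {q \<in> tpaths V tbv (Pt w). thomotopic V tbv (Pt w) p q}"
    using pi1_memD[OF \<gamma>] by blast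
  obtain K where K: "convex K" "K \<subseteq> P1m" "Vmap i ` region tbv \<subseteq> K" "anchor (Vbase i) \<in> K"
    by (rule Vmap_region)
  have "\<exists>G. \<forall>q. thomotopic V tbv (Pt w) p q \<longrightarrow>
    (\<forall>\<^sub>F e in at_right 0. homotopic_paths P1m (anchored (anchor (Vbase i)) ?z (cutoff tbv e) (1 - cutoff (Pt w) e) (Vmap i \<circ> q)) G)"
    by (rule thomotopic_anchored[OF p continuous_on_Vmap _ K(1,2,4,3), where L = "{?z}"])
       (use Vmap_maps z in auto)
  then obtain G where G: "\<And>q. thomotopic V tbv (Pt w) p q \<Longrightarrow>
    \<forall>\<^sub>F e in at_right 0. homotopic_paths P1m (anchored (anchor (Vbase i)) ?z (cutoff tbv e) (1 - cutoff (Pt w) e) (Vmap i \<circ> q)) G"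
    by blast
  have cut: "cutoff tbv e = cutoff (Vbase i) e" "cutoff (Pt w) e = cutoff (Pt ?z) e" for e
    by (simp_all add: cutoff_def tbv_def Vbase_eq)
  have "truncates_to P1m (Vbase i) (Pt ?z) ((\<lambda>q. Vmap i \<circ> q) ` \<gamma>0) G"
    unfolding truncates_to_def anchor.simps
  proof (intro ballI conjI)
    fix g assume "g \<in> (\<lambda>q. Vmap i \<circ> q) ` \<gamma>0"
    then obtain q where q: "q \<in> tpaths V tbv (Pt w)" "thomotopic V tbv (Pt w) p q" and g: "g = Vmap i \<circ> q"
      unfolding \<gamma>0 by blast
    show "g \<in> tpaths P1m (Vbase i) (Pt ?z)" unfolding g by (rule Vmap_tpaths[OF q(1)])
    show "\<forall>\<^sub>F e in at_right 0. homotopic_paths P1m (anchored (anchor (Vbase i)) ?z (cutoff (Vbase i) e) (1 - cutoff (Pt ?z) e) g) G"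
      using G[OF q(2)] unfolding g cut .
  qed
  then have "truncates_to P1m (Vbase i) (Pt ?z) (\<Union>g\<in>(\<lambda>q. Vmap i \<circ> q) ` \<gamma>0. pclass P1m (Vbase i) (Pt ?z) g) G"
    by (rule truncates_to_Union_pclass[OF _ convex_region_Vbase reg])
  then have L: "truncates_to P1m (Vbase i) (Pt ?z) (pimage P1m (Vbase i) (Pt ?z) (Vmap i) \<gamma>0) G"
    by (simp add: pimage_def)
  then show "\<exists>G. truncates_to P1m (Vbase i) (Pt ?z) (pimage P1m (Vbase i) (Pt ?z) (Vmap i) \<gamma>0) G" by blast
  obtain G1 where G1: "truncates_to P1m tb01 (Vbase i) (delta i) G1" using truncates_to_delta by blast
  have "truncates_to P1m tb01 (Pt ?z) (path_system w \<gamma>0 i) (G1 +++ G)"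
    unfolding path_system_def using G1 L convex_region_Vbase[of i] convex_region_Vbase[of 0] z
    unfolding tb01_Vbase(1) Vbase_eq by (intro truncates_to_pcomp)
  then show "\<exists>G. truncates_to P1m tb01 (Pt ?z) (path_system w \<gamma>0 i) G" by blast
qed

text \<open>
  The first half is the tangential curve itself, on which the nine maps are real and all branches are known.
\<close>

definition curve_then :: "real \<Rightarrow> (real \<Rightarrow> complex \<times> complex) \<Rightarrow> real \<Rightarrow> complex \<times> complex" where
  "curve_then v P = (\<lambda>t. if t \<le> 1 / 2 then (of_real ((2 * v * t)\<^sup>2), of_real (2 * v * t)) else P (2 * t - 1))"

lemma open_V: "open V"
proof -
  have "V = {w. fst w * snd w * (1 - fst w) * (1 - snd w) * (fst w - snd w) * (1 - fst w * snd w) \<noteq> 0}"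
    by (auto simp: V_def case_prod_unfold)
  then show ?thesis
    using open_Collect_neq[of "\<lambda>w::complex\<times>complex. fst w * snd w * (1 - fst w) * (1 - snd w) * (fst w - snd w) * (1 - fst w * snd w)" "\<lambda>_. 0"]
    by (simp add: continuous_intros del: mult_eq_0_iff)
qed

lemma curve_then_in_class:
  assumes \<gamma>: "\<gamma>0 \<in> pi1 V tbv (Pt w)"
  shows "\<forall>\<^sub>F v in at_right 0. \<exists>P. polynomial_function P \<and> P 0 = (of_real (v\<^sup>2), of_real v) \<and> P 1 = w \<and>
     P ` {0..1} \<subseteq> V \<and> curve_then v P \<in> \<gamma>0"
proof -
  obtain p where p: "p \<in> tpaths V tbv (Pt w)" and \<gamma>0: "\<gamma>0 = {q \<in> tpaths V tbv (Pt w). thomotopic V tbv (Pt w) p q}"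
    using pi1_memD[OF \<gamma>] by blast
  let ?b = "\<lambda>t::real. (complex_of_real (t\<^sup>2), complex_of_real t)"
  have "continuous_on {0<..<1} ?b" by (intro continuous_intros)
  moreover have "?b ` {0<..<1} \<subseteq> V"
  proof (rule image_subsetI)
    fix t :: real assume t: "t \<in> {0<..<1}"
    have "t\<^sup>2 * t * (1 - t\<^sup>2) * (1 - t) * (t\<^sup>2 - t) * (1 - t\<^sup>2 * t) \<noteq> 0"
    proof -
      have "t\<^sup>2 < t" using t by (simp add: power2_eq_square)
      moreover have "t\<^sup>2 * t < 1 * 1" using t \<open>t\<^sup>2 < t\<close> by (intro mult_strict_mono) auto
      ultimately show ?thesis using t by auto
    qed
    then have "complex_of_real (t\<^sup>2 * t * (1 - t\<^sup>2) * (1 - t) * (t\<^sup>2 - t) * (1 - t\<^sup>2 * t)) \<noteq> 0"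
      unfolding of_real_eq_0_iff .
    then show "?b t \<in> V" by (simp add: V_def)
  qed
  ultimately have "\<forall>\<^sub>F v in at_right 0. \<exists>P. polynomial_function P \<and> P 0 = ?b v \<and> P 1 = w \<and> P ` {0..1} \<subseteq> V \<and>
           thomotopic V (Tangential ?b) (Pt w) p (\<lambda>t. if t \<le> 1 / 2 then ?b (2 * v * t) else P (2 * t - 1))"
    by (rule tangential_polynomial_representative[OF p[unfolded tbv_def] open_V])
  then show ?thesis
  proof eventually_elim
    case (elim v)
    then obtain P where P: "polynomial_function P" "P 0 = ?b v" "P 1 = w" "P ` {0..1} \<subseteq> V"
      "thomotopic V tbv (Pt w) p (curve_then v P)" unfolding tbv_def curve_then_def by blast
    then have "curve_then v P \<in> \<gamma>0" unfolding \<gamma>0 using thomotopic_imp_tpaths(2) by blast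
    then show ?case using P(1-4) by blast
  qed
qed

section \<open>Evaluation of the integrals on explicit paths\<close>

text \<open>
  Successive primitives of the two integrands determine the iterated integral; \<open>L\<close> is a logarithm of \<open>1 - g\<close>.
\<close>

lemma Li2_path_primitive:
  assumes g: "valid_path g" "\<And>t. t \<in> {0..1} \<Longrightarrow> g t \<noteq> 1" and S: "finite S"
    and L: "continuous_on {0..1} L" "L 0 = 0"
      "\<And>t. t \<in> {0<..<1} - S \<Longrightarrow> (L has_vector_derivative vector_derivative g (at t) / (g t - 1)) (at t)"
    and G: "continuous_on {0..1} G" "G 0 = 0"
      "\<And>t. t \<in> {0<..<1} - S \<Longrightarrow> (G has_vector_derivative 1 / g t * - L t * vector_derivative g (at t)) (at t)"
  shows "Li2_path g = G 1"
proof -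
  have "((\<lambda>t. 1 / g t * - L t * vector_derivative g (at t)) has_integral (G 1 - G 0)) {0..1}"
    by (rule fundamental_theorem_of_calculus_interior_strong[OF S]) (use G in auto)
  then have "integral {0..1} (\<lambda>t. 1 / g t * - L t * vector_derivative g (at t)) = G 1"
    using G(2) by (simp only: integral_unique diff_0_right)
  moreover have "Li2_path g = integral {0..1} (\<lambda>t. 1 / g t * - L t * vector_derivative g (at t))"
    unfolding Li2_path_def
  proof (rule integral_spike)
    show "negligible {0, 1::real}" by simp
    fix t :: real assume t: "t \<in> {0..1} - {0, 1}"
    have "Li1_path (subpath 0 t g) = - L t"
      by (rule Li1_path_primitive[OF g S L]) (use t in auto)
    moreover have "vector_derivative g (at t within {0..1}) = vector_derivative g (at t)"
      using t by (simp add: at_within_Icc_at)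
    ultimately show "1 / g t * - L t * vector_derivative g (at t) =
        1 / g t * Li1_path (subpath 0 t g) * vector_derivative g (at t within {0..1})" by simp
  qed
  ultimately show ?thesis by simp
qed

lemma joinpaths_deriv1:
  fixes f :: "real \<Rightarrow> complex"
  assumes "t < 1 / 2" "(f has_vector_derivative f') (at (2 * t))"
  shows "((f +++ g) has_vector_derivative 2 * f') (at t)"
proof -
  have "((\<lambda>t. 2 * t) has_vector_derivative 2) (at t)"
    by (auto simp: has_real_derivative_iff_has_vector_derivative[symmetric] intro!: derivative_eq_intros)
  from vector_diff_chain_at[OF this assms(2)]
  have "((\<lambda>t. f (2 * t)) has_vector_derivative 2 * f') (at t)" by (simp add: o_def scaleR_conv_of_real)
  then show ?thesis
    by (rule has_vector_derivative_transform_within_open[where S = "{..<1/2}"])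
       (use assms(1) in \<open>auto simp: joinpaths_def\<close>)
qed

lemma joinpaths_deriv2:
  fixes f :: "real \<Rightarrow> complex"
  assumes "1 / 2 < t" "(g has_vector_derivative g') (at (2 * t - 1))"
  shows "((f +++ g) has_vector_derivative 2 * g') (at t)"
proof -
  have "((\<lambda>t. 2 * t - 1) has_vector_derivative 2) (at t)"
    by (auto simp: has_real_derivative_iff_has_vector_derivative[symmetric] intro!: derivative_eq_intros)
  from vector_diff_chain_at[OF this assms(2)]
  have "((\<lambda>t. g (2 * t - 1)) has_vector_derivative 2 * g') (at t)" by (simp add: o_def scaleR_conv_of_real)
  then show ?thesis
    by (rule has_vector_derivative_transform_within_open[where S = "{1/2<..}"])
       (use assms(1) in \<open>auto simp: joinpaths_def\<close>)
qed

text \<open>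
  On the first piece the principal branch serves as primitive; the functions \<open>L\<close> and \<open>G\<close> continue it along the second.
\<close>

lemma Li2_path_join:
  assumes d: "valid_path d" "\<And>t. t \<in> {0..1} \<Longrightarrow> d t \<in> slit_plane" "d 0 = 0" "\<And>t. t \<in> {0<..1} \<Longrightarrow> d t \<noteq> 0"
    and Q: "valid_path Q" "Q 0 = d 1" "\<And>t. t \<in> {0..1} \<Longrightarrow> Q t \<noteq> 1"
      "\<And>t. t \<in> {0<..<1} \<Longrightarrow> (Q has_vector_derivative Q' t) (at t)"
    and L: "continuous_on {0..1} L" "L 0 = Ln (1 - d 1)"
      "\<And>t. t \<in> {0<..<1} \<Longrightarrow> (L has_vector_derivative Q' t / (Q t - 1)) (at t)"
    and G: "continuous_on {0..1} G" "G 0 = dilog (d 1)"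
      "\<And>t. t \<in> {0<..<1} \<Longrightarrow> (G has_vector_derivative 1 / Q t * - L t * Q' t) (at t)"
  shows "Li2_path (d +++ Q) = G 1"
proof -
  obtain S where S: "finite S" "{0, 1} \<subseteq> S"
    "\<And>t. t \<in> {0..1} - S \<Longrightarrow> (d has_vector_derivative vector_derivative d (at t)) (at t)"
    using valid_path_obtain_deriv[OF d(1)] by metis
  let ?L = "(\<lambda>t. Ln (1 - d t)) +++ L" and ?G = "(\<lambda>t. dilog (d t)) +++ G"
  let ?S = "insert (1 / 2) ((\<lambda>x. x / 2) ` S)"
  have dc: "continuous_on {0..1} d" using d(1) valid_path_imp_path path_def by blast
  have Lc: "continuous_on {0..1} (\<lambda>t. Ln (1 - d t))"
    using d(2) by (intro continuous_intros dc) (auto simp: slit_plane_def)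
  have "continuous_on slit_plane dilog"
    by (intro continuous_at_imp_continuous_on ballI DERIV_isCont[OF dilog_has_deriv])
  then have Gc: "continuous_on {0..1} (\<lambda>t. dilog (d t))"
    by (rule continuous_on_compose2[OF _ dc]) (use d(2) in blast)
  have cL: "continuous_on {0..1} ?L" 
    by (rule continuous_on_joinpaths[OF Lc L(1)]) (simp add: pathfinish_def pathstart_def L(2))
  have cG: "continuous_on {0..1} ?G"
    by (rule continuous_on_joinpaths[OF Gc G(1)]) (simp add: pathfinish_def pathstart_def G(2))
  have v: "valid_path (d +++ Q)"
    by (rule valid_path_join[OF d(1) Q(1)]) (simp add: pathfinish_def pathstart_def Q(2))
  have one: "1 \<notin> slit_plane" by (simp add: slit_plane_iff)
  have ne1: "(d +++ Q) t \<noteq> 1" if "t \<in> {0..1}" for t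
  proof (cases "t \<le> 1 / 2")
    case True
    then have "d (2 * t) \<in> slit_plane" using that by (intro d(2)) auto
    then have "d (2 * t) \<noteq> 1" using one by metis
    then show ?thesis using True by (simp add: joinpaths_def)
  next
    case False
    then show ?thesis using Q(3)[of "2 * t - 1"] that by (simp add: joinpaths_def)
  qed
  have D1: "(d has_vector_derivative vector_derivative d (at (2 * t))) (at (2 * t))" "2 * t \<in> {0<..1}"
    if "t \<in> {0<..<1} - ?S" "t < 1 / 2" for t
  proof -
    have "t \<notin> (\<lambda>x. x / 2) ` S" using that by blast
    then have "2 * t \<notin> S" by (metis image_eqI nonzero_mult_div_cancel_left zero_neq_numeral)
    then show "(d has_vector_derivative vector_derivative d (at (2 * t))) (at (2 * t))"
      by (intro S(3)) (use that in auto)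
    show "2 * t \<in> {0<..1}" using that by auto
  qed
  have vd1: "vector_derivative (d +++ Q) (at t) = 2 * vector_derivative d (at (2 * t))"
    if "t \<in> {0<..<1} - ?S" "t < 1 / 2" for t
    by (rule vector_derivative_at[OF joinpaths_deriv1[OF that(2) D1(1)[OF that]]])
  have t2: "2 * t - 1 \<in> {0<..<1}" if "t \<in> {0<..<1} - ?S" "1 / 2 < t" for t using that by auto
  have vd2: "vector_derivative (d +++ Q) (at t) = 2 * Q' (2 * t - 1)"
    if "t \<in> {0<..<1} - ?S" "1 / 2 < t" for t
    by (rule vector_derivative_at[OF joinpaths_deriv2[OF that(2) Q(4)[OF t2[OF that]]]])
  have dich: "t < 1 / 2 \<or> 1 / 2 < t" if "t \<in> {0<..<1} - ?S" for t using that by auto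
  have "Li2_path (d +++ Q) = ?G 1"
  proof (rule Li2_path_primitive[OF v ne1 _ cL _ _ cG])
    show "finite ?S" using S(1) by simp
    show "?L 0 = 0" "?G 0 = 0" by (simp_all add: joinpaths_def d(3) dilog_0)
    fix t assume t: "t \<in> {0<..<1} - ?S"
    show "(?L has_vector_derivative vector_derivative (d +++ Q) (at t) / ((d +++ Q) t - 1)) (at t)"
    proof (cases "t < 1 / 2")
      case True
      note D = D1[OF t True]
      have sl: "d (2 * t) \<in> slit_plane" by (rule d(2)) (use D(2) in auto)
      from field_vector_diff_chain_at[OF D(1) Ln_one_minus_deriv[OF sl]]
      have "((\<lambda>t. - Ln (1 - d t)) has_vector_derivative vector_derivative d (at (2 * t)) * (1 / (1 - d (2 * t)))) (at (2 * t))"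
        by (simp only: o_def)
      from has_vector_derivative_minus[OF this]
      have "((\<lambda>t. Ln (1 - d t)) has_vector_derivative - (vector_derivative d (at (2 * t)) * (1 / (1 - d (2 * t))))) (at (2 * t))"
        by (simp only: minus_minus)
      from joinpaths_deriv1[OF True this]
      have "(?L has_vector_derivative 2 * - (vector_derivative d (at (2 * t)) * (1 / (1 - d (2 * t))))) (at t)" .
      moreover have "2 * - (a * (1 / (1 - b))) = 2 * a / (b - 1)" for a b :: complex
      proof -
        have "2 * - (a * (1 / (- c))) = 2 * a / c" for c by simp
        from this[of "b - 1"] show ?thesis by (simp only: minus_diff_eq)
      qed
      moreover have "(d +++ Q) t = d (2 * t)" using True by (simp add: joinpaths_def)
      ultimately show ?thesis unfolding vd1[OF t True] by (simp only:)
    next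
      case False
      then have h: "1 / 2 < t" using dich[OF t] by blast
      have "(d +++ Q) t = Q (2 * t - 1)" using h by (simp add: joinpaths_def)
      then show ?thesis
        using joinpaths_deriv2[OF h L(3)[OF t2[OF t h]], of "\<lambda>t. Ln (1 - d t)"] unfolding vd2[OF t h]
        by (simp only: times_divide_eq_right)
    qed
    show "(?G has_vector_derivative 1 / (d +++ Q) t * - ?L t * vector_derivative (d +++ Q) (at t)) (at t)"
    proof (cases "t < 1 / 2")
      case True
      note D = D1[OF t True]
      have sl: "d (2 * t) \<in> slit_plane" by (rule d(2)) (use D(2) in auto)
      from field_vector_diff_chain_at[OF D(1) dilog_has_deriv[OF sl]]
      have "((\<lambda>t. dilog (d t)) has_vector_derivative vector_derivative d (at (2 * t)) * dilog_deriv (d (2 * t))) (at (2 * t))"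
        by (simp only: o_def)
      from joinpaths_deriv1[OF True this]
      have "(?G has_vector_derivative 2 * (vector_derivative d (at (2 * t)) * dilog_deriv (d (2 * t)))) (at t)" .
      moreover have "dilog_deriv (d (2 * t)) = - Ln (1 - d (2 * t)) / d (2 * t)"
        using d(4)[OF D(2)] by (simp add: dilog_deriv_def)
      moreover have "2 * (a * (- l / b)) = 1 / b * - l * (2 * a)" for a b l :: complex by simp
      moreover have "(d +++ Q) t = d (2 * t)" "?L t = Ln (1 - d (2 * t))" using True by (simp_all add: joinpaths_def)
      ultimately show ?thesis unfolding vd1[OF t True] by (simp only:)
    next
      case False
      then have h: "1 / 2 < t" using dich[OF t] by blast
      have "(d +++ Q) t = Q (2 * t - 1)" "?L t = L (2 * t - 1)" using h by (simp_all add: joinpaths_def)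
      moreover have "2 * (a * b) = a * (2 * b)" for a b :: complex by simp
      ultimately show ?thesis
        using joinpaths_deriv2[OF h G(3)[OF t2[OF t h]], of "\<lambda>t. dilog (d t)"] unfolding vd2[OF t h]
        by (simp only:)
    qed
  qed
  also have "?G 1 = G 1" by (simp add: joinpaths_def)
  finally show ?thesis .
qed

text \<open>
  A time at which the standard path can be cut in order to be composed with a path that starts close to the puncture.
\<close>

lemma delta_end_param_surj:
  assumes "0 < c" "c < 1 / 5"
  obtains \<tau> where "2 / 3 \<le> \<tau>" "\<tau> < 1" "delta_end_param i \<tau> = c"
proof -
  have "\<exists>x\<ge>2 / 3. x \<le> 1 \<and> delta_end_param i x = c"
  proof (rule IVT2')
    show "delta_end_param i 1 \<le> c" using assms by (simp add: delta_end_param_def)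
    show "c \<le> delta_end_param i (2 / 3)" using assms by (simp add: delta_end_param_def)
    show "continuous_on {2 / 3..1} (delta_end_param i)"
      unfolding delta_end_param_def by (cases "i = 6"; cases "i = 7"; simp; intro continuous_intros; simp)
  qed simp
  then obtain x where x: "2 / 3 \<le> x" "x \<le> 1" "delta_end_param i x = c" by blast
  have "x \<noteq> 1"
  proof
    assume "x = 1"
    then have "delta_end_param i x = 0" by (simp add: delta_end_param_def)
    then show False using x(3) assms(1) by simp
  qed
  then show ?thesis using that[of x] x by linarith
qed

text \<open>
  The path has to be cut at time \<open>1 / 2\<close>, which is where it leaves the tangential curve.
\<close>

lemma path_system_composite:
  assumes w: "w \<in> V" and \<gamma>: "\<gamma>0 \<in> pi1 V tbv (Pt w)" and v: "0 < v" "v < 1 / 10"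
    and P: "P 0 = (of_real (v\<^sup>2), of_real v)" "curve_then v P \<in> \<gamma>0"
    and \<tau>: "2 / 3 \<le> \<tau>" "\<tau> < 1" "delta_end_param i \<tau> = vparam i v"
  shows "subpath 0 \<tau> (delta_path i) +++ subpath (1 / 2) 1 (Vmap i \<circ> curve_then v P) \<in> path_system w \<gamma>0 i"
proof -
  let ?q = "Vmap i \<circ> curve_then v P" and ?z = "Vmap i w"
  have z: "?z \<in> P1m" by (rule Vmap_maps[OF w])
  obtain G1 where G1: "truncates_to P1m tb01 (Vbase i) (delta i) G1" using truncates_to_delta by blast
  obtain G2 where G2: "truncates_to P1m (Vbase i) (Pt ?z) (pimage P1m (Vbase i) (Pt ?z) (Vmap i) \<gamma>0) G2"
    using truncates_to_path_system(1)[OF w \<gamma>] by blast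
  have st: "starts_at (1 / 2) (Vbase i) ?q"
  proof (rule vparam_starts[where u = "\<lambda>t. 2 * v * t"])
    show "continuous_on {0<..1 / 2} (\<lambda>t. 2 * v * t)" by (intro continuous_intros)
    have "((\<lambda>t. 2 * v * t) \<longlongrightarrow> 2 * v * 0) (at_right 0)" by (intro tendsto_intros)
    then show "((\<lambda>t. 2 * v * t) \<longlongrightarrow> 0) (at_right 0)" by simp
    fix t :: real assume t: "t \<in> {0<..1 / 2}"
    have "v * (2 * t) \<le> v" using t v by (intro mult_left_le) auto
    then have "2 * v * t < 1 / 10" using v by linarith
    then show "0 < 2 * v * t \<and> 2 * v * t < 1 / 10 \<and> curve_then v P t = (of_real ((2 * v * t)\<^sup>2), of_real (2 * v * t))"
      using t v by (simp add: curve_then_def)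
  qed simp
  have "delta_path i \<tau> = ?q (1 / 2)"
    using delta_path_end[OF \<tau>(1,2), of i] \<tau>(3) Vmap_curve[of v i] v by (simp add: curve_then_def)
  then have comp: "composite (Vbase i) (delta_path i) ?q (subpath 0 \<tau> (delta_path i) +++ subpath (1 / 2) 1 ?q)"
    using st delta_end_param_starts[OF \<tau>(1,2), of i] \<tau>(1,2) unfolding Vbase_eq composite.simps
    by (intro bexI[of _ \<tau>] bexI[of _ "1 / 2"] conjI refl) simp_all
  have di: "delta_path i \<in> delta i"
    unfolding delta_eq pclass_def using thomotopic_refl[OF delta_path_tpaths] by simp
  have "curve_then v P \<in> tpaths V tbv (Pt w)"
    using pi1_memD[OF \<gamma>] P(2) by blast
  then have "?q \<in> pclass P1m (Vbase i) (Pt ?z) ?q"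
    unfolding pclass_def using thomotopic_refl[OF Vmap_tpaths] by blast
  then have qi: "?q \<in> pimage P1m (Vbase i) (Pt ?z) (Vmap i) \<gamma>0"
    unfolding pimage_def using P(2) by blast
  show ?thesis
    unfolding path_system_def
    using G1 G2 convex_region_Vbase[of i] convex_region_Vbase[of 0] z di qi comp
    unfolding tb01_Vbase(1) Vbase_eq by (intro composite_in_pcomp)
qed

lemma subpath_curve_then:
  assumes "P 0 = (of_real (v\<^sup>2), of_real v)" "0 \<le> t"
  shows "subpath (1 / 2) 1 (Vmap i \<circ> curve_then v P) t = Vmap i (P t)"
proof (cases "t = 0")
  case True
  then show ?thesis using assms by (simp add: subpath_def curve_then_def)
next
  case False
  have "(1 - 1 / 2) * t + 1 / 2 = (1 + t) / 2" "2 * ((1 + t) / 2) - 1 = t" "\<not> (1 + t) / 2 \<le> 1 / 2"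
    using False assms(2) by (auto simp: field_simps)
  then show ?thesis by (simp only: subpath_def curve_then_def o_def if_False)
qed

lemma valid_path_C1:
  assumes c: "continuous_on {0..1} h'" 
    and d: "\<And>t. t \<in> {0..1} \<Longrightarrow> (h has_vector_derivative h' t) (at t within {0..1})"
    and Q: "\<And>t. t \<in> {0..1} \<Longrightarrow> Q t = h t"
  shows "valid_path Q" "\<And>t. t \<in> {0<..<1} \<Longrightarrow> (Q has_vector_derivative h' t) (at t)"
proof -
  show q: "(Q has_vector_derivative h' t) (at t)" if "t \<in> {0<..<1}" for t
  proof -
    have "(h has_vector_derivative h' t) (at t)"
      using d[of t] that by (simp add: at_within_Icc_at)
    then show ?thesis
      by (rule has_vector_derivative_transform_within_open[where S = "{0<..<1}"]) (use that Q in auto)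
  qed
  have "continuous_on {0..1} h"
    unfolding continuous_on_eq_continuous_within by (intro ballI has_vector_derivative_continuous[OF d])
  then have "continuous_on {0..1} Q" by (subst continuous_on_cong[OF refl Q])
  moreover have "Q C1_differentiable_on {0..1} - {0, 1}"
    unfolding C1_differentiable_on_def
  proof (intro exI[of _ h'] conjI ballI)
    show "(Q has_vector_derivative h' x) (at x)" if "x \<in> {0..1} - {0, 1}" for x
      by (rule q) (use that in auto)
    show "continuous_on ({0..1} - {0, 1}) h'" by (rule continuous_on_subset[OF c]) auto
  qed
  ultimately show "valid_path Q"
    unfolding valid_path_def piecewise_C1_differentiable_on_def by (intro conjI exI[of _ "{0, 1}"]) simp_all
qed

text \<open>
  The initial value of \<open>G\<close> is a principal one, since the standard path stays in the slit plane.
\<close>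

lemma Li2_path_system:
  assumes w: "w \<in> V" and \<gamma>: "\<gamma>0 \<in> pi1 V tbv (Pt w)" and v: "0 < v" "v < 1 / 10"
    and P: "P 0 = (of_real (v\<^sup>2), of_real v)" "curve_then v P \<in> \<gamma>0" "P ` {0..1} \<subseteq> V"
    and h: "continuous_on {0..1} h'"
      "\<And>t. t \<in> {0..1} \<Longrightarrow> ((\<lambda>t. Vmap i (P t)) has_vector_derivative h' t) (at t within {0..1})"
    and L: "L 0 = Ln (1 - vcurve i (vparam i v))"
      "\<And>t. t \<in> {0..1} \<Longrightarrow> (L has_vector_derivative h' t / (Vmap i (P t) - 1)) (at t within {0..1})"
    and G: "G 0 = dilog (vcurve i (vparam i v))"
      "\<And>t. t \<in> {0..1} \<Longrightarrow> (G has_vector_derivative 1 / Vmap i (P t) * - L t * h' t) (at t within {0..1})"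
  shows "Li2 (Vmap i w) (path_system w \<gamma>0 i) = G 1"
proof -
  obtain \<tau> where \<tau>: "2 / 3 \<le> \<tau>" "\<tau> < 1" "delta_end_param i \<tau> = vparam i v"
    by (rule delta_end_param_surj[OF vparam_pos[OF v(1)] vparam_small[OF v]])
  let ?d = "subpath 0 \<tau> (delta_path i)" and ?Q = "subpath (1 / 2) 1 (Vmap i \<circ> curve_then v P)"
  have Q: "?Q t = Vmap i (P t)" if "t \<in> {0..1}" for t
    by (rule subpath_curve_then[where P = P and v = v, OF P(1)]) (use that in auto)
  have QP: "Vmap i (P t) \<in> P1m" if "t \<in> {0..1}" for t
    by (rule Vmap_maps) (use P(3) that in blast)
  have vQ1: "valid_path ?Q" by (rule valid_path_C1(1)[OF h Q])
  have vQ2: "(?Q has_vector_derivative h' t) (at t)" if "t \<in> {0<..<1}" for t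
    by (rule valid_path_C1(2)[OF h Q]) (use that in auto)
  have d1: "?d 1 = vcurve i (vparam i v)"
    using delta_path_end[OF \<tau>(1,2), of i] \<tau>(3) by (simp add: subpath_def)
  have Q0: "?Q 0 = ?d 1"
    using Q[of 0] P(1) Vmap_curve[of v i] v d1 by simp
  have dt: "?d t = delta_path i (\<tau> * t)" for t by (simp add: subpath_def)
  have mem: "\<tau> * t \<in> {0..<1}" if "t \<in> {0..1}" for t
  proof -
    have "\<tau> * t \<le> \<tau>" "0 \<le> \<tau> * t" using that \<tau> by (auto intro!: mult_left_le)
    then show ?thesis using \<tau>(2) unfolding atLeastLessThan_iff by linarith
  qed
  have in_Icc: "t \<in> {0..1}" if "t \<in> {0<..<1}" for t :: real using that by auto
  have at: "at t within {0..1} = at t" if "t \<in> {0<..<1}" for t :: real using that by (simp add: at_within_Icc_at)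
  have "Li2_path (?d +++ ?Q) = G 1"
  proof (rule Li2_path_join[where Q' = h' and L = L and G = G])
    show "valid_path ?d" by (rule delta_path_valid[OF \<tau>(1,2)])
    show "?d t \<in> slit_plane" if "t \<in> {0..1}" for t
      unfolding dt by (rule delta_path_slit) (use mem[OF that] in auto)
    show "?d 0 = 0" unfolding dt by (simp add: delta_path_def)
    show "?d t \<noteq> 0" if t: "t \<in> {0<..1}" for t
      unfolding dt
    proof (rule delta_path_nonzero)
      show "0 < \<tau> * t" using t \<tau> by simp
      show "\<tau> * t < 1" using mem[of t] t by simp
    qed
    show "valid_path ?Q" by (rule vQ1)
    show "?Q 0 = ?d 1" by (rule Q0)
    show "?Q t \<noteq> 1" if "t \<in> {0..1}" for t using Q[OF that] QP[OF that] by (simp add: P1m_def)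
    show "(?Q has_vector_derivative h' t) (at t)" if "t \<in> {0<..<1}" for t by (rule vQ2[OF that])
    show "continuous_on {0..1} L"
      unfolding continuous_on_eq_continuous_within by (intro ballI has_vector_derivative_continuous[OF L(2)])
    show "continuous_on {0..1} G"
      unfolding continuous_on_eq_continuous_within by (intro ballI has_vector_derivative_continuous[OF G(2)])
    show "L 0 = Ln (1 - ?d 1)" "G 0 = dilog (?d 1)" unfolding d1 by (rule L(1) G(1))+
    show "(L has_vector_derivative h' t / (?Q t - 1)) (at t)" if "t \<in> {0<..<1}" for t
      using L(2)[OF in_Icc[OF that]] unfolding at[OF that] Q[OF in_Icc[OF that]] .
    show "(G has_vector_derivative 1 / ?Q t * - L t * h' t) (at t)" if "t \<in> {0<..<1}" for t
      using G(2)[OF in_Icc[OF that]] unfolding at[OF that] Q[OF in_Icc[OF that]] .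
  qed
  moreover have "valid_path (?d +++ ?Q)"
    using Q0 by (intro valid_path_join delta_path_valid[OF \<tau>(1,2)] vQ1) (simp add: pathfinish_def pathstart_def)
  moreover obtain G' where "truncates_to P1m tb01 (Pt (Vmap i w)) (path_system w \<gamma>0 i) G'"
    using truncates_to_path_system(2)[OF w \<gamma>] by blast
  ultimately show ?thesis
    using Li2_eqI[OF _ path_system_composite[where P = P and v = v and \<tau> = \<tau> and i = i, OF w \<gamma> v P(1,2) \<tau>]] by metis
qed

section \<open>Logarithms along the path system\<close>

lemma truncates_to_pinv_delta_10: "\<exists>G. truncates_to P1m tb10 tb01 (pinv delta_10) G"
  and reversepath_in_pinv: "reversepath (delta_path 6) \<in> pinv delta_10"
proof -
  have d10: "delta_10 = pclass P1m tb01 tb10 (delta_path 6)"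
    using delta_eq[of 6] by (simp add: delta_def Vbase_def)
  have "thomotopic P1m tb01 tb10 (delta_path 6) (delta_path 6)"
    using thomotopic_refl[OF delta_path_tpaths[of 6]] by (simp add: Vbase_def)
  then have r: "reversepath (delta_path 6) \<in> tpaths P1m tb10 tb01" and m: "delta_path 6 \<in> delta_10"
    using thomotopic_imp_tpaths(1)[OF thomotopic_reversepath] d10 by (auto simp: pclass_def)
  show "reversepath (delta_path 6) \<in> pinv delta_10" unfolding pinv_def using m by blast
  obtain G where G: "truncates_to P1m tb10 tb01 (pclass P1m tb10 tb01 (reversepath (delta_path 6))) G"
    using truncates_to_pclass[OF r] convex_region_Vbase[of 0] convex_region_Vbase[of 6]
    unfolding tb01_Vbase(1) tb10_Vbase by blast
  have "pinv delta_10 \<subseteq> pclass P1m tb10 tb01 (reversepath (delta_path 6))"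
    unfolding pinv_def d10 pclass_def using thomotopic_reversepath by blast
  then have "truncates_to P1m tb10 tb01 (pinv delta_10) G" using G unfolding truncates_to_def by blast
  then show "\<exists>G. truncates_to P1m tb10 tb01 (pinv delta_10) G" by blast
qed

text \<open>
  For \<open>i\<close> other than \<open>5\<close> and \<open>7\<close> the standard path is real and the composite with the inverse of \<open>delta_10\<close> can
  be cut where the standard path ends: it is then the segment from \<open>1\<close> to \<open>c\<close> followed by the image of \<open>P\<close>.
\<close>

lemma log_path_system:
  assumes w: "w \<in> V" and \<gamma>: "\<gamma>0 \<in> pi1 V tbv (Pt w)" and v: "0 < v" "v < 1 / 10"
    and P: "P 0 = (of_real (v\<^sup>2), of_real v)" "curve_then v P \<in> \<gamma>0" "P ` {0..1} \<subseteq> V"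
    and i: "i \<noteq> 5" "i \<noteq> 7" and c: "vcurve i (vparam i v) = of_real c" "0 < c" "c < 1"
    and h: "continuous_on {0..1} h'"
      "\<And>t. t \<in> {0..1} \<Longrightarrow> ((\<lambda>t. Vmap i (P t)) has_vector_derivative h' t) (at t within {0..1})"
    and L: "L 0 = of_real (ln c)"
      "\<And>t. t \<in> {0..1} \<Longrightarrow> (L has_vector_derivative h' t / Vmap i (P t)) (at t within {0..1})"
  shows "log_along (Vmap i w) (path_system w \<gamma>0 i) = L 1"
proof -
  obtain \<tau> where \<tau>: "2 / 3 \<le> \<tau>" "\<tau> < 1" "delta_end_param i \<tau> = vparam i v"
    by (rule delta_end_param_surj[OF vparam_pos[OF v(1)] vparam_small[OF v]])
  let ?z = "Vmap i w" and ?C = "path_system w \<gamma>0 i"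
  let ?d = "subpath 0 \<tau> (delta_path i)" and ?Q = "subpath (1 / 2) 1 (Vmap i \<circ> curve_then v P)"
  let ?r = "?d +++ ?Q" and ?p = "reversepath (delta_path 6)"
  let ?s = "subpath 0 (1 - c) ?p +++ subpath (1 / 2) 1 ?r"
  have Q: "?Q t = Vmap i (P t)" if "t \<in> {0..1}" for t
    by (rule subpath_curve_then[where P = P and v = v, OF P(1)]) (use that in auto)
  have vQ1: "valid_path ?Q" by (rule valid_path_C1(1)[OF h Q])
  have dt: "?d t = delta_path i (\<tau> * t)" for t by (simp add: subpath_def)
  have d1: "?d 1 = of_real c"
    using delta_path_end[OF \<tau>(1,2), of i] \<tau>(3) c(1) by (simp add: subpath_def)
  have Q0: "?Q 0 = of_real c"
    using Q[of 0] P(1) Vmap_curve[of v i] v c(1) by simp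
  have vr: "valid_path ?r"
    using Q0 d1 by (intro valid_path_join delta_path_valid[OF \<tau>(1,2)] vQ1) (simp add: pathfinish_def pathstart_def)
  have r2: "subpath (1 / 2) 1 ?r t = Vmap i (P t)" if t: "t \<in> {0..1}" for t
  proof (cases "t = 0")
    case True
    have "subpath (1 / 2) 1 ?r 0 = ?d 1" by (simp add: subpath_def joinpaths_def)
    then show ?thesis using d1 Q0 Q[of 0] True by simp
  next
    case False
    have eqs: "(1 - 1 / 2) * t + 1 / 2 = (1 + t) / 2" "2 * ((1 + t) / 2) - 1 = t" "\<not> (1 + t) / 2 \<le> 1 / 2"
      using False t by (auto simp: field_simps)
    have "subpath (1 / 2) 1 ?r t = ?r ((1 + t) / 2)"
      unfolding subpath_def[of "1 / 2" 1 ?r] eqs(1) ..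
    also have "\<dots> = ?Q t"
      unfolding joinpaths_def using eqs(2,3) by (simp only: if_False)
    finally have "subpath (1 / 2) 1 ?r t = ?Q t" .
    then show ?thesis using Q[OF t] by simp
  qed
  have vr2: "(subpath (1 / 2) 1 ?r has_vector_derivative h' t) (at t)" if "t \<in> {0<..<1}" for t
    by (rule valid_path_C1(2)[OF h r2]) (use that in auto)
  have line: "subpath 0 (1 - c) ?p = linepath 1 (of_real c)"
    by (rule ext) (simp add: subpath_def reversepath_def delta_path_def linepath_def scaleR_conv_of_real algebra_simps)
  have st1: "starts_at (1 - (1 - c)) tb01 (reversepath ?p)"
    unfolding tb01_def starts_at.simps
    using c(2,3) by (intro exI[of _ "\<lambda>t. t"] conjI ballI continuous_on_id tendsto_ident_at)
      (simp_all add: reversepath_def delta_path_def)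
  have st2: "starts_at (1 / 2) tb01 ?r"
    unfolding tb01_def starts_at.simps
  proof (intro exI[of _ "\<lambda>t. if i = 6 then \<tau> * (2 * t) else \<tau> * (2 * t) * (1 - \<tau> * (2 * t))"] conjI ballI)
    let ?u = "\<lambda>t. if i = 6 then \<tau> * (2 * t) else \<tau> * (2 * t) * (1 - \<tau> * (2 * t))"
    have c: "isCont ?u t" for t by (cases "i = 6"; simp; intro continuous_intros)
    show "continuous_on {0<..1 / 2} ?u" by (intro continuous_at_imp_continuous_on ballI c)
    have "(?u \<longlongrightarrow> ?u 0) (at 0)" by (rule c[of 0, unfolded isCont_def])
    then have "(?u \<longlongrightarrow> 0) (at 0)" by (rule tendsto_eq_rhs) simp
    then show "(?u \<longlongrightarrow> 0) (at_right 0)" by (rule filterlim_mono) (simp_all add: at_le)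
    fix t :: real assume t: "t \<in> {0<..1 / 2}"
    define x where "x = \<tau> * (2 * t)"
    have x0: "0 < x" using t \<tau> by (simp add: x_def)
    have "x \<le> \<tau>" unfolding x_def using t \<tau> by (intro mult_left_le) auto
    then have x1: "x < 1" using \<tau>(2) by linarith
    have xx: "0 < x * (1 - x)" "x * (1 - x) < 1"
      using x0 x1 mult_one_minus_le_quarter[of x] by (simp, linarith)
    show "0 < ?u t" "?u t < 1" unfolding x_def[symmetric] using x0 x1 xx by (cases "i = 6"; simp only: if_True if_False)+
    have "t \<le> 1 / 2" using t by simp
    then have "?r t = ?d (2 * t)" unfolding joinpaths_def by (rule if_P)
    also have "\<dots> = delta_path i x" unfolding dt x_def ..
    also have "\<dots> = of_real (?u t)"
      unfolding x_def[symmetric] using i by (simp add: delta_path_def)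
    finally show "?r t = of_real (?u t)" .
  qed
  have rh: "?r (1 / 2) = of_real c" using d1 by (simp add: joinpaths_def)
  have pr: "?p (1 - c) = ?r (1 / 2)" unfolding rh by (simp add: reversepath_def delta_path_def)
  have mem: "1 - c \<in> {0<..<1}" "1 / 2 \<in> {0<..<1::real}" using c(2,3) by auto
  have comp: "composite tb01 ?p ?r ?s"
    using st1 st2 pr mem unfolding tb01_Vbase(1) Vbase_eq composite.simps
    by (intro bexI[of _ "1 - c"] bexI[of _ "1 / 2"] conjI refl)
  obtain G1 where G1: "truncates_to P1m tb10 tb01 (pinv delta_10) G1" using truncates_to_pinv_delta_10 by blast
  obtain G2 where G2: "truncates_to P1m tb01 (Pt ?z) ?C G2" using truncates_to_path_system(2)[OF w \<gamma>] by blast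
  have z: "?z \<in> P1m" by (rule Vmap_maps[OF w])
  have rC: "?r \<in> ?C"
    by (rule path_system_composite[where P = P and v = v and \<tau> = \<tau> and i = i, OF w \<gamma> v P(1,2) \<tau>])
  have reg: "convex_region P1m tb10" "convex_region P1m tb01"
    using convex_region_Vbase[of 6] convex_region_Vbase[of 0] by (simp_all add: Vbase_def)
  have sC: "?s \<in> pcomp P1m tb10 tb01 (Pt ?z) (pinv delta_10) ?C"
    using G1 G2 reg z reversepath_in_pinv rC comp unfolding tb01_def tb10_def by (rule composite_in_pcomp)
  have lead: "truncates_to P1m tb10 (Pt ?z) (pcomp P1m tb10 tb01 (Pt ?z) (pinv delta_10) ?C) (G1 +++ G2)"
    using G1 G2 reg z unfolding tb01_def tb10_def by (rule truncates_to_pcomp)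
  have vs2: "valid_path (subpath (1 / 2) 1 ?r)" by (rule valid_path_subpath[OF vr]) auto
  have vs: "valid_path ?s"
    unfolding line by (intro valid_path_join valid_path_linepath vs2) (simp only: pathfinish_linepath pathstart_subpath rh)
  have "log_along ?z ?C = contour_integral ?s (\<lambda>t. 1 / t)"
    by (rule log_along_eqI[OF lead sC vs])
  also have "\<dots> = L 1"
  proof (rule contour_integral_unique)
    have seg: "closed_segment 1 (complex_of_real c) \<subseteq> - \<real>\<^sub>\<le>\<^sub>0"
    proof
      fix x assume "x \<in> closed_segment 1 (complex_of_real c)"
      then obtain u where u: "0 \<le> u" "u \<le> 1" "x = of_real ((1 - u) + u * c)"
        by (auto simp: closed_segment_def scaleR_conv_of_real)
      have "0 < (1 - u) + u * c"
        using u c(2) by (cases "u = 1") (auto intro: add_pos_nonneg)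
      then show "x \<in> - \<real>\<^sub>\<le>\<^sub>0" using u(3) by (auto simp: complex_nonpos_Reals_iff)
    qed
    have "((\<lambda>t. 1 / t) has_contour_integral (Ln (pathfinish (linepath 1 (of_real c))) - Ln (pathstart (linepath 1 (of_real c))))) (linepath 1 (of_real c))"
    proof (rule contour_integral_primitive)
      show "(Ln has_field_derivative 1 / x) (at x within - \<real>\<^sub>\<le>\<^sub>0)" if "x \<in> - \<real>\<^sub>\<le>\<^sub>0" for x
        using has_field_derivative_Ln[of x] that by (simp add: has_field_derivative_at_within inverse_eq_divide)
    qed (use seg in auto)
    then have 1: "((\<lambda>t. 1 / t) has_contour_integral of_real (ln c)) (subpath 0 (1 - c) ?p)"
      unfolding line using Ln_of_real[OF c(2)] by simp
    have "((\<lambda>x. 1 / subpath (1 / 2) 1 ?r x * vector_derivative (subpath (1 / 2) 1 ?r) (at x)) has_integral L 1 - L 0) {0..1}"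
    proof (rule fundamental_theorem_of_calculus_interior_strong[of "{}"])
      show "continuous_on {0..1} L"
        unfolding continuous_on_eq_continuous_within by (intro ballI has_vector_derivative_continuous[OF L(2)])
      fix x :: real assume "x \<in> {0<..<1} - {}"
      then have x: "x \<in> {0<..<1}" "x \<in> {0..1}" "at x within {0..1} = at x" by (simp_all add: at_within_Icc_at)
      show "(L has_vector_derivative 1 / subpath (1 / 2) 1 ?r x * vector_derivative (subpath (1 / 2) 1 ?r) (at x)) (at x)"
        using L(2)[OF x(2)] unfolding vector_derivative_at[OF vr2[OF x(1)]] r2[OF x(2)] x(3) by simp
    qed simp_all
    then have 2: "((\<lambda>t. 1 / t) has_contour_integral L 1 - L 0) (subpath (1 / 2) 1 ?r)"
      unfolding has_contour_integral .
    have "valid_path (subpath 0 (1 - c) ?p)" unfolding line by (rule valid_path_linepath)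
    from has_contour_integral_join[OF 1 2 this vs2]
    show "((\<lambda>t. 1 / t) has_contour_integral L 1) ?s" using L(1) by simp
  qed
  finally show ?thesis .
qed

text \<open>
  With the derivative in the form \<open>F t * \<eta>\<close> no division is needed, and products and quotients of functions
  correspond to sums and differences of logarithmic derivatives.
\<close>

definition has_logderiv :: "(real \<Rightarrow> complex) \<Rightarrow> complex \<Rightarrow> real \<Rightarrow> bool" where
  "has_logderiv F \<eta> t \<longleftrightarrow> (F has_vector_derivative F t * \<eta>) (at t within {0..1})"

lemma has_logderiv_mult:
  assumes "has_logderiv F \<eta> t" "has_logderiv G \<theta> t"
  shows "has_logderiv (\<lambda>t. F t * G t) (\<eta> + \<theta>) t"
proof -
  have "F t * (G t * \<theta>) + F t * \<eta> * G t = F t * G t * (\<eta> + \<theta>)" by (simp add: algebra_simps)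
  with has_vector_derivative_mult[OF assms[unfolded has_logderiv_def]]
  show ?thesis unfolding has_logderiv_def by (simp only:)
qed

lemma has_logderiv_power2:
  "has_logderiv F \<eta> t \<Longrightarrow> has_logderiv (\<lambda>t. (F t)\<^sup>2) (2 * \<eta>) t"
  unfolding power2_eq_square mult_2 by (rule has_logderiv_mult)

lemma has_logderiv_divide:
  assumes "has_logderiv F \<eta> t" "has_logderiv G \<theta> t" "G t \<noteq> 0"
  shows "has_logderiv (\<lambda>t. F t / G t) (\<eta> - \<theta>) t"
proof -
  have "(inverse has_field_derivative - (inverse (G t) * 1 * inverse (G t))) (at (G t))"
    using DERIV_inverse'[OF DERIV_ident assms(3)] by simp
  then have "(inverse has_field_derivative - (inverse (G t) * 1 * inverse (G t))) (at (G t) within G ` {0..1})"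
    by (rule has_field_derivative_at_within)
  from field_vector_diff_chain_within[OF assms(2)[unfolded has_logderiv_def] this]
  have "((\<lambda>t. inverse (G t)) has_vector_derivative G t * \<theta> * - (inverse (G t) * 1 * inverse (G t))) (at t within {0..1})"
    by (simp only: o_def)
  moreover have "G t * \<theta> * - (inverse (G t) * 1 * inverse (G t)) = inverse (G t) * - \<theta>"
    using assms(3) by (simp add: field_simps)
  ultimately have "has_logderiv (\<lambda>t. inverse (G t)) (- \<theta>) t"
    unfolding has_logderiv_def by (simp only:)
  from has_logderiv_mult[OF assms(1) this] show ?thesis by (simp only: divide_inverse diff_conv_add_uminus)
qed

lemma has_logderivI:
  assumes "(F has_vector_derivative d) (at t within {0..1})" "F t \<noteq> 0" "\<eta> = d / F t"
  shows "has_logderiv F \<eta> t"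
  using assms by (simp add: has_logderiv_def)

text \<open>
  The derivative of \<open>1 - f\<close> is minus that of \<open>f\<close>. This links the two logarithmic derivatives \<open>\<eta>\<close> and \<open>\<theta>\<close>, so that
  \<open>L\<close> is a logarithm of \<open>1 - f\<close> in the sense of \<open>Li2_path_system\<close>.
\<close>

lemma Li2_path_system_logderiv:
  assumes w: "w \<in> V" and \<gamma>: "\<gamma>0 \<in> pi1 V tbv (Pt w)" and v: "0 < v" "v < 1 / 10"
    and P: "P 0 = (of_real (v\<^sup>2), of_real v)" "curve_then v P \<in> \<gamma>0" "P ` {0..1} \<subseteq> V"
    and \<eta>: "continuous_on {0..1} \<eta>" "\<And>t. t \<in> {0..1} \<Longrightarrow> has_logderiv (\<lambda>t. Vmap i (P t)) (\<eta> t) t"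
    and \<theta>: "\<And>t. t \<in> {0..1} \<Longrightarrow> has_logderiv (\<lambda>t. 1 - Vmap i (P t)) (\<theta> t) t"
    and L: "L 0 = Ln (1 - vcurve i (vparam i v))"
      "\<And>t. t \<in> {0..1} \<Longrightarrow> (L has_vector_derivative \<theta> t) (at t within {0..1})"
    and G: "G 0 = dilog (vcurve i (vparam i v))"
      "\<And>t. t \<in> {0..1} \<Longrightarrow> (G has_vector_derivative - (L t * \<eta> t)) (at t within {0..1})"
  shows "Li2 (Vmap i w) (path_system w \<gamma>0 i) = G 1"
proof (rule Li2_path_system[where P = P and L = L and G = G and h' = "\<lambda>t. Vmap i (P t) * \<eta> t", OF w \<gamma> v P])
  have d: "((\<lambda>t. Vmap i (P t)) has_vector_derivative Vmap i (P t) * \<eta> t) (at t within {0..1})" if "t \<in> {0..1}" for t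
    using \<eta>(2)[OF that] by (simp only: has_logderiv_def)
  have "continuous_on {0..1} (\<lambda>t. Vmap i (P t))"
    unfolding continuous_on_eq_continuous_within by (intro ballI has_vector_derivative_continuous[OF d])
  then show "continuous_on {0..1} (\<lambda>t. Vmap i (P t) * \<eta> t)" using \<eta>(1) by (rule continuous_on_mult)
  show "((\<lambda>t. Vmap i (P t)) has_vector_derivative Vmap i (P t) * \<eta> t) (at t within {0..1})" if "t \<in> {0..1}" for t
    by (rule d[OF that])
  show "L 0 = Ln (1 - vcurve i (vparam i v))" "G 0 = dilog (vcurve i (vparam i v))" by (rule L(1) G(1))+
  fix t :: real assume t: "t \<in> {0..1}"
  have "Vmap i (P t) \<in> P1m" by (rule Vmap_maps) (use P(3) t in blast)
  then have ne: "Vmap i (P t) \<noteq> 0" "Vmap i (P t) - 1 \<noteq> 0" by (auto simp: P1m_def)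
  have "((\<lambda>t. 1 - Vmap i (P t)) has_vector_derivative 0 - Vmap i (P t) * \<eta> t) (at t within cbox 0 1)"
    using d[OF t] by (intro has_vector_derivative_diff has_vector_derivative_const) simp
  moreover have "((\<lambda>t. 1 - Vmap i (P t)) has_vector_derivative (1 - Vmap i (P t)) * \<theta> t) (at t within cbox 0 1)"
    using \<theta>[OF t] by (simp add: has_logderiv_def)
  ultimately have "0 - Vmap i (P t) * \<eta> t = (1 - Vmap i (P t)) * \<theta> t"
    using vector_derivative_unique_within_closed_interval[of 0 1 t] t by simp
  then have "Vmap i (P t) * \<eta> t = (Vmap i (P t) - 1) * \<theta> t" by (simp add: algebra_simps)
  then have "Vmap i (P t) * \<eta> t / (Vmap i (P t) - 1) = \<theta> t" using ne(2) by simp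
  then show "(L has_vector_derivative Vmap i (P t) * \<eta> t / (Vmap i (P t) - 1)) (at t within {0..1})"
    using L(2)[OF t] by simp
  have "1 / Vmap i (P t) * - L t * (Vmap i (P t) * \<eta> t) = - (L t * \<eta> t)" using ne(1) by simp
  then show "(G has_vector_derivative 1 / Vmap i (P t) * - L t * (Vmap i (P t) * \<eta> t)) (at t within {0..1})"
    using G(2)[OF t] by simp
qed

lemma log_path_system_logderiv:
  assumes w: "w \<in> V" and \<gamma>: "\<gamma>0 \<in> pi1 V tbv (Pt w)" and v: "0 < v" "v < 1 / 10"
    and P: "P 0 = (of_real (v\<^sup>2), of_real v)" "curve_then v P \<in> \<gamma>0" "P ` {0..1} \<subseteq> V"
    and i: "i \<noteq> 5" "i \<noteq> 7" and c: "vcurve i (vparam i v) = of_real c" "0 < c" "c < 1"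
    and \<eta>: "continuous_on {0..1} \<eta>" "\<And>t. t \<in> {0..1} \<Longrightarrow> has_logderiv (\<lambda>t. Vmap i (P t)) (\<eta> t) t"
    and L: "L 0 = of_real (ln c)"
      "\<And>t. t \<in> {0..1} \<Longrightarrow> (L has_vector_derivative \<eta> t) (at t within {0..1})"
  shows "log_along (Vmap i w) (path_system w \<gamma>0 i) = L 1"
proof (rule log_path_system[where P = P and L = L and h' = "\<lambda>t. Vmap i (P t) * \<eta> t", OF w \<gamma> v P i c])
  have d: "((\<lambda>t. Vmap i (P t)) has_vector_derivative Vmap i (P t) * \<eta> t) (at t within {0..1})" if "t \<in> {0..1}" for t
    using \<eta>(2)[OF that] by (simp only: has_logderiv_def)
  have "continuous_on {0..1} (\<lambda>t. Vmap i (P t))"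
    unfolding continuous_on_eq_continuous_within by (intro ballI has_vector_derivative_continuous[OF d])
  then show "continuous_on {0..1} (\<lambda>t. Vmap i (P t) * \<eta> t)" using \<eta>(1) by (rule continuous_on_mult)
  show "((\<lambda>t. Vmap i (P t)) has_vector_derivative Vmap i (P t) * \<eta> t) (at t within {0..1})" if "t \<in> {0..1}" for t
    by (rule d[OF that])
  show "L 0 = of_real (ln c)" by (rule L(1))
  fix t :: real assume t: "t \<in> {0..1}"
  have "Vmap i (P t) \<in> P1m" by (rule Vmap_maps) (use P(3) t in blast)
  then have "Vmap i (P t) * \<eta> t / Vmap i (P t) = \<eta> t" by (simp add: P1m_def)
  then show "(L has_vector_derivative Vmap i (P t) * \<eta> t / Vmap i (P t)) (at t within {0..1})"
    using L(2)[OF t] by (simp only:)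
qed

section \<open>Logarithmic derivatives of the nine maps\<close>

lemma has_logderiv_cong:
  assumes "has_logderiv F \<eta> t" "t \<in> {0..1}" "\<And>s. s \<in> {0..1} \<Longrightarrow> G s = F s"
  shows "has_logderiv G \<eta> t"
  using has_vector_derivative_transform[OF assms(2,3) assms(1)[unfolded has_logderiv_def]] assms(2,3)
  unfolding has_logderiv_def by (simp only:)

text \<open>
  These factorisations are the reason why the dilogarithms of the nine maps are related: the differences \<open>1 - f\<^sub>i\<close>
  have only the factors of the equation of \<open>V\<close>, and so only six logarithms occur.
\<close>

lemma one_minus_Vmap:
  assumes "(x, y) \<in> V"
  shows "1 - Vmap 1 (x, y) = (y - x) * (1 - x * y) / (y * (1 - x)\<^sup>2)"
    "1 - Vmap 2 (x, y) = 1 - x * y"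
    "1 - Vmap 3 (x, y) = (y - x) / y"
    "1 - Vmap 4 (x, y) = (y - x) / (y * (1 - x))"
    "1 - Vmap 5 (x, y) = (1 - x * y) / (1 - x)"
    "1 - Vmap 6 (x, y) = (y - x) / (1 - x)"
    "1 - Vmap 7 (x, y) = (1 - x * y) / (y * (1 - x))"
    "1 - Vmap 8 (x, y) = 1 - x"
    "1 - Vmap 9 (x, y) = 1 - y"
proof -
  have nz: "x \<noteq> 0" "y \<noteq> 0" "1 - x \<noteq> 0" "x - 1 \<noteq> 0" using assms by (auto simp: V_def)
  have d: "1 - a / b = (b - a) / b" if "b \<noteq> 0" for a b :: complex using that by (simp add: diff_divide_distrib)
  have e1: "y * (1 - x)\<^sup>2 - x * (1 - y)\<^sup>2 = (y - x) * (1 - x * y)"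
    by (simp add: power2_eq_square algebra_simps)
  have e4: "y * (1 - x) - x * (1 - y) = y - x" by (simp add: algebra_simps)
  have e5: "(x - 1) - x * (1 - y) = - (1 - x * y)" by (simp add: algebra_simps)
  have e6: "(1 - x) - (1 - y) = y - x" by (simp add: algebra_simps)
  have e7: "y * (x - 1) - (1 - y) = - (1 - x * y)" by (simp add: algebra_simps)
  have m5: "- u / (x - 1) = u / (1 - x)" for u by (metis minus_diff_eq minus_divide_divide minus_minus)
  have m7: "- u / (y * (x - 1)) = u / (y * (1 - x))" for u
    by (metis minus_diff_eq minus_divide_divide minus_minus mult_minus_right)
  have z1: "y * (1 - x)\<^sup>2 \<noteq> 0" and z4: "y * (1 - x) \<noteq> 0" and z7: "y * (x - 1) \<noteq> 0" using nz by simp_all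
  show "1 - Vmap 1 (x, y) = (y - x) * (1 - x * y) / (y * (1 - x)\<^sup>2)"
    using d[OF z1, of "x * (1 - y)\<^sup>2"] unfolding e1 by (simp add: Vmap_def)
  show "1 - Vmap 2 (x, y) = 1 - x * y" "1 - Vmap 8 (x, y) = 1 - x" "1 - Vmap 9 (x, y) = 1 - y"
    by (simp_all add: Vmap_def)
  show "1 - Vmap 3 (x, y) = (y - x) / y" using d[OF nz(2), of x] by (simp add: Vmap_def)
  show "1 - Vmap 4 (x, y) = (y - x) / (y * (1 - x))"
    using d[OF z4, of "x * (1 - y)"] unfolding e4 by (simp add: Vmap_def)
  show "1 - Vmap 5 (x, y) = (1 - x * y) / (1 - x)"
    using d[OF nz(4), of "x * (1 - y)"] unfolding e5 m5 by (simp add: Vmap_def)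
  show "1 - Vmap 6 (x, y) = (y - x) / (1 - x)"
    using d[OF nz(3), of "1 - y"] unfolding e6 by (simp add: Vmap_def)
  show "1 - Vmap 7 (x, y) = (1 - x * y) / (y * (1 - x))"
    using d[OF z7, of "1 - y"] unfolding e7 m7 by (simp add: Vmap_def)
qed

lemma ex_antiderivative:
  fixes f :: "real \<Rightarrow> complex"
  assumes "continuous_on {0..1} f"
  shows "\<exists>g. g 0 = c \<and> (\<forall>t\<in>{0..1}. (g has_vector_derivative f t) (at t within {0..1}))"
proof -
  obtain g where g: "\<And>t. t \<in> {0..1} \<Longrightarrow> (g has_vector_derivative f t) (at t within {0..1})"
    using antiderivative_continuous[OF assms] by metis
  have "((\<lambda>t. g t - g 0 + c) has_vector_derivative f t) (at t within {0..1})" if "t \<in> {0..1}" for t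
    using has_vector_derivative_add[OF has_vector_derivative_diff[OF g[OF that] has_vector_derivative_const[of "g 0"]]
        has_vector_derivative_const[of c]] by simp
  then show ?thesis by (intro exI[of _ "\<lambda>t. g t - g 0 + c"]) simp
qed

lemma zero_derivative_imp_eq:
  fixes F :: "real \<Rightarrow> complex"
  assumes "\<And>t. t \<in> {0..1} \<Longrightarrow> (F has_vector_derivative F' t) (at t within {0..1})"
    and "\<And>t. t \<in> {0..1} \<Longrightarrow> F' t = 0"
  shows "F 1 = F 0"
proof -
  have "(F' has_integral F 1 - F 0) {0..1}"
    by (rule fundamental_theorem_of_calculus) (use assms(1) in auto)
  moreover have "(F' has_integral 0) {0..1}"
    by (rule has_integral_is_0) (use assms(2) in auto)
  ultimately have "F 1 - F 0 = 0" by (rule has_integral_unique)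
  then show ?thesis by simp
qed

text \<open>
  The derivative of \<open>log f\<^sub>i\<close> at the point \<open>(x, y)\<close> in the direction \<open>(a, b)\<close>. The terms are kept in the shape in
  which the product rule produces them.
\<close>

definition Vlogderiv :: "complex \<times> complex \<Rightarrow> complex \<times> complex \<Rightarrow> nat \<Rightarrow> complex" where
  "Vlogderiv = (\<lambda>(x, y) (a, b) i.
     if i = 1 then a / x + 2 * (- b / (1 - y)) - (b / y + 2 * (- a / (1 - x)))
     else if i = 2 then a / x + b / y
     else if i = 3 then a / x - b / y
     else if i = 4 then a / x + - b / (1 - y) - (b / y + - a / (1 - x))
     else if i = 5 then a / x + - b / (1 - y) - - a / (1 - x)
     else if i = 6 then - b / (1 - y) - - a / (1 - x)
     else if i = 7 then - b / (1 - y) - (b / y + - a / (1 - x))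
     else if i = 8 then a / x
     else b / y)"

lemma Vmap_has_logderiv:
  assumes P: "P ` {0..1} \<subseteq> V" and t: "t \<in> {0..1}" and i: "i \<in> {1..9}"
    and x: "\<And>t. t \<in> {0..1} \<Longrightarrow> ((\<lambda>t. fst (P t)) has_vector_derivative fst (P' t)) (at t within {0..1})"
    and y: "\<And>t. t \<in> {0..1} \<Longrightarrow> ((\<lambda>t. snd (P t)) has_vector_derivative snd (P' t)) (at t within {0..1})"
  shows "has_logderiv (\<lambda>t. Vmap i (P t)) (Vlogderiv (P t) (P' t) i) t"
proof -
  let ?x = "\<lambda>t. fst (P t)" and ?y = "\<lambda>t. snd (P t)"
  let ?a = "fst (P' t)" and ?b = "snd (P' t)"
  have "P t \<in> V" using P t by blast
  then have nz: "?x t \<noteq> 0" "?y t \<noteq> 0" "1 - ?x t \<noteq> 0" "1 - ?y t \<noteq> 0" "?x t - 1 \<noteq> 0"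
    by (auto simp: V_def)
  have lx: "has_logderiv ?x (?a / ?x t) t" by (rule has_logderivI[OF x[OF t] nz(1) refl])
  have ly: "has_logderiv ?y (?b / ?y t) t" by (rule has_logderivI[OF y[OF t] nz(2) refl])
  have lA: "has_logderiv (\<lambda>t. 1 - ?x t) (- ?a / (1 - ?x t)) t"
    by (rule has_logderivI[OF has_vector_derivative_diff[OF has_vector_derivative_const x[OF t]] nz(3)]) simp
  have lB: "has_logderiv (\<lambda>t. 1 - ?y t) (- ?b / (1 - ?y t)) t"
    by (rule has_logderivI[OF has_vector_derivative_diff[OF has_vector_derivative_const y[OF t]] nz(4)]) simp
  have "- ?a / (1 - ?x t) = (?a - 0) / (?x t - 1)" by (metis diff_0_right minus_diff_eq minus_divide_divide)
  then have lA': "has_logderiv (\<lambda>t. ?x t - 1) (- ?a / (1 - ?x t)) t"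
    by (rule has_logderivI[OF has_vector_derivative_diff[OF x[OF t] has_vector_derivative_const] nz(5)])
  note rules = has_logderiv_mult has_logderiv_divide has_logderiv_power2 lx ly lA lB lA'
  have 5: "has_logderiv (\<lambda>t. ?x t * (1 - ?y t) / (?x t - 1)) (?a / ?x t + - ?b / (1 - ?y t) - - ?a / (1 - ?x t)) t"
    by (intro rules) (use nz in simp)
  have 7: "has_logderiv (\<lambda>t. (1 - ?y t) / (?y t * (?x t - 1))) (- ?b / (1 - ?y t) - (?b / ?y t + - ?a / (1 - ?x t))) t"
    by (intro rules) (use nz in simp)
  have 1: "has_logderiv (\<lambda>t. ?x t * (1 - ?y t)\<^sup>2 / (?y t * (1 - ?x t)\<^sup>2))
     (?a / ?x t + 2 * (- ?b / (1 - ?y t)) - (?b / ?y t + 2 * (- ?a / (1 - ?x t)))) t"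
    by (intro rules) (use nz in simp)
  have 2: "has_logderiv (\<lambda>t. ?x t * ?y t) (?a / ?x t + ?b / ?y t) t" by (intro rules)
  have 3: "has_logderiv (\<lambda>t. ?x t / ?y t) (?a / ?x t - ?b / ?y t) t" by (intro rules) (use nz in simp)
  have 4: "has_logderiv (\<lambda>t. ?x t * (1 - ?y t) / (?y t * (1 - ?x t)))
     (?a / ?x t + - ?b / (1 - ?y t) - (?b / ?y t + - ?a / (1 - ?x t))) t" by (intro rules) (use nz in simp)
  have 6: "has_logderiv (\<lambda>t. (1 - ?y t) / (1 - ?x t)) (- ?b / (1 - ?y t) - - ?a / (1 - ?x t)) t"
    by (intro rules) (use nz in simp)
  have "i = 1 \<or> i = 2 \<or> i = 3 \<or> i = 4 \<or> i = 5 \<or> i = 6 \<or> i = 7 \<or> i = 8 \<or> i = 9" using i by auto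
  then show ?thesis
    unfolding Vlogderiv_def Vmap_def case_prod_unfold
    by (elim disjE; simp only: 1 2 3 4 5 6 7 lx ly if_True if_False numeral_eq_iff one_eq_numeral_iff numeral_eq_one_iff num.distinct num.inject refl simp_thms)
qed

text \<open>
  The derivative of \<open>log (1 - f\<^sub>i)\<close>, read off from the factorisations.
\<close>

definition Vlogderiv_one_minus :: "complex \<times> complex \<Rightarrow> complex \<times> complex \<Rightarrow> nat \<Rightarrow> complex" where
  "Vlogderiv_one_minus = (\<lambda>(x, y) (a, b) i.
     let A = - a / (1 - x); B = - b / (1 - y); C = - (a * y + x * b) / (1 - x * y); E = (b - a) / (y - x) in
     if i = 1 then E + C - (b / y + 2 * A)
     else if i = 2 then C
     else if i = 3 then E - b / y
     else if i = 4 then E - (b / y + A)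
     else if i = 5 then C - A
     else if i = 6 then E - A
     else if i = 7 then C - (b / y + A)
     else if i = 8 then A
     else B)"

lemma Vlogderiv_one_minus_simps:
  "Vlogderiv_one_minus (x, y) (a, b) 1 =
     (b - a) / (y - x) + - (a * y + x * b) / (1 - x * y) - (b / y + 2 * (- a / (1 - x)))"
  "Vlogderiv_one_minus (x, y) (a, b) 2 = - (a * y + x * b) / (1 - x * y)"
  "Vlogderiv_one_minus (x, y) (a, b) 3 = (b - a) / (y - x) - b / y"
  "Vlogderiv_one_minus (x, y) (a, b) 4 = (b - a) / (y - x) - (b / y + - a / (1 - x))"
  "Vlogderiv_one_minus (x, y) (a, b) 5 = - (a * y + x * b) / (1 - x * y) - - a / (1 - x)"
  "Vlogderiv_one_minus (x, y) (a, b) 6 = (b - a) / (y - x) - - a / (1 - x)"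
  "Vlogderiv_one_minus (x, y) (a, b) 7 = - (a * y + x * b) / (1 - x * y) - (b / y + - a / (1 - x))"
  "Vlogderiv_one_minus (x, y) (a, b) 8 = - a / (1 - x)"
  "Vlogderiv_one_minus (x, y) (a, b) 9 = - b / (1 - y)"
  by (simp_all add: Vlogderiv_one_minus_def Let_def)

lemma one_minus_Vmap_has_logderiv:
  assumes P: "P ` {0..1} \<subseteq> V" and t: "t \<in> {0..1}" and i: "i \<in> {1..9}"
    and x: "\<And>t. t \<in> {0..1} \<Longrightarrow> ((\<lambda>t. fst (P t)) has_vector_derivative fst (P' t)) (at t within {0..1})"
    and y: "\<And>t. t \<in> {0..1} \<Longrightarrow> ((\<lambda>t. snd (P t)) has_vector_derivative snd (P' t)) (at t within {0..1})"
  shows "has_logderiv (\<lambda>t. 1 - Vmap i (P t)) (Vlogderiv_one_minus (P t) (P' t) i) t"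
proof -
  let ?x = "\<lambda>t. fst (P t)" and ?y = "\<lambda>t. snd (P t)"
  let ?a = "fst (P' t)" and ?b = "snd (P' t)"
  have PV: "(?x t, ?y t) \<in> V" if "t \<in> {0..1}" for t using P that by auto
  have gen: "x \<noteq> 0 \<and> y \<noteq> 0 \<and> 1 - x \<noteq> 0 \<and> 1 - y \<noteq> 0 \<and> 1 - x * y \<noteq> 0 \<and> y - x \<noteq> 0" if "(x, y) \<in> V" for x y
    using that by (auto simp: V_def)
  have nz: "?x t \<noteq> 0" "?y t \<noteq> 0" "1 - ?x t \<noteq> 0" "1 - ?y t \<noteq> 0" "1 - ?x t * ?y t \<noteq> 0" "?y t - ?x t \<noteq> 0"
    using gen[OF PV[OF t]] by blast+
  have ly: "has_logderiv ?y (?b / ?y t) t" by (rule has_logderivI[OF y[OF t] nz(2) refl])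
  have lA: "has_logderiv (\<lambda>t. 1 - ?x t) (- ?a / (1 - ?x t)) t"
    by (rule has_logderivI[OF has_vector_derivative_diff[OF has_vector_derivative_const x[OF t]] nz(3)]) simp
  have lB: "has_logderiv (\<lambda>t. 1 - ?y t) (- ?b / (1 - ?y t)) t"
    by (rule has_logderivI[OF has_vector_derivative_diff[OF has_vector_derivative_const y[OF t]] nz(4)]) simp
  have lC: "has_logderiv (\<lambda>t. 1 - ?x t * ?y t) (- (?a * ?y t + ?x t * ?b) / (1 - ?x t * ?y t)) t"
    by (rule has_logderivI[OF has_vector_derivative_diff[OF has_vector_derivative_const has_vector_derivative_mult[OF x[OF t] y[OF t]]] nz(5)])
       (simp add: add.commute)
  have lE: "has_logderiv (\<lambda>t. ?y t - ?x t) ((?b - ?a) / (?y t - ?x t)) t"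
    by (rule has_logderivI[OF has_vector_derivative_diff[OF y[OF t] x[OF t]] nz(6) refl])
  note rules = has_logderiv_mult has_logderiv_divide has_logderiv_power2 ly lA lB lC lE
  note cong = has_logderiv_cong[OF _ t]
  have e: "1 - Vmap i (P s) = 1 - Vmap i (?x s, ?y s)" for s i by simp
  have "i = 1 \<or> i = 2 \<or> i = 3 \<or> i = 4 \<or> i = 5 \<or> i = 6 \<or> i = 7 \<or> i = 8 \<or> i = 9" using i by auto
  then show ?thesis
  proof (elim disjE)
    assume i: "i = 1"
    have "has_logderiv (\<lambda>t. (?y t - ?x t) * (1 - ?x t * ?y t) / (?y t * (1 - ?x t)\<^sup>2)) (Vlogderiv_one_minus (?x t, ?y t) (?a, ?b) 1) t"
      unfolding Vlogderiv_one_minus_simps by (intro rules) (use nz in simp)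
    from cong[OF this] show ?thesis unfolding i e using one_minus_Vmap(1)[OF PV] by (simp only: prod.collapse)
  next
    assume i: "i = 2"
    have "has_logderiv (\<lambda>t. 1 - ?x t * ?y t) (Vlogderiv_one_minus (?x t, ?y t) (?a, ?b) 2) t"
      using lC unfolding Vlogderiv_one_minus_simps .
    from cong[OF this] show ?thesis unfolding i e using one_minus_Vmap(2)[OF PV] by (simp only: prod.collapse)
  next
    assume i: "i = 3"
    have "has_logderiv (\<lambda>t. (?y t - ?x t) / ?y t) ((?b - ?a) / (?y t - ?x t) - ?b / ?y t) t"
      by (intro rules) (use nz in simp)
    then have "has_logderiv (\<lambda>t. (?y t - ?x t) / ?y t) (Vlogderiv_one_minus (?x t, ?y t) (?a, ?b) 3) t"
      unfolding Vlogderiv_one_minus_simps .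
    from cong[OF this] show ?thesis unfolding i e using one_minus_Vmap(3)[OF PV] by (simp only: prod.collapse)
  next
    assume i: "i = 4"
    have "has_logderiv (\<lambda>t. (?y t - ?x t) / (?y t * (1 - ?x t))) ((?b - ?a) / (?y t - ?x t) - (?b / ?y t + - ?a / (1 - ?x t))) t"
      by (intro rules) (use nz in simp)
    then have "has_logderiv (\<lambda>t. (?y t - ?x t) / (?y t * (1 - ?x t))) (Vlogderiv_one_minus (?x t, ?y t) (?a, ?b) 4) t"
      unfolding Vlogderiv_one_minus_simps .
    from cong[OF this] show ?thesis unfolding i e using one_minus_Vmap(4)[OF PV] by (simp only: prod.collapse)
  next
    assume i: "i = 5"
    have "has_logderiv (\<lambda>t. (1 - ?x t * ?y t) / (1 - ?x t)) (- (?a * ?y t + ?x t * ?b) / (1 - ?x t * ?y t) - - ?a / (1 - ?x t)) t"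
      by (intro rules) (use nz in simp)
    then have "has_logderiv (\<lambda>t. (1 - ?x t * ?y t) / (1 - ?x t)) (Vlogderiv_one_minus (?x t, ?y t) (?a, ?b) 5) t"
      unfolding Vlogderiv_one_minus_simps .
    from cong[OF this] show ?thesis unfolding i e using one_minus_Vmap(5)[OF PV] by (simp only: prod.collapse)
  next
    assume i: "i = 6"
    have "has_logderiv (\<lambda>t. (?y t - ?x t) / (1 - ?x t)) ((?b - ?a) / (?y t - ?x t) - - ?a / (1 - ?x t)) t"
      by (intro rules) (use nz in simp)
    then have "has_logderiv (\<lambda>t. (?y t - ?x t) / (1 - ?x t)) (Vlogderiv_one_minus (?x t, ?y t) (?a, ?b) 6) t"
      unfolding Vlogderiv_one_minus_simps .
    from cong[OF this] show ?thesis unfolding i e using one_minus_Vmap(6)[OF PV] by (simp only: prod.collapse)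
  next
    assume i: "i = 7"
    have "has_logderiv (\<lambda>t. (1 - ?x t * ?y t) / (?y t * (1 - ?x t))) (- (?a * ?y t + ?x t * ?b) / (1 - ?x t * ?y t) - (?b / ?y t + - ?a / (1 - ?x t))) t"
      by (intro rules) (use nz in simp)
    then have "has_logderiv (\<lambda>t. (1 - ?x t * ?y t) / (?y t * (1 - ?x t))) (Vlogderiv_one_minus (?x t, ?y t) (?a, ?b) 7) t"
      unfolding Vlogderiv_one_minus_simps .
    from cong[OF this] show ?thesis unfolding i e using one_minus_Vmap(7)[OF PV] by (simp only: prod.collapse)
  next
    assume i: "i = 8"
    have "has_logderiv (\<lambda>t. 1 - ?x t) (Vlogderiv_one_minus (?x t, ?y t) (?a, ?b) 8) t"
      using lA unfolding Vlogderiv_one_minus_simps .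
    from cong[OF this] show ?thesis unfolding i e using one_minus_Vmap(8)[OF PV] by (simp only: prod.collapse)
  next
    assume i: "i = 9"
    have "has_logderiv (\<lambda>t. 1 - ?y t) (Vlogderiv_one_minus (?x t, ?y t) (?a, ?b) 9) t"
      using lB unfolding Vlogderiv_one_minus_simps .
    from cong[OF this] show ?thesis unfolding i e using one_minus_Vmap(9)[OF PV] by (simp only: prod.collapse)
  qed
qed

lemma Vlogderiv_simps:
  "Vlogderiv (x, y) (a, b) 1 = a / x + 2 * (- b / (1 - y)) - (b / y + 2 * (- a / (1 - x)))"
  "Vlogderiv (x, y) (a, b) 2 = a / x + b / y"
  "Vlogderiv (x, y) (a, b) 3 = a / x - b / y"
  "Vlogderiv (x, y) (a, b) 4 = a / x + - b / (1 - y) - (b / y + - a / (1 - x))"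
  "Vlogderiv (x, y) (a, b) 5 = a / x + - b / (1 - y) - - a / (1 - x)"
  "Vlogderiv (x, y) (a, b) 6 = - b / (1 - y) - - a / (1 - x)"
  "Vlogderiv (x, y) (a, b) 7 = - b / (1 - y) - (b / y + - a / (1 - x))"
  "Vlogderiv (x, y) (a, b) 8 = a / x"
  "Vlogderiv (x, y) (a, b) 9 = b / y"
  by (simp_all add: Vlogderiv_def)

text \<open>
  On the tangential curve all factors are positive reals, so the principal logarithm of \<open>1 - f\<^sub>i\<close> is the combination of the
  real logarithms of the factors. This is the consistency of branches at the start of the path.
\<close>

lemma ln_one_minus_vcurve:
  assumes v: "0 < v" "v < 1 / 10"
  defines "A \<equiv> ln (1 - v\<^sup>2)" and "B \<equiv> ln (1 - v)" and "C \<equiv> ln (1 - v\<^sup>2 * v)" and "E \<equiv> ln (v - v\<^sup>2)"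
  shows "Ln (1 - vcurve 1 (vparam 1 v)) = of_real (E + C - (ln v + 2 * A))"
    "Ln (1 - vcurve 2 (vparam 2 v)) = of_real C"
    "Ln (1 - vcurve 3 (vparam 3 v)) = of_real (E - ln v)"
    "Ln (1 - vcurve 4 (vparam 4 v)) = of_real (E - (ln v + A))"
    "Ln (1 - vcurve 5 (vparam 5 v)) = of_real (C - A)"
    "Ln (1 - vcurve 6 (vparam 6 v)) = of_real (E - A)"
    "Ln (1 - vcurve 7 (vparam 7 v)) = of_real (C - (ln v + A))"
    "Ln (1 - vcurve 8 (vparam 8 v)) = of_real A"
    "Ln (1 - vcurve 9 (vparam 9 v)) = of_real B"
proof -
  have v1: "v < 1" using v by simp
  have sq: "v\<^sup>2 < v" using v by (simp add: power2_eq_square)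
  have "v\<^sup>2 * v < 1 * 1" using v sq by (intro mult_strict_mono) auto
  then have pos: "0 < v - v\<^sup>2" "0 < 1 - v\<^sup>2 * v" "0 < 1 - v\<^sup>2" "0 < 1 - v" using sq v by auto
  let ?x = "complex_of_real (v\<^sup>2)" and ?y = "complex_of_real v"
  have "v\<^sup>2 * v * (1 - v\<^sup>2) * (1 - v) * (v\<^sup>2 - v) * (1 - v\<^sup>2 * v) \<noteq> 0"
    using pos v by auto
  then have "complex_of_real (v\<^sup>2 * v * (1 - v\<^sup>2) * (1 - v) * (v\<^sup>2 - v) * (1 - v\<^sup>2 * v)) \<noteq> 0"
    unfolding of_real_eq_0_iff .
  then have xyV: "(?x, ?y) \<in> V" by (simp add: V_def)
  note om = one_minus_Vmap[OF xyV, unfolded Vmap_curve[OF v(1) v1]]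
  have Ln: "Ln z = of_real (ln r)" if "z = of_real r" "0 < r" for z r
    using Ln_of_real[OF that(2)] that(1) by simp
  have r: "?y - ?x = of_real (v - v\<^sup>2)" "1 - ?x * ?y = of_real (1 - v\<^sup>2 * v)" "1 - ?x = of_real (1 - v\<^sup>2)"
    "1 - ?y = of_real (1 - v)"
    by simp_all
  note om' = om[unfolded r, unfolded of_real_mult[symmetric] of_real_power[symmetric] of_real_divide[symmetric]]
  have "ln ((v - v\<^sup>2) * (1 - v\<^sup>2 * v) / (v * (1 - v\<^sup>2)\<^sup>2)) = E + C - (ln v + 2 * A)"
    using pos v(1) by (simp add: ln_div ln_mult ln_realpow E_def C_def A_def)
  then show "Ln (1 - vcurve 1 (vparam 1 v)) = of_real (E + C - (ln v + 2 * A))"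
    using Ln[OF om'(1)] pos v(1) by simp
  show "Ln (1 - vcurve 2 (vparam 2 v)) = of_real C" using Ln[OF om'(2)] pos by (simp only: C_def)
  have "ln ((v - v\<^sup>2) / v) = E - ln v" using pos v(1) by (simp add: ln_div E_def)
  then show "Ln (1 - vcurve 3 (vparam 3 v)) = of_real (E - ln v)" using Ln[OF om'(3)] pos v(1) by simp
  have "ln ((v - v\<^sup>2) / (v * (1 - v\<^sup>2))) = E - (ln v + A)" using pos v(1) by (simp add: ln_div ln_mult E_def A_def)
  then show "Ln (1 - vcurve 4 (vparam 4 v)) = of_real (E - (ln v + A))" using Ln[OF om'(4)] pos v(1) by simp
  have "ln ((1 - v\<^sup>2 * v) / (1 - v\<^sup>2)) = C - A" using pos by (simp add: ln_div C_def A_def)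
  then show "Ln (1 - vcurve 5 (vparam 5 v)) = of_real (C - A)" using Ln[OF om'(5)] pos by simp
  have "ln ((v - v\<^sup>2) / (1 - v\<^sup>2)) = E - A" using pos by (simp add: ln_div E_def A_def)
  then show "Ln (1 - vcurve 6 (vparam 6 v)) = of_real (E - A)" using Ln[OF om'(6)] pos by simp
  have "ln ((1 - v\<^sup>2 * v) / (v * (1 - v\<^sup>2))) = C - (ln v + A)" using pos v(1) by (simp add: ln_div ln_mult C_def A_def)
  then show "Ln (1 - vcurve 7 (vparam 7 v)) = of_real (C - (ln v + A))" using Ln[OF om'(7)] pos v(1) by simp
  show "Ln (1 - vcurve 8 (vparam 8 v)) = of_real A" using Ln[OF om'(8)] pos by (simp only: A_def)
  show "Ln (1 - vcurve 9 (vparam 9 v)) = of_real B" using Ln[OF om'(9)] pos by (simp only: B_def)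
qed

section \<open>The functional equations\<close>

text \<open>
  Let \<open>\<beta>\<close>, \<open>A\<close>, \<open>B\<close>, \<open>C\<close>, \<open>E\<close> be the logarithms of \<open>y\<close>, \<open>1 - x\<close>, \<open>1 - y\<close>, \<open>1 - x y\<close>, \<open>y - x\<close> along \<open>P\<close>, real at the
  start. Then \<open>L i\<close> is the logarithm of \<open>1 - f\<^sub>i\<close>, and \<open>G i\<close> with derivative \<open>- L i * \<eta> i\<close> computes \<open>Li2 (f\<^sub>i)\<close>. In each of the
  three combinations the derivatives cancel identically. The right-hand sides are the values at the start of \<open>P\<close>.
\<close>

lemma equations_at_parameter:
  fixes \<gamma>0 :: "(real \<Rightarrow> complex \<times> complex) set" and v :: real and w :: "complex \<times> complex"
  defines "D \<equiv> \<lambda>i. dilog (vcurve i (vparam i v))"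
    and "I \<equiv> \<lambda>i. Li2 (Vmap i w) (path_system w \<gamma>0 i)"
    and "l \<equiv> \<lambda>i. log_along (Vmap i w) (path_system w \<gamma>0 i)"
  assumes w: "w \<in> V" and \<gamma>: "\<gamma>0 \<in> pi1 V tbv (Pt w)" and v: "0 < v" "v < 1 / 10"
    and pol: "polynomial_function P"
    and P: "P 0 = (of_real (v\<^sup>2), of_real v)" "curve_then v P \<in> \<gamma>0" "P ` {0..1} \<subseteq> V"
  shows "I 4 - I 9 + I 8 - I 3 - I 6 - l 9 * l 6
       = D 4 - D 9 + D 8 - D 3 - D 6 - of_real (ln v * (ln (1 - v) - ln (1 - v\<^sup>2)))"
    "I 1 - I 5 - I 7 - I 4 - I 6 - 1 / 2 * (l 9 * l 9)
       = D 1 - D 5 - D 7 - D 4 - D 6 - of_real ((ln v)\<^sup>2 / 2)"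
    "I 7 + I 2 - I 8 - I 9 - I 5 - l 9 * l 6 + 1 / 2 * (l 9 * l 9)
       = D 7 + D 2 - D 8 - D 9 - D 5 - of_real (ln v * (ln (1 - v) - ln (1 - v\<^sup>2))) + of_real ((ln v)\<^sup>2 / 2)"
proof -
  obtain P' where P': "polynomial_function P'" "\<And>t. (P has_vector_derivative P' t) (at t)"
    using has_vector_derivative_polynomial_function[OF pol] by blast
  have cP: "continuous_on {0..1} P" "continuous_on {0..1} P'"
    by (rule continuous_on_polymonial_function[OF pol] continuous_on_polymonial_function[OF P'(1)])+
  have dx: "((\<lambda>t. fst (P t)) has_vector_derivative fst (P' t)) (at t within {0..1})" for t
    by (rule has_vector_derivative_at_within[OF bounded_linear.has_vector_derivative[OF bounded_linear_fst P'(2)]])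
  have dy: "((\<lambda>t. snd (P t)) has_vector_derivative snd (P' t)) (at t within {0..1})" for t
    by (rule has_vector_derivative_at_within[OF bounded_linear.has_vector_derivative[OF bounded_linear_snd P'(2)]])
  define x y a b where "x = (\<lambda>t. fst (P t))" "y = (\<lambda>t. snd (P t))" "a = (\<lambda>t. fst (P' t))" "b = (\<lambda>t. snd (P' t))"
  note xyab = x_y_a_b_def
  have PP: "P t = (x t, y t)" "P' t = (a t, b t)" for t by (simp_all add: xyab)
  have gen: "x \<noteq> 0 \<and> y \<noteq> 0 \<and> 1 - x \<noteq> 0 \<and> 1 - y \<noteq> 0 \<and> 1 - x * y \<noteq> 0 \<and> y - x \<noteq> 0" if "(x, y) \<in> V" for x y
    using that by (auto simp: V_def)
  have V: "(x t, y t) \<in> V" if "t \<in> {0..1}" for t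
    unfolding PP(1)[symmetric] using P(3) that by blast
  have nz: "\<forall>t\<in>{0..1}. x t \<noteq> 0" "\<forall>t\<in>{0..1}. y t \<noteq> 0" "\<forall>t\<in>{0..1}. 1 - x t \<noteq> 0"
    "\<forall>t\<in>{0..1}. 1 - y t \<noteq> 0" "\<forall>t\<in>{0..1}. 1 - x t * y t \<noteq> 0" "\<forall>t\<in>{0..1}. y t - x t \<noteq> 0"
    by (intro ballI; drule V; drule gen; elim conjE; assumption)+
  have c: "continuous_on {0..1} x" "continuous_on {0..1} y" "continuous_on {0..1} a" "continuous_on {0..1} b"
    unfolding xyab by (intro continuous_on_fst continuous_on_snd cP)+
  \<comment> \<open>The derivatives of the logarithms of \<open>x\<close>, \<open>y\<close>, \<open>1 - x\<close>, \<open>1 - y\<close> and then of \<open>1 - x y\<close>, \<open>y - x\<close>.\<close>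
  define p q r s where "p = (\<lambda>t. a t / x t)" "q = (\<lambda>t. b t / y t)" "r = (\<lambda>t. - a t / (1 - x t))" "s = (\<lambda>t. - b t / (1 - y t))"
  note pqrs = p_q_r_s_def
  define k e where "k = (\<lambda>t. - (a t * y t + x t * b t) / (1 - x t * y t))" "e = (\<lambda>t. (b t - a t) / (y t - x t))"
  note ke = k_e_def
  have cc: "continuous_on {0..1} p" "continuous_on {0..1} q" "continuous_on {0..1} r" "continuous_on {0..1} s"
    "continuous_on {0..1} k" "continuous_on {0..1} e"
    unfolding pqrs ke by (intro continuous_intros c nz)+
  obtain \<beta> where \<beta>: "\<beta> 0 = of_real (ln v)" "\<And>t. t \<in> {0..1} \<Longrightarrow> (\<beta> has_vector_derivative q t) (at t within {0..1})"
    using ex_antiderivative[OF cc(2), of "of_real (ln v)"] by blast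
  obtain A where A: "A 0 = of_real (ln (1 - v\<^sup>2))" "\<And>t. t \<in> {0..1} \<Longrightarrow> (A has_vector_derivative r t) (at t within {0..1})"
    using ex_antiderivative[OF cc(3), of "of_real (ln (1 - v\<^sup>2))"] by blast
  obtain B where B: "B 0 = of_real (ln (1 - v))" "\<And>t. t \<in> {0..1} \<Longrightarrow> (B has_vector_derivative s t) (at t within {0..1})"
    using ex_antiderivative[OF cc(4), of "of_real (ln (1 - v))"] by blast
  obtain C where C: "C 0 = of_real (ln (1 - v\<^sup>2 * v))" "\<And>t. t \<in> {0..1} \<Longrightarrow> (C has_vector_derivative k t) (at t within {0..1})"
    using ex_antiderivative[OF cc(5), of "of_real (ln (1 - v\<^sup>2 * v))"] by blast
  obtain E where E: "E 0 = of_real (ln (v - v\<^sup>2))" "\<And>t. t \<in> {0..1} \<Longrightarrow> (E has_vector_derivative e t) (at t within {0..1})"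
    using ex_antiderivative[OF cc(6), of "of_real (ln (v - v\<^sup>2))"] by blast
  define \<eta> where "\<eta> = (\<lambda>i t. Vlogderiv (P t) (P' t) i)"
  have \<eta>: "\<eta> 1 = (\<lambda>t. p t + 2 * s t - (q t + 2 * r t))" "\<eta> 2 = (\<lambda>t. p t + q t)" "\<eta> 3 = (\<lambda>t. p t - q t)"
    "\<eta> 4 = (\<lambda>t. p t + s t - (q t + r t))" "\<eta> 5 = (\<lambda>t. p t + s t - r t)" "\<eta> 6 = (\<lambda>t. s t - r t)"
    "\<eta> 7 = (\<lambda>t. s t - (q t + r t))" "\<eta> 8 = p" "\<eta> 9 = q"
    unfolding \<eta>_def PP Vlogderiv_simps pqrs by (rule refl)+
  define \<theta> where "\<theta> = (\<lambda>i t. Vlogderiv_one_minus (P t) (P' t) i)"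
  have \<theta>: "\<theta> 1 = (\<lambda>t. e t + k t - (q t + 2 * r t))" "\<theta> 2 = k" "\<theta> 3 = (\<lambda>t. e t - q t)"
    "\<theta> 4 = (\<lambda>t. e t - (q t + r t))" "\<theta> 5 = (\<lambda>t. k t - r t)" "\<theta> 6 = (\<lambda>t. e t - r t)"
    "\<theta> 7 = (\<lambda>t. k t - (q t + r t))" "\<theta> 8 = r" "\<theta> 9 = s"
    unfolding \<theta>_def PP Vlogderiv_one_minus_simps pqrs ke by (rule refl)+
  define L where "L = (\<lambda>i::nat. if i = 1 then (\<lambda>t. E t + C t - (\<beta> t + 2 * A t)) else if i = 2 then C
     else if i = 3 then (\<lambda>t. E t - \<beta> t) else if i = 4 then (\<lambda>t. E t - (\<beta> t + A t)) else if i = 5 then (\<lambda>t. C t - A t)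
     else if i = 6 then (\<lambda>t. E t - A t) else if i = 7 then (\<lambda>t. C t - (\<beta> t + A t)) else if i = 8 then A else B)"
  have L: "L 1 = (\<lambda>t. E t + C t - (\<beta> t + 2 * A t))" "L 2 = C" "L 3 = (\<lambda>t. E t - \<beta> t)" "L 4 = (\<lambda>t. E t - (\<beta> t + A t))"
    "L 5 = (\<lambda>t. C t - A t)" "L 6 = (\<lambda>t. E t - A t)" "L 7 = (\<lambda>t. C t - (\<beta> t + A t))" "L 8 = A" "L 9 = B"
    by (simp_all add: L_def)
  have cases9: "Q i" if "Q 1" "Q 2" "Q 3" "Q 4" "Q 5" "Q 6" "Q 7" "Q 8" "Q 9" "i \<in> {1..9}" for Q :: "nat \<Rightarrow> bool" and i
  proof -
    have "i = 1 \<or> i = 2 \<or> i = 3 \<or> i = 4 \<or> i = 5 \<or> i = 6 \<or> i = 7 \<or> i = 8 \<or> i = 9" using that(10) by auto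
    then show ?thesis using that(1-9) by (elim disjE) simp_all
  qed
  have L0: "L i 0 = Ln (1 - vcurve i (vparam i v))" if "i \<in> {1..9}" for i
    by (rule cases9[where Q = "\<lambda>i. L i 0 = Ln (1 - vcurve i (vparam i v))", OF _ _ _ _ _ _ _ _ _ that])
       (simp_all only: L \<beta>(1) A(1) B(1) C(1) E(1) ln_one_minus_vcurve[OF v] of_real_add of_real_diff of_real_mult of_real_numeral)
  have dL: "(L i has_vector_derivative \<theta> i t) (at t within {0..1})" if "i \<in> {1..9}" and t: "t \<in> {0..1}" for i t
    by (rule cases9[where Q = "\<lambda>i. (L i has_vector_derivative \<theta> i t) (at t within {0..1})", OF _ _ _ _ _ _ _ _ _ that(1)]; unfold L \<theta>;
        intro has_vector_derivative_add has_vector_derivative_diff has_vector_derivative_mult_right \<beta>(2) A(2) B(2) C(2) E(2) t)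
  have c\<eta>: "continuous_on {0..1} (\<eta> i)" if "i \<in> {1..9}" for i
    by (rule cases9[where Q = "\<lambda>i. continuous_on {0..1} (\<eta> i)", OF _ _ _ _ _ _ _ _ _ that]; unfold \<eta>; intro continuous_intros cc)
  have cL: "continuous_on {0..1} (L i)" if "i \<in> {1..9}" for i
    unfolding continuous_on_eq_continuous_within by (intro ballI has_vector_derivative_continuous[OF dL[OF that]])
  have "\<forall>i\<in>{1..9}. \<exists>g. g 0 = D i \<and> (\<forall>t\<in>{0..1}. (g has_vector_derivative - (L i t * \<eta> i t)) (at t within {0..1}))"
    by (intro ballI ex_antiderivative continuous_on_minus continuous_on_mult cL c\<eta>)
  then obtain G where G: "\<And>i. i \<in> {1..9} \<Longrightarrow> G i 0 = D i"
    "\<And>i t. i \<in> {1..9} \<Longrightarrow> t \<in> {0..1} \<Longrightarrow> (G i has_vector_derivative - (L i t * \<eta> i t)) (at t within {0..1})"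
    unfolding bchoice_iff by blast
  have \<eta>l: "has_logderiv (\<lambda>t. Vmap i (P t)) (\<eta> i t) t" if "i \<in> {1..9}" "t \<in> {0..1}" for i t
    unfolding \<eta>_def by (rule Vmap_has_logderiv[OF P(3) that(2,1) dx dy])
  have IG: "I i = G i 1" if i: "i \<in> {1..9}" for i
    unfolding I_def
  proof (rule Li2_path_system_logderiv[where P = P and \<eta> = "\<eta> i" and \<theta> = "\<theta> i" and L = "L i" and G = "G i", OF w \<gamma> v P c\<eta>[OF i]])
    show "has_logderiv (\<lambda>t. 1 - Vmap i (P t)) (\<theta> i t) t" if "t \<in> {0..1}" for t
      unfolding \<theta>_def by (rule one_minus_Vmap_has_logderiv[OF P(3) that i dx dy])
    show "G i 0 = dilog (vcurve i (vparam i v))" using G(1)[OF i] by (simp only: D_def)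
  qed (rule \<eta>l[OF i] L0[OF i] dL[OF i] G(2)[OF i]; assumption)+
  have l9: "l 9 = \<beta> 1"
    unfolding l_def
  proof (rule log_path_system_logderiv[where P = P and c = v and \<eta> = "\<eta> 9", OF w \<gamma> v P])
    show "vcurve 9 (vparam 9 v) = of_real v" by (simp add: vcurve_def vparam_def)
    show "continuous_on {0..1} (\<eta> 9)" by (rule c\<eta>) simp
    show "has_logderiv (\<lambda>t. Vmap 9 (P t)) (\<eta> 9 t) t" if "t \<in> {0..1}" for t by (rule \<eta>l[OF _ that]) simp
    show "\<beta> 0 = of_real (ln v)" by (rule \<beta>(1))
    show "(\<beta> has_vector_derivative \<eta> 9 t) (at t within {0..1})" if "t \<in> {0..1}" for t
      unfolding \<eta> by (rule \<beta>(2)[OF that])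
  qed (use v in simp_all)
  have l6: "l 6 = B 1 - A 1"
    unfolding l_def
  proof (rule log_path_system_logderiv[where P = P and c = "1 - v / (1 + v)" and \<eta> = "\<eta> 6" and L = "\<lambda>t. B t - A t", OF w \<gamma> v P])
    show "vcurve 6 (vparam 6 v) = of_real (1 - v / (1 + v))" by (simp add: vcurve_def vparam_def)
    show "0 < 1 - v / (1 + v)" "1 - v / (1 + v) < 1" using v by simp_all
    show "continuous_on {0..1} (\<eta> 6)" by (rule c\<eta>) simp
    show "has_logderiv (\<lambda>t. Vmap 6 (P t)) (\<eta> 6 t) t" if "t \<in> {0..1}" for t by (rule \<eta>l[OF _ that]) simp
    have "1 - v\<^sup>2 = (1 - v) * (1 + v)" by (simp add: power2_eq_square algebra_simps)
    then have "ln (1 - v\<^sup>2) = ln (1 - v) + ln (1 + v)" using v by (simp add: ln_mult)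
    moreover have "1 - v / (1 + v) = 1 / (1 + v)" using v by (simp add: field_simps)
    then have "ln (1 - v / (1 + v)) = - ln (1 + v)" using v by (simp add: ln_div)
    ultimately show "B 0 - A 0 = of_real (ln (1 - v / (1 + v)))" unfolding B(1) A(1) by simp
    show "((\<lambda>t. B t - A t) has_vector_derivative \<eta> 6 t) (at t within {0..1})" if "t \<in> {0..1}" for t
      unfolding \<eta> by (rule has_vector_derivative_diff[OF B(2)[OF that] A(2)[OF that]])
  qed simp_all
  have n: "1 \<in> {1..9::nat}" "2 \<in> {1..9::nat}" "3 \<in> {1..9::nat}" "4 \<in> {1..9::nat}" "5 \<in> {1..9::nat}"
    "6 \<in> {1..9::nat}" "7 \<in> {1..9::nat}" "8 \<in> {1..9::nat}" "9 \<in> {1..9::nat}" by simp_all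
  note dG = has_vector_derivative_add has_vector_derivative_diff
  have dba: "((\<lambda>t. \<beta> t * (B t - A t)) has_vector_derivative (\<beta> t * (s t - r t) + q t * (B t - A t))) (at t within {0..1})"
    if "t \<in> {0..1}" for t
    by (rule has_vector_derivative_mult[OF \<beta>(2)[OF that] has_vector_derivative_diff[OF B(2)[OF that] A(2)[OF that]]])
  have dbb: "((\<lambda>t. 1 / 2 * (\<beta> t * \<beta> t)) has_vector_derivative 1 / 2 * (\<beta> t * q t + q t * \<beta> t)) (at t within {0..1})"
    if "t \<in> {0..1}" for t
    by (rule has_vector_derivative_mult_right[OF has_vector_derivative_mult[OF \<beta>(2)[OF that] \<beta>(2)[OF that]]])
  have init: "\<beta> 0 * (B 0 - A 0) = of_real (ln v * (ln (1 - v) - ln (1 - v\<^sup>2)))"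
    "1 / 2 * (\<beta> 0 * \<beta> 0) = of_real ((ln v)\<^sup>2 / 2)"
    unfolding \<beta>(1) A(1) B(1) by (simp_all add: power2_eq_square)
  have "G 4 1 - G 9 1 + G 8 1 - G 3 1 - G 6 1 - \<beta> 1 * (B 1 - A 1)
      = G 4 0 - G 9 0 + G 8 0 - G 3 0 - G 6 0 - \<beta> 0 * (B 0 - A 0)"
  proof (rule zero_derivative_imp_eq)
    fix t :: real assume t: "t \<in> {0..1}"
    show "((\<lambda>t. G 4 t - G 9 t + G 8 t - G 3 t - G 6 t - \<beta> t * (B t - A t)) has_vector_derivative
       - (L 4 t * \<eta> 4 t) - - (L 9 t * \<eta> 9 t) + - (L 8 t * \<eta> 8 t) - - (L 3 t * \<eta> 3 t) - - (L 6 t * \<eta> 6 t)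
        - (\<beta> t * (s t - r t) + q t * (B t - A t))) (at t within {0..1})"
      by (intro dG G(2) n t dba)
    show "- (L 4 t * \<eta> 4 t) - - (L 9 t * \<eta> 9 t) + - (L 8 t * \<eta> 8 t) - - (L 3 t * \<eta> 3 t) - - (L 6 t * \<eta> 6 t)
        - (\<beta> t * (s t - r t) + q t * (B t - A t)) = 0"
      unfolding L \<eta> by (simp add: algebra_simps)
  qed
  then show "I 4 - I 9 + I 8 - I 3 - I 6 - l 9 * l 6
       = D 4 - D 9 + D 8 - D 3 - D 6 - of_real (ln v * (ln (1 - v) - ln (1 - v\<^sup>2)))"
    unfolding l9 l6 init by (simp only: IG G(1) n)
  have "G 1 1 - G 5 1 - G 7 1 - G 4 1 - G 6 1 - 1 / 2 * (\<beta> 1 * \<beta> 1)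
      = G 1 0 - G 5 0 - G 7 0 - G 4 0 - G 6 0 - 1 / 2 * (\<beta> 0 * \<beta> 0)"
  proof (rule zero_derivative_imp_eq)
    fix t :: real assume t: "t \<in> {0..1}"
    show "((\<lambda>t. G 1 t - G 5 t - G 7 t - G 4 t - G 6 t - 1 / 2 * (\<beta> t * \<beta> t)) has_vector_derivative
       - (L 1 t * \<eta> 1 t) - - (L 5 t * \<eta> 5 t) - - (L 7 t * \<eta> 7 t) - - (L 4 t * \<eta> 4 t) - - (L 6 t * \<eta> 6 t)
        - 1 / 2 * (\<beta> t * q t + q t * \<beta> t)) (at t within {0..1})"
      by (intro dG G(2) n t dbb)
    show "- (L 1 t * \<eta> 1 t) - - (L 5 t * \<eta> 5 t) - - (L 7 t * \<eta> 7 t) - - (L 4 t * \<eta> 4 t) - - (L 6 t * \<eta> 6 t)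
        - 1 / 2 * (\<beta> t * q t + q t * \<beta> t) = 0"
      unfolding L \<eta> by (simp add: algebra_simps)
  qed
  then show "I 1 - I 5 - I 7 - I 4 - I 6 - 1 / 2 * (l 9 * l 9)
       = D 1 - D 5 - D 7 - D 4 - D 6 - of_real ((ln v)\<^sup>2 / 2)"
    unfolding l9 l6 init by (simp only: IG G(1) n)
  have "G 7 1 + G 2 1 - G 8 1 - G 9 1 - G 5 1 - \<beta> 1 * (B 1 - A 1) + 1 / 2 * (\<beta> 1 * \<beta> 1)
      = G 7 0 + G 2 0 - G 8 0 - G 9 0 - G 5 0 - \<beta> 0 * (B 0 - A 0) + 1 / 2 * (\<beta> 0 * \<beta> 0)"
  proof (rule zero_derivative_imp_eq)
    fix t :: real assume t: "t \<in> {0..1}"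
    show "((\<lambda>t. G 7 t + G 2 t - G 8 t - G 9 t - G 5 t - \<beta> t * (B t - A t) + 1 / 2 * (\<beta> t * \<beta> t)) has_vector_derivative
       - (L 7 t * \<eta> 7 t) + - (L 2 t * \<eta> 2 t) - - (L 8 t * \<eta> 8 t) - - (L 9 t * \<eta> 9 t) - - (L 5 t * \<eta> 5 t)
        - (\<beta> t * (s t - r t) + q t * (B t - A t)) + 1 / 2 * (\<beta> t * q t + q t * \<beta> t)) (at t within {0..1})"
      by (intro dG G(2) n t dba dbb)
    show "- (L 7 t * \<eta> 7 t) + - (L 2 t * \<eta> 2 t) - - (L 8 t * \<eta> 8 t) - - (L 9 t * \<eta> 9 t) - - (L 5 t * \<eta> 5 t)
        - (\<beta> t * (s t - r t) + q t * (B t - A t)) + 1 / 2 * (\<beta> t * q t + q t * \<beta> t) = 0"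
      unfolding L \<eta> by (simp add: algebra_simps)
  qed
  then show "I 7 + I 2 - I 8 - I 9 - I 5 - l 9 * l 6 + 1 / 2 * (l 9 * l 9)
       = D 7 + D 2 - D 8 - D 9 - D 5 - of_real (ln v * (ln (1 - v) - ln (1 - v\<^sup>2))) + of_real ((ln v)\<^sup>2 / 2)"
    unfolding l9 l6 init by (simp only: IG G(1) n)
qed

lemma tendsto_dilog_vcurve:
  assumes "i \<noteq> 6" "i \<noteq> 7"
  shows "((\<lambda>v. dilog (vcurve i (vparam i v))) \<longlongrightarrow> 0) (at_right 0)"
proof (rule tendsto_dilog_0)
  have "((\<lambda>v. vparam i v) \<longlongrightarrow> vparam i 0) (at 0)" using vparam_isCont[of 0 i] by (simp add: isCont_def)
  then have "((\<lambda>v. vparam i v) \<longlongrightarrow> 0) (at_right 0)"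
    unfolding vparam_0 by (rule filterlim_mono) (simp_all add: at_le)
  then have "((\<lambda>v. complex_of_real (vparam i v)) \<longlongrightarrow> of_real 0) (at_right 0)"
    "((\<lambda>v. complex_of_real (- vparam i v)) \<longlongrightarrow> of_real (- 0)) (at_right 0)"
    by (intro tendsto_intros; assumption)+
  then show "((\<lambda>v. vcurve i (vparam i v)) \<longlongrightarrow> 0) (at_right 0)"
    using assms by (cases "i = 5") (simp_all add: vcurve_def)
qed

lemma tendsto_dilog_vcurve_6: "((\<lambda>v. dilog (vcurve 6 (vparam 6 v))) \<longlongrightarrow> of_real pi ^ 2 / 6) (at_right 0)"
proof (rule tendsto_dilog_1)
  have "((\<lambda>v. vparam 6 v) \<longlongrightarrow> vparam 6 0) (at 0)" using vparam_isCont[of 0 6] by (simp add: isCont_def)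
  then have "((\<lambda>v. vparam 6 v) \<longlongrightarrow> 0) (at_right 0)"
    unfolding vparam_0 by (rule filterlim_mono) (simp_all add: at_le)
  then have "((\<lambda>v. complex_of_real (1 - vparam 6 v)) \<longlongrightarrow> of_real (1 - 0)) (at_right 0)"
    by (intro tendsto_intros)
  then show "((\<lambda>v. vcurve 6 (vparam 6 v)) \<longlongrightarrow> 1) (at_right 0)"
    by (simp add: vcurve_def)
  have "norm (vcurve 6 (vparam 6 v)) < 1" if "0 < v" "v < 1 / 10" for v
  proof -
    have "vcurve 6 (vparam 6 v) = of_real (1 - vparam 6 v)" by (simp add: vcurve_def)
    moreover have "\<bar>1 - vparam 6 v\<bar> < 1" using vparam_pos[OF that(1), of 6] vparam_small[OF that, of 6] by simp
    ultimately show ?thesis by (simp only: norm_of_real)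
  qed
  then show "\<forall>\<^sub>F v in at_right 0. norm (vcurve 6 (vparam 6 v)) < 1"
    unfolding eventually_at_right_field by (intro exI[of _ "1 / 10"]) simp
qed

text \<open>
  As \<open>v\<close> tends to \<open>0\<close>, the argument \<open>- 1 / (v (1 + v))\<close> is unbounded; inversion replaces it by one that tends to \<open>0\<close>.
\<close>

lemma dilog_vcurve_7:
  assumes "0 < v"
  shows "dilog (vcurve 7 (vparam 7 v)) =
    - (of_real pi ^ 2 / 6) - dilog (of_real (- (v * (1 + v)))) - of_real ((ln (v * (1 + v)))\<^sup>2 / 2)"
proof -
  have "0 < v * (1 + v)" using assms by simp
  note dilog_inversion[OF this]
  moreover have "vcurve 7 (vparam 7 v) = of_real (- 1 / (v * (1 + v)))" by (simp add: vcurve_def vparam_def)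
  moreover have "a = c - n - s" if "a + n + s = c" for a n s c :: complex
    unfolding that[symmetric] by simp
  ultimately show ?thesis by (simp only:)
qed

text \<open>
  Uses \<open>ln (1 + v) \<le> v\<close> and \<open>- ln v \<le> 2 / sqrt v\<close>.
\<close>

lemma tendsto_ln_mult_ln: "((\<lambda>v::real. ln v * ln (1 + v)) \<longlongrightarrow> 0) (at_right 0)"
proof (rule Lim_null_comparison)
  have "norm (ln v * ln (1 + v)) \<le> 2 * sqrt v" if v: "0 < v" "v < 1" for v :: real
  proof -
    have "ln (1 / sqrt v) \<le> 1 / sqrt v - 1" using v by (intro ln_le_minus_one) simp
    moreover have "ln (1 / sqrt v) = - (ln v / 2)" using v by (simp add: ln_div ln_sqrt)
    ultimately have "- ln v \<le> 2 * (1 / sqrt v)" by linarith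
    moreover have "\<bar>ln v\<bar> = - ln v" using v by simp
    ultimately have 1: "\<bar>ln v\<bar> \<le> 2 * (1 / sqrt v)" by linarith
    have 2: "\<bar>ln (1 + v)\<bar> \<le> v" using v ln_add_one_self_le_self[of v] by simp
    have "norm (ln v * ln (1 + v)) \<le> 2 * (1 / sqrt v) * v"
      unfolding real_norm_def abs_mult using v by (intro mult_mono 1 2) simp_all
    also have "\<dots> = 2 * sqrt v" using v real_div_sqrt[of v] by simp
    finally show ?thesis .
  qed
  then show "\<forall>\<^sub>F v::real in at_right 0. norm (ln v * ln (1 + v)) \<le> 2 * sqrt v"
    unfolding eventually_at_right_field by (intro exI[of _ 1]) simp
  have "((\<lambda>v::real. 2 * sqrt v) \<longlongrightarrow> 2 * sqrt 0) (at_right 0)" by (intro tendsto_intros)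
  then show "((\<lambda>v::real. 2 * sqrt v) \<longlongrightarrow> 0) (at_right 0)" by simp
qed

lemma tendsto_imp_const_eq:
  fixes f :: "real \<Rightarrow> complex"
  assumes "(f \<longlongrightarrow> l) (at_right 0)" "\<forall>\<^sub>F v in at_right 0. f v = K"
  shows "K = l"
proof -
  have "((\<lambda>_. K) \<longlongrightarrow> l) (at_right (0::real))" by (rule Lim_transform_eventually[OF assms])
  then show ?thesis by (simp only: tendsto_const_iff[OF trivial_limit_at_right_real])
qed

theorem theorem4p1:
  fixes x y :: complex
    and \<gamma>0 :: "(real \<Rightarrow> complex \<times> complex) set"
    and \<gamma> :: "nat \<Rightarrow> (real \<Rightarrow> complex) set"
  assumes "(x, y) \<in> V"
    and "\<gamma>0 \<in> pi1 V tbv (Pt (x, y))"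
    and "\<And>i. i \<in> {1..9} \<Longrightarrow> \<gamma> i = path_system (x, y) \<gamma>0 i"
  shows "(Li2 (x * (1 - y) / (y * (1 - x))) (\<gamma> 4) - Li2 y (\<gamma> 9) + Li2 x (\<gamma> 8)
           - Li2 (x / y) (\<gamma> 3) - Li2 ((1 - y) / (1 - x)) (\<gamma> 6)
         = log_along y (\<gamma> 9) * log_along ((1 - y) / (1 - x)) (\<gamma> 6) - (of_real pi)\<^sup>2 / 6)
       \<and> (Li2 (x * (1 - y)\<^sup>2 / (y * (1 - x)\<^sup>2)) (\<gamma> 1) - Li2 (x * (1 - y) / (x - 1)) (\<gamma> 5)
           - Li2 ((1 - y) / (y * (x - 1))) (\<gamma> 7) - Li2 (x * (1 - y) / (y * (1 - x))) (\<gamma> 4)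
           - Li2 ((1 - y) / (1 - x)) (\<gamma> 6)
         = 1 / 2 * (log_along y (\<gamma> 9))\<^sup>2)
       \<and> (Li2 ((1 - y) / (y * (x - 1))) (\<gamma> 7) + Li2 (x * y) (\<gamma> 2) - Li2 x (\<gamma> 8)
           - Li2 y (\<gamma> 9) - Li2 (x * (1 - y) / (x - 1)) (\<gamma> 5)
         = - ((of_real pi)\<^sup>2 / 6) + log_along y (\<gamma> 9) * log_along ((1 - y) / (1 - x)) (\<gamma> 6)
           - 1 / 2 * (log_along y (\<gamma> 9))\<^sup>2)"
proof -
  define I where "I = (\<lambda>i. Li2 (Vmap i (x, y)) (path_system (x, y) \<gamma>0 i))"
  define l where "l = (\<lambda>i. log_along (Vmap i (x, y)) (path_system (x, y) \<gamma>0 i))"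
  define D where "D = (\<lambda>i v. dilog (vcurve i (vparam i v)))"
  \<comment> \<open>Up to sign, \<open>R\<close> is the product of the two logarithms at \<open>(v\<^sup>2, v)\<close>; \<open>S\<close> is the difference of \<open>(ln (v (1 + v)))\<^sup>2 / 2\<close>
    and \<open>(ln v)\<^sup>2 / 2\<close>. Both divergent squares cancel once \<open>D 7\<close> is replaced by means of the inversion formula.\<close>
  define R where "R = (\<lambda>v::real. ln v * ln (1 + v))"
  define S where "S = (\<lambda>v::real. ln v * ln (1 + v) + (ln (1 + v))\<^sup>2 / 2)"
  define N where "N = (\<lambda>v::real. dilog (of_real (- (v * (1 + v)))))"
  let ?z = "(of_real pi)\<^sup>2 / 6 :: complex"
  have "\<forall>\<^sub>F v::real in at_right 0. 0 < v \<and> v < 1 / 10"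
    unfolding eventually_at_right_field by (intro exI[of _ "1 / 10"]) simp
  then have ev: "\<forall>\<^sub>F v in at_right 0.
      D 4 v - D 9 v + D 8 v - D 3 v - D 6 v + of_real (R v) = I 4 - I 9 + I 8 - I 3 - I 6 - l 9 * l 6 \<and>
      D 1 v - D 5 v - D 4 v - D 6 v + ?z + N v + of_real (S v) = I 1 - I 5 - I 7 - I 4 - I 6 - 1 / 2 * (l 9 * l 9) \<and>
      - ?z - N v - of_real (S v) + D 2 v - D 8 v - D 9 v - D 5 v + of_real (R v)
        = I 7 + I 2 - I 8 - I 9 - I 5 - l 9 * l 6 + 1 / 2 * (l 9 * l 9)"
    using curve_then_in_class[OF assms(2)]
  proof eventually_elim
    case (elim v)
    then obtain P where v: "0 < v" "v < 1 / 10" and P: "polynomial_function P" "P 0 = (of_real (v\<^sup>2), of_real v)"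
      "curve_then v P \<in> \<gamma>0" "P ` {0..1} \<subseteq> V" by blast
    have pos: "0 < 1 - v" "0 < 1 + v" using v by auto
    have sq: "1 - v\<^sup>2 = (1 - v) * (1 + v)" by (simp add: power2_eq_square algebra_simps)
    have lns: "ln (1 - v\<^sup>2) = ln (1 - v) + ln (1 + v)" "ln (v * (1 + v)) = ln v + ln (1 + v)"
      unfolding sq using v(1) pos by (simp_all add: ln_mult)
    have R: "ln v * (ln (1 - v) - ln (1 - v\<^sup>2)) = - R v" unfolding R_def lns by simp
    have S: "(ln (v * (1 + v)))\<^sup>2 / 2 = S v + (ln v)\<^sup>2 / 2"
      unfolding S_def lns by (simp add: power2_eq_square field_simps)
    have D7: "D 7 v = - ?z - N v - (of_real (S v) + of_real ((ln v)\<^sup>2 / 2))"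
      unfolding D_def N_def dilog_vcurve_7[OF v(1)] S of_real_add ..
    have 1: "I 4 - I 9 + I 8 - I 3 - I 6 - l 9 * l 6
       = D 4 v - D 9 v + D 8 v - D 3 v - D 6 v - of_real (- R v)"
      unfolding I_def l_def D_def R[symmetric] by (rule equations_at_parameter(1)[OF assms(1,2) v P])
    have 2: "I 1 - I 5 - I 7 - I 4 - I 6 - 1 / 2 * (l 9 * l 9)
       = D 1 v - D 5 v - D 7 v - D 4 v - D 6 v - of_real ((ln v)\<^sup>2 / 2)"
      unfolding I_def l_def D_def by (rule equations_at_parameter(2)[OF assms(1,2) v P])
    have 3: "I 7 + I 2 - I 8 - I 9 - I 5 - l 9 * l 6 + 1 / 2 * (l 9 * l 9)
       = D 7 v + D 2 v - D 8 v - D 9 v - D 5 v - of_real (- R v) + of_real ((ln v)\<^sup>2 / 2)"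
      unfolding I_def l_def D_def R[symmetric] by (rule equations_at_parameter(3)[OF assms(1,2) v P])
    show ?case unfolding 1 2 3 D7 by (simp add: algebra_simps)
  qed
  have Dl: "(D i \<longlongrightarrow> 0) (at_right 0)" if "i \<noteq> 6" "i \<noteq> 7" for i
    unfolding D_def by (rule tendsto_dilog_vcurve[OF that])
  have D6: "(D 6 \<longlongrightarrow> ?z) (at_right 0)"
    unfolding D_def by (rule tendsto_dilog_vcurve_6)
  have lR: "((\<lambda>v. complex_of_real (R v)) \<longlongrightarrow> of_real 0) (at_right 0)"
    unfolding R_def by (intro tendsto_of_real tendsto_ln_mult_ln)
  have "((\<lambda>v. R v + (ln (1 + v))\<^sup>2 / 2) \<longlongrightarrow> 0 + (ln (1 + 0))\<^sup>2 / 2) (at_right 0)"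
    unfolding R_def by (intro tendsto_intros tendsto_ln_mult_ln) auto
  then have lS: "((\<lambda>v. complex_of_real (S v)) \<longlongrightarrow> of_real 0) (at_right 0)"
    unfolding S_def R_def by (intro tendsto_of_real) simp
  have "((\<lambda>v. complex_of_real (- (v * (1 + v)))) \<longlongrightarrow> of_real (- (0 * (1 + 0)))) (at_right 0)"
    by (intro tendsto_intros)
  then have lN: "(N \<longlongrightarrow> 0) (at_right 0)"
    unfolding N_def by (intro tendsto_dilog_0) simp
  have "I 4 - I 9 + I 8 - I 3 - I 6 - l 9 * l 6 = 0 - 0 + 0 - 0 - ?z + of_real 0"
  proof (rule tendsto_imp_const_eq)
    show "((\<lambda>v. D 4 v - D 9 v + D 8 v - D 3 v - D 6 v + of_real (R v)) \<longlongrightarrow> 0 - 0 + 0 - 0 - ?z + of_real 0) (at_right 0)"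
      by (intro tendsto_add tendsto_diff Dl D6 lR) simp_all
  qed (use ev in \<open>auto elim: eventually_mono\<close>)
  moreover have "I 1 - I 5 - I 7 - I 4 - I 6 - 1 / 2 * (l 9 * l 9) = 0 - 0 - 0 - ?z + ?z + 0 + of_real 0"
  proof (rule tendsto_imp_const_eq)
    show "((\<lambda>v. D 1 v - D 5 v - D 4 v - D 6 v + ?z + N v + of_real (S v)) \<longlongrightarrow> 0 - 0 - 0 - ?z + ?z + 0 + of_real 0) (at_right 0)"
      by (intro tendsto_add tendsto_diff tendsto_const Dl D6 lS lN) simp_all
  qed (use ev in \<open>auto elim: eventually_mono\<close>)
  moreover have "I 7 + I 2 - I 8 - I 9 - I 5 - l 9 * l 6 + 1 / 2 * (l 9 * l 9)
      = - ?z - 0 - of_real 0 + 0 - 0 - 0 - 0 + of_real 0"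
  proof (rule tendsto_imp_const_eq)
    show "((\<lambda>v. - ?z - N v - of_real (S v) + D 2 v - D 8 v - D 9 v - D 5 v + of_real (R v)) \<longlongrightarrow>
       - ?z - 0 - of_real 0 + 0 - 0 - 0 - 0 + of_real 0) (at_right 0)"
      by (intro tendsto_add tendsto_diff tendsto_const Dl lR lS lN) simp_all
  qed (use ev in \<open>auto elim: eventually_mono\<close>)
  ultimately have key: "I 4 - I 9 + I 8 - I 3 - I 6 - l 9 * l 6 = - ?z"
    "I 1 - I 5 - I 7 - I 4 - I 6 - 1 / 2 * (l 9 * l 9) = 0"
    "I 7 + I 2 - I 8 - I 9 - I 5 - l 9 * l 6 + 1 / 2 * (l 9 * l 9) = - ?z"
    by simp_all
  have vals: "Li2 (x * (1 - y) / (y * (1 - x))) (\<gamma> 4) = I 4" "Li2 y (\<gamma> 9) = I 9" "Li2 x (\<gamma> 8) = I 8"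
    "Li2 (x / y) (\<gamma> 3) = I 3" "Li2 ((1 - y) / (1 - x)) (\<gamma> 6) = I 6"
    "Li2 (x * (1 - y)\<^sup>2 / (y * (1 - x)\<^sup>2)) (\<gamma> 1) = I 1" "Li2 (x * (1 - y) / (x - 1)) (\<gamma> 5) = I 5"
    "Li2 ((1 - y) / (y * (x - 1))) (\<gamma> 7) = I 7" "Li2 (x * y) (\<gamma> 2) = I 2"
    "log_along y (\<gamma> 9) = l 9" "log_along ((1 - y) / (1 - x)) (\<gamma> 6) = l 6"
    using assms(3) by (simp_all add: I_def l_def Vmap_def)
  have solve: "a = p - z" if "a - p = - z" for a p z :: complex
    using that by (metis add_uminus_conv_diff diff_eq_eq add.commute)
  have solve2: "a = - z + p - q" if "a - p + q = - z" for a p q z :: complex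
  proof -
    have "a = (a - p + q) + p - q" by simp
    then show ?thesis using that by simp
  qed
  show ?thesis
    unfolding vals power2_eq_square[of "l 9"]
    using solve[OF key(1)] key(2) solve2[OF key(3)] by (simp only: eq_iff_diff_eq_0[symmetric] simp_thms)
qed

end
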